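(* Let $\rho=e^{\pi i/3}$. Suppose that $\mathfrak{z}\in\{i,\rho\}$, $\ell\in\mathbb{N}$, $m\geq 4+2\ell$ is an integer, and $1\leq\nu\leq 2$. If $F\in\mathcal{M}_{2-m,\mathfrak{z},\nu}$, then, for $z=x+iy\in\mathbb{H}$ with $y>\mathfrak{z}_2:=\operatorname{Im}(\mathfrak{z})$, the function $E_2^{\ell}F$ has a Fourier expansion which is a linear combination (over $\mathbb{C}$) of the expansions $F_{2k\omega_{\mathfrak{z}},j,r}(\mathfrak{z};q)$ with $k\in\mathbb{N}$, $j\in\mathbb{N}_0$, and $r\in\mathbb{N}_0$.
   Context: Notation: $\mathbb{H}$ is the complex upper half-plane, $q=e^{2\pi i z}$, $e(\alpha):=e^{2\pi i\alpha}$, $\mathfrak{z}=\mathfrak{z}_1+i\mathfrak{z}_2$ with $\mathfrak{z}_1,\mathfrak{z}_2\in\mathbb{R}$. $E_2(z)=1-24\sum_{n\ge1}\sigma_1(n)q^n$ is the weight 2 quasi-modular Eisenstein series. $\omega_{\mathfrak{z}}$ is the size of the stabilizer of $\mathfrak{z}$ in $\mathrm{PSL}_2(\mathbb{Z})$ (so $\omega_i=2$, $\omega_\rho=3$). $\mathcal{M}_{\mathfrak{z},\nu}$ denotes the space of negative weight meromorphic modular forms for $\mathrm{SL}_2(\mathbb{Z})$ whose only poles modulo $\mathrm{SL}_2(\mathbb{Z})$ are at $z=\mathfrak{z}$ and have order at most $\nu$ (in particular there is no pole at $i\infty$), and $\mathcal{M}_{\kappa,\mathfrak{z},\nu}$ is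 the subspace of forms satisfying weight $\kappa\in\mathbb{Z}$ modularity. For $\mathfrak{z}\in\{i,\rho\}$, $\mathcal{O}_{\mathbb{Q}(\mathfrak{z})}=\mathbb{Z}[\mathfrak{z}]$ is the ring of integers of $\mathbb{Q}(\mathfrak{z})$ and $N$ is the norm. A nonzero ideal is primitive if it is not divisible by any principal ideal $(g)$ with $g\in\mathbb{Z}$, $|g|>1$; $\sum^{*}_{\mathfrak{b}}$ denotes the sum over primitive ideals. Every primitive ideal is $\mathfrak{b}=(c\mathfrak{z}+d)$ with $c,d\in\mathbb{Z}$, $\gcd(c,d)=1$. For $n\in\mathbb{N}_0$ and $k\in\mathbb{N}$ divisible by $2\omega_{\mathfrak{z}}$, choosing $a,b\in\mathbb{Z}$ with $ad-bc=1$, put $$C_k(\mathfrak{b},n):=\operatorname{Re}\, e\!\left(-\frac{n}{N(\mathfrak{b})}\left(ac|\mathfrak{z}|^2+bd+\mathfrak{z}_1(ad+bc)\right)-\frac{k}{2\pi}\arg(c\mathfrak{z}+d)\right),$$ which does not depend on the choices made. For such $k$ and $j,r\in\mathbb{N}_0$ (with $0^0:=1$), $$F_{k,j,r}(\mathfrak{z};q):=\sum_{n=0}^{\infty}\ \sum^{*}_{\mathfrak{b}\subseteq\mathcal{O}_{\mathbb{Q}(\mathfrak{z})}}\frac{C_k(\mathfrak{b},n)}{N(\mathfrak{b})^{\frac{k}{2}-j}}\,n^r e^{\frac{2\pi n}{N(\mathfrak{b})}\mathfrak{z}_2}q^n.$$ *)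

theory Defs
  imports
    "HOL-Complex_Analysis.Complex_Analysis"
    "HOL-Algebra.QuotRing"
    "HOL-Algebra.Ideal_Product"
    "HOL-Algebra.Divisibility"
begin

definition upper_half_plane :: "complex set" where
  "upper_half_plane = {z. Im z > 0}"

definition nome :: "complex \<Rightarrow> complex" where
  "nome z = exp (2 * of_real pi * \<i> * z)"

definition SL2Z :: "(int ^ 2 ^ 2) set" where
  "SL2Z = {A. det A = 1}"

definition automorphy_factor :: "int ^ 2 ^ 2 \<Rightarrow> complex \<Rightarrow> complex" where
  "automorphy_factor A z = of_int (A $ 2 $ 1) * z + of_int (A $ 2 $ 2)"

definition mobius_action :: "int ^ 2 ^ 2 \<Rightarrow> complex \<Rightarrow> complex" where
  "mobius_action A z =
     (of_int (A $ 1 $ 1) * z + of_int (A $ 1 $ 2)) / automorphy_factor A z"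

(* PSL_2(Z) = SL_2(Z) / {I, -I}: its elements are the pairs {A, -A}. *)
definition PSL2_stabilizer :: "complex \<Rightarrow> (int ^ 2 ^ 2) set set" where
  "PSL2_stabilizer \<zz> = (\<lambda>A. {A, - A}) ` {A \<in> SL2Z. mobius_action A \<zz> = \<zz>}"

definition stab_order :: "complex \<Rightarrow> nat" where
  "stab_order \<zz> = card (PSL2_stabilizer \<zz>)"

definition E2 :: "complex \<Rightarrow> complex" where
  "E2 z = 1 - 24 * (\<Sum>n. of_nat (\<Sum>d | d dvd Suc n. d) * nome z ^ Suc n)"

(* Being nicely meromorphic (value 0 at the poles, continuous elsewhere) only fixes the
   representative of a meromorphic function, so that the transformation law can be
   required at every point.  The last conjunct, a q-expansion without negative exponents
   near the cusp, says that there is no pole at infinity. *)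
definition mero_forms :: "int \<Rightarrow> complex \<Rightarrow> nat \<Rightarrow> (complex \<Rightarrow> complex) set" where
  "mero_forms \<kappa> \<zz> \<nu> = {F.
     F nicely_meromorphic_on upper_half_plane \<and>
     (\<forall>A\<in>SL2Z. \<forall>z\<in>upper_half_plane.
        F (mobius_action A z) = automorphy_factor A z powi \<kappa> * F z) \<and>
     (\<forall>z\<in>upper_half_plane. is_pole F z \<longrightarrow>
        (\<exists>A\<in>SL2Z. z = mobius_action A \<zz>) \<and> zorder F z \<ge> - int \<nu>) \<and>
     (\<exists>a :: nat \<Rightarrow> complex. \<exists>Y > 0. \<forall>z. Im z > Y \<longrightarrow> (\<lambda>n. a n * nome z ^ n) sums F z)}"

definition rho :: complex where
  "rho = exp (of_real pi * \<i> / 3)"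

(* The ring Z[\<zz>], which for \<zz> = i and \<zz> = rho is the ring of integers of Q(\<zz>). *)
definition int_ring :: "complex \<Rightarrow> complex ring" where
  "int_ring \<zz> = \<lparr>carrier = {of_int a + of_int b * \<zz> | a b :: int. True},
     mult = (*), one = 1, zero = 0, add = (+)\<rparr>"

definition ideal_norm :: "complex \<Rightarrow> complex set \<Rightarrow> nat" where
  "ideal_norm \<zz> I = card (carrier (int_ring \<zz> Quot I))"

definition primitive_ideals :: "complex \<Rightarrow> complex set set" where
  "primitive_ideals \<zz> = {I. ideal I (int_ring \<zz>) \<and> I \<noteq> {0} \<and>
     (\<forall>g :: int. \<bar>g\<bar> > 1 \<longrightarrow>
        \<not> (PIdl\<^bsub>int_ring \<zz>\<^esub> (of_int g)) divides\<^bsub>ideals_set (int_ring \<zz>)\<^esub> I)}"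

definition unit_exp :: "real \<Rightarrow> complex" where
  "unit_exp \<alpha> = exp (2 * of_real pi * \<i> * of_real \<alpha>)"

(* gcd c d = 1 follows from a * d - b * c = 1.  For \<zz> = i, rho, primitive I and k divisible
   by 2 * stab_order \<zz>, a quadruple exists and the value of C_coeff does not depend on it. *)
definition generating_quadruple ::
    "complex \<Rightarrow> complex set \<Rightarrow> int \<times> int \<times> int \<times> int \<Rightarrow> bool" where
  "generating_quadruple \<zz> I = (\<lambda>(a, b, c, d).
     a * d - b * c = 1 \<and> I = PIdl\<^bsub>int_ring \<zz>\<^esub> (of_int c * \<zz> + of_int d))"

definition C_coeff :: "complex \<Rightarrow> nat \<Rightarrow> complex set \<Rightarrow> nat \<Rightarrow> real" where
  "C_coeff \<zz> k I n =
     (let (a, b, c, d) = (SOME t. generating_quadruple \<zz> I t) in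
      Re (unit_exp (- (real n / real (ideal_norm \<zz> I)) *
               (of_int (a * c) * (cmod \<zz>)\<^sup>2 + of_int (b * d) + Re \<zz> * of_int (a * d + b * c))
             - real k / (2 * pi) * Arg (of_int c * \<zz> + of_int d))))"

definition F_term ::
    "complex \<Rightarrow> nat \<Rightarrow> nat \<Rightarrow> nat \<Rightarrow> complex \<Rightarrow> nat \<Rightarrow> complex set \<Rightarrow> complex" where
  "F_term \<zz> k j r q n I =
     of_real (C_coeff \<zz> k I n / real (ideal_norm \<zz> I) powr (real k / 2 - real j)
              * real n ^ r * exp (2 * pi * real n / real (ideal_norm \<zz> I) * Im \<zz>)) * q ^ n"

definition F_series :: "complex \<Rightarrow> nat \<Rightarrow> nat \<Rightarrow> nat \<Rightarrow> complex \<Rightarrow> complex" where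
  "F_series \<zz> k j r q = (\<Sum>n. \<Sum>\<^sub>\<infinity>I\<in>primitive_ideals \<zz>. F_term \<zz> k j r q n I)"

(* Without this, F_series may be a default value rather than the value of a series. *)
definition F_converges :: "complex \<Rightarrow> nat \<Rightarrow> nat \<Rightarrow> nat \<Rightarrow> complex \<Rightarrow> bool" where
  "F_converges \<zz> k j r q \<longleftrightarrow>
     (\<forall>n. F_term \<zz> k j r q n summable_on primitive_ideals \<zz>) \<and>
     summable (\<lambda>n. \<Sum>\<^sub>\<infinity>I\<in>primitive_ideals \<zz>. F_term \<zz> k j r q n I)"

end

theory Submission
  imports Defs
begin

text \<open>
  Write \<open>f = E2 ^ l * F\<close> and fix a point \<open>z\<close> far up in the half-plane.
  Let \<open>k(w) = 1 / (1 - e(z - w))\<close>, the Cauchy kernel of the cylinder: it is 1-periodic in \<open>w\<close>, has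
  a simple pole at \<open>z\<close>, and vanishes at the cusp. Average \<open>E2 ^ l * k\<close> over the modular group
  modulo translations with automorphy factor \<open>j ^ (-m)\<close>. Because \<open>E2\<close> is quasimodular, the term of
  a bottom row \<open>(c, d)\<close> is \<open>O(|j| ^ (2 * l - m))\<close>, and \<open>m \<ge> 4 + 2 * l\<close> makes the sum
  \<open>H\<close> converge absolutely; it transforms with weight \<open>m\<close>. Hence \<open>Phi = F * H\<close> has weight 2, so
  \<open>Phi dw\<close> is an invariant differential, and the residue theorem on the modular curve relates its
  residues at \<open>z\<close> and at the elliptic point (\<open>residue_formula\<close>). The residue at \<open>z\<close> is a
  multiple of \<open>f z\<close>; the one at \<open>\<zz>\<close> is \<open>a * H' \<zz> + b * H \<zz>\<close>, since \<open>F\<close> has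
  a pole of order at most 2 there.

  Instead of a fundamental domain, the residue theorem is used through periods: the integral over one
  period of a 1-periodic holomorphic function on a horizontal strip does not depend on the path. It jumps by a residue
  when the strip crosses a pole (\<open>period_jump\<close>), it vanishes at the cusp, and the elliptic element
  \<open>w \<mapsto> 1 / (t - w)\<close> fixing \<open>\<zz>\<close> (with \<open>t = 0\<close> for \<open>\<i>\<close> and \<open>t = 1\<close> for \<open>rho\<close>)
  forces the period below \<open>\<zz>\<close> to be \<open>-(\<omega> - 1)\<close> times the period above it
  (\<open>elliptic_period_relation\<close>).

  To evaluate \<open>H\<close> and \<open>H'\<close> at \<open>\<zz>\<close>, note that the nonholomorphic completion of \<open>E2\<close> vanishes at \<open>\<zz>\<close>.
  Consequently \<open>E2 (\<gamma> \<zz>)\<close> is a constant times the norm \<open>N\<close> of \<open>j = c * \<zz> + d\<close>, and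
  \<open>E2' (\<gamma> \<zz>)\<close> is a combination of \<open>j ^ 4\<close> and \<open>N ^ 2\<close> (\<open>E2_moebius_zz\<close>,
  \<open>deriv_E2_moebius_zz\<close>). Every term of the residue is therefore a combination of four expressions
  \<open>N ^ J * j ^ (-K)\<close> times the kernel or its derivative at \<open>\<gamma> \<zz>\<close>; expanding the kernel in powers of \<open>q\<close>
  gives four \<open>q\<close>-series (\<open>kterm_sum\<close>), and analytic continuation
  extends the identity to \<open>Im z > Im \<zz>\<close> (\<open>quasimodular_expansion\<close>).

  The ring of integers is Euclidean, so primitive ideals are the orbits of coprime
  pairs under the \<open>2 * \<omega>\<close> units. Multiplying \<open>j\<close> by a unit multiplies a term by the power \<open>-K\<close> of
  that unit: if \<open>2 * \<omega>\<close> does not divide \<open>K\<close> the series vanishes, and otherwise the sum over pairs is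
  \<open>2 * \<omega>\<close> times a sum over ideals. Complex conjugation permutes the pairs, so only real
  parts survive, which are the coefficients \<open>C_coeff\<close> (\<open>F_series_eq\<close>).
\<close>

section \<open>Lattice sums and the cotangent series\<close>

text \<open>Infinite sums over integers and pairs are unconditional sums (\<open>has_sum\<close>) throughout.\<close>

no_notation Infinite_Set_Sum.abs_summable_on (infix \<open>abs'_summable'_on\<close> 50)

lemma has_sum_int_split:
  fixes f :: "int \<Rightarrow> 'a :: {topological_comm_monoid_add, t2_space}"
  assumes "((\<lambda>n::nat. f (int n)) has_sum a) UNIV"
      and "((\<lambda>n::nat. f (- int (Suc n))) has_sum b) UNIV"
    shows "(f has_sum (a + b)) UNIV"
proof -
  have 1: "(f has_sum a) (range int)"
    using assms(1) by (subst has_sum_reindex) (auto simp: o_def)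
  have 2: "(f has_sum b) (range (\<lambda>n. - int (Suc n)))"
    using assms(2) by (subst has_sum_reindex) (auto simp: o_def inj_on_def)
  have U: "range int \<union> range (\<lambda>n. - int (Suc n)) = UNIV"
  proof (intro equalityI subsetI UNIV_I)
    fix x :: int
    show "x \<in> range int \<union> range (\<lambda>n. - int (Suc n))"
      by (cases x) auto
  qed
  have "(f has_sum (a + b)) (range int \<union> range (\<lambda>n. - int (Suc n)))"
    by (rule has_sum_Un_disjoint[OF 1 2]) auto
  thus ?thesis unfolding U .
qed

lemma has_sum_nonzero_int_split:
  fixes f :: "int \<Rightarrow> 'a :: {topological_comm_monoid_add, t2_space}"
  assumes "((\<lambda>n::nat. f (int (Suc n))) has_sum a) UNIV"
      and "((\<lambda>n::nat. f (- int (Suc n))) has_sum b) UNIV"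
    shows "(f has_sum (a + b)) (-{0})"
proof -
  have 1: "(f has_sum a) (range (\<lambda>n. int (Suc n)))"
    using assms(1) by (subst has_sum_reindex) (auto simp: o_def inj_on_def)
  have 2: "(f has_sum b) (range (\<lambda>n. - int (Suc n)))"
    using assms(2) by (subst has_sum_reindex) (auto simp: o_def inj_on_def)
  have U: "range (\<lambda>n. int (Suc n)) \<union> range (\<lambda>n. - int (Suc n)) = -{0}"
  proof (intro equalityI subsetI)
    fix x :: int assume "x \<in> -{0}"
    thus "x \<in> range (\<lambda>n. int (Suc n)) \<union> range (\<lambda>n. - int (Suc n))"
      by (cases x rule: int_cases3) (auto simp: image_iff intro: exI[of _ "nat \<bar>x\<bar> - 1"])
  qed auto
  have "(f has_sum (a + b)) (range (\<lambda>n. int (Suc n)) \<union> range (\<lambda>n. - int (Suc n)))"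
    by (rule has_sum_Un_disjoint[OF 1 2]) auto
  thus ?thesis unfolding U .
qed

text \<open>The factor by which the taxicab norm of \<open>(c, d)\<close> can exceed \<open>\<bar>c * w + d\<bar>\<close>. It is explicit so that
  it is visibly bounded for \<open>Re w\<close> bounded and \<open>Im w\<close> bounded away from 0.\<close>

definition lattice_const :: "complex \<Rightarrow> real" where
  "lattice_const w = 1 + (1 + \<bar>Re w\<bar>) / Im w"

lemma lattice_lower_bound:
  assumes "Im w > 0"
  shows "\<bar>c\<bar> + \<bar>d\<bar> \<le> lattice_const w * cmod (of_real c * w + of_real d)"
proof -
  let ?j = "of_real c * w + of_real d"
  have "\<bar>c\<bar> * Im w = \<bar>Im ?j\<bar>" using assms by (simp add: abs_mult)
  also have "\<dots> \<le> cmod ?j" by (rule abs_Im_le_cmod)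
  finally have c: "\<bar>c\<bar> \<le> cmod ?j / Im w" using assms by (simp add: field_simps)
  have "\<bar>d\<bar> \<le> \<bar>c * Re w + d\<bar> + \<bar>c\<bar> * \<bar>Re w\<bar>"
    using abs_triangle_ineq4[of "c * Re w + d" "c * Re w"] by (simp add: abs_mult)
  also have "c * Re w + d = Re ?j" by simp
  also have "\<bar>Re ?j\<bar> \<le> cmod ?j" by (rule abs_Re_le_cmod)
  also have "\<bar>c\<bar> * \<bar>Re w\<bar> \<le> cmod ?j / Im w * \<bar>Re w\<bar>"
    by (intro mult_right_mono c) auto
  finally have d: "\<bar>d\<bar> \<le> cmod ?j + cmod ?j / Im w * \<bar>Re w\<bar>" by simp
  show ?thesis using c d unfolding lattice_const_def
    by (simp add: algebra_simps add_divide_distrib)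
qed

lemma lattice_const_ge_1: "Im w > 0 \<Longrightarrow> lattice_const w \<ge> 1"
  by (simp add: lattice_const_def)

lemma summable_on_int_powr:
  assumes "s > 1"
  shows "(\<lambda>n::int. (1 + \<bar>real_of_int n\<bar>) powr (-s)) summable_on UNIV"
proof -
  have 1: "summable (\<lambda>n. (1 + real n) powr (-s))"
    using summable_real_powr_iff[of "-s"] assms
    by (subst (asm) summable_Suc_iff [symmetric]) (simp add: add.commute)
  have 2: "summable (\<lambda>n. (1 + real (Suc n)) powr (-s))"
    using summable_Suc_iff[of "\<lambda>n. (1 + real n) powr (-s)"] 1 by simp
  have a: "(\<lambda>n. (1 + real n) powr (-s)) summable_on UNIV"
    by (rule summable_nonneg_imp_summable_on[OF 1]) auto
  have b: "(\<lambda>n. (1 + real (Suc n)) powr (-s)) summable_on UNIV"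
    by (rule summable_nonneg_imp_summable_on[OF 2]) auto
  have "((\<lambda>n::int. (1 + \<bar>real_of_int n\<bar>) powr (-s)) has_sum
     ((\<Sum>\<^sub>\<infinity>n::nat. (1 + real n) powr (-s)) + (\<Sum>\<^sub>\<infinity>n::nat. (1 + real (Suc n)) powr (-s)))) UNIV"
    by (rule has_sum_int_split) (use a b in \<open>simp_all add: has_sum_infsum\<close>)
  thus ?thesis by (rule has_sum_imp_summable)
qed

text \<open>The exponent 3 exceeds the dimension 2: the product \<open>(1 + \<bar>c\<bar>) * (1 + \<bar>d\<bar>)\<close> is at most four times the square
  of the taxicab norm, so the summand is dominated by a product of two summable powers with exponent 3/2.\<close>

lemma summable_on_lattice:
  "(\<lambda>(c::int, d::int). 1 / (\<bar>real_of_int c\<bar> + \<bar>real_of_int d\<bar>) ^ 3) summable_on (- {(0, 0)})"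
proof -
  let ?a = "\<lambda>n::int. (1 + \<bar>real_of_int n\<bar>) powr (-(3/2))"
  have a: "?a summable_on UNIV" by (rule summable_on_int_powr) auto
  have "(\<lambda>(c, d). 8 * (?a c * ?a d)) summable_on (UNIV \<times> UNIV)"
  proof (rule summable_on_SigmaI)
    show "((\<lambda>d. case (c, d) of (c, d) \<Rightarrow> 8 * (?a c * ?a d)) has_sum 8 * (?a c * infsum ?a UNIV)) UNIV" for c
      unfolding prod.case by (intro has_sum_cmult_right has_sum_infsum a)
    show "(\<lambda>c. 8 * (?a c * infsum ?a UNIV)) summable_on UNIV"
      by (intro summable_on_cmult_right summable_on_cmult_left a)
  qed auto
  hence s: "(\<lambda>(c, d). 8 * (?a c * ?a d)) summable_on (- {(0, 0)})"
    by (rule summable_on_subset_banach) auto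
  show ?thesis
  proof (rule summable_on_comparison_test[OF s])
    fix x :: "int \<times> int" assume x: "x \<in> - {(0, 0)}"
    obtain c d where cd: "x = (c, d)" by (cases x)
    have nz: "c = 0 \<longrightarrow> d \<noteq> 0" using x cd by auto
    define S where "S = \<bar>real_of_int c\<bar> + \<bar>real_of_int d\<bar>"
    have "\<bar>c\<bar> + \<bar>d\<bar> \<ge> 1" using nz by auto
    hence S: "S \<ge> 1" unfolding S_def by linarith
    have "(1 + \<bar>real_of_int c\<bar>) * (1 + \<bar>real_of_int d\<bar>) \<le> (2 * S) * (2 * S)"
      by (intro mult_mono) (use S in \<open>auto simp: S_def\<close>)
    also have "\<dots> = (2 * S) powr 2" using S by (simp add: power2_eq_square)
    finally have "((2 * S) powr 2) powr (-(3/2)) \<le>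
        ((1 + \<bar>real_of_int c\<bar>) * (1 + \<bar>real_of_int d\<bar>)) powr (-(3/2))"
      by (intro powr_mono2') (auto simp: add_pos_nonneg)
    also have "\<dots> = ?a c * ?a d" by (rule powr_mult)
    finally have "(2 * S) powr (- 3) \<le> ?a c * ?a d" unfolding powr_powr by simp
    moreover have "(2 * S) powr (- 3) = 1 / (8 * S ^ 3)"
      using S by (simp add: powr_minus powr_numeral power_mult_distrib divide_simps)
    ultimately have "1 / (8 * S ^ 3) \<le> ?a c * ?a d" by simp
    hence "8 * (1 / (8 * S ^ 3)) \<le> 8 * (?a c * ?a d)" by (rule mult_left_mono) simp
    hence le: "1 / S ^ 3 \<le> 8 * (?a c * ?a d)" by (simp only: mult.assoc times_divide_eq_right mult_1_right nonzero_mult_divide_mult_cancel_left)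
    thus "(case x of (c, d) \<Rightarrow> 1 / (\<bar>real_of_int c\<bar> + \<bar>real_of_int d\<bar>) ^ 3) \<le> (case x of (c, d) \<Rightarrow> 8 * (?a c * ?a d))"
      unfolding S_def cd prod.case .
  qed (simp add: case_prod_unfold)
qed

text \<open>The logarithmic derivative of the reflection formula of the Gamma function.\<close>

lemma cot_eq_Digamma:
  fixes z :: complex
  assumes "z \<notin> \<int>"
  shows "of_real pi * cot (of_real pi * z) = Digamma (1 - z) - Digamma z"
proof -
  have z1: "z \<notin> \<int>\<^sub>\<le>\<^sub>0" "1 - z \<notin> \<int>\<^sub>\<le>\<^sub>0"
    using assms Ints_diff[of 1 "1 - z"] by (auto dest!: nonpos_Ints_Int)
  have s: "sin (of_real pi * z) \<noteq> 0"
    using assms by (auto simp: sin_eq_0 mult.commute)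
  have 1: "((\<lambda>z. rGamma z * rGamma (1 - z)) has_field_derivative
     (- rGamma z * Digamma z) * rGamma (1 - z) + (- (- rGamma (1 - z) * Digamma (1 - z))) * rGamma z) (at z)"
    by (rule derivative_eq_intros has_field_derivative_rGamma_no_nonpos_int z1
        DERIV_chain2[where f = rGamma] refl | simp)+
  have 2: "((\<lambda>z. sin (of_real pi * z) / of_real pi) has_field_derivative cos (of_real pi * z)) (at z)"
    by (auto intro!: derivative_eq_intros)
  have "(- rGamma z * Digamma z) * rGamma (1 - z) + (- (- rGamma (1 - z) * Digamma (1 - z))) * rGamma z = cos (of_real pi * z)"
    by (rule DERIV_unique[OF 1]) (use 2 in \<open>simp add: rGamma_reflection_complex\<close>)
  hence "(rGamma z * rGamma (1 - z)) * (Digamma (1 - z) - Digamma z) = cos (of_real pi * z)"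
    by (simp add: algebra_simps)
  thus ?thesis using s by (simp add: rGamma_reflection_complex cot_def field_simps)
qed

text \<open>The partial fractions of the cotangent, obtained by pairing the poles \<open>n\<close> and \<open>-n\<close> in the two Digamma series.\<close>

lemma cot_sums:
  fixes z :: complex
  assumes "z \<notin> \<int>"
  shows "(\<lambda>n. 2 * z / (z\<^sup>2 - of_nat (Suc n) ^ 2)) sums (of_real pi * cot (of_real pi * z) - 1 / z)"
proof -
  have nz: "z \<noteq> 0" "1 - z \<noteq> 0" using assms by auto
  have nz': "z + of_int k \<noteq> 0" for k
    using assms Ints_of_int[of "-k"] by (auto simp: add_eq_0_iff2)
  have s: "(\<lambda>n. inverse (z + of_nat n) - inverse (1 - z + of_nat n)) sums (Digamma (1 - z) - Digamma z)"
    using sums_diff[OF summable_sums[OF summable_Digamma[OF nz(2)]] summable_sums[OF summable_Digamma[OF nz(1)]]]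
    by (simp add: Digamma_def)
  let ?S = "\<lambda>N. \<Sum>n<N. inverse (z + of_nat n) - inverse (1 - z + of_nat n)"
  let ?T = "\<lambda>N. \<Sum>n<N. 2 * z / (z\<^sup>2 - of_nat (Suc n) ^ 2)"
  have eq: "?T N = ?S N - 1 / z + inverse (z + of_nat N)" for N
  proof (induction N)
    case (Suc N)
    have d: "z - (1 + of_nat N) \<noteq> 0" "z + (1 + of_nat N) \<noteq> 0" "1 - z + of_nat N \<noteq> 0"
      using nz'[of "- (1 + int N)"] nz'[of "1 + int N"] by (auto simp: algebra_simps)
    have "z\<^sup>2 - of_nat (Suc N) ^ 2 = (z - (1 + of_nat N)) * (z + (1 + of_nat N))"
      by (simp add: power2_eq_square algebra_simps)
    hence "2 * z / (z\<^sup>2 - of_nat (Suc N) ^ 2) =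
             inverse (z + (1 + of_nat N)) + inverse (z - (1 + of_nat N))"
      using d by (simp add: divide_simps)
    also have "inverse (z - (1 + of_nat N)) = - inverse (1 - z + of_nat N)"
      by (subst inverse_minus_eq [symmetric]) (simp add: algebra_simps)
    finally have "2 * z / (z\<^sup>2 - of_nat (Suc N) ^ 2) =
        inverse (z + (1 + of_nat N)) - inverse (1 - z + of_nat N)" by simp
    hence t: "2 * z / (z\<^sup>2 - of_nat (Suc N) ^ 2) =
        inverse (z + of_nat (Suc N)) - inverse (1 - z + of_nat N)" by (simp add: algebra_simps)
    show ?case unfolding sum.lessThan_Suc t Suc by (simp add: algebra_simps)
  qed (simp add: divide_inverse)
  have lim: "(\<lambda>N. inverse (z + of_nat N)) \<longlonglongrightarrow> 0"
    by (rule tendsto_inverse_0[THEN filterlim_compose])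
       (intro tendsto_add_filterlim_at_infinity[OF tendsto_const] tendsto_of_nat)
  have "?S \<longlonglongrightarrow> Digamma (1 - z) - Digamma z" using s by (simp add: sums_def)
  hence "?T \<longlonglongrightarrow> (Digamma (1 - z) - Digamma z) - 1 / z + 0"
    unfolding eq by (intro tendsto_intros lim)
  thus ?thesis by (simp add: sums_def cot_eq_Digamma[OF assms])
qed

lemma abs_summable_inverse_square_shift:
  assumes "Im z > 0"
  shows "(\<lambda>n::int. 1 / (z + of_int n)\<^sup>2) abs_summable_on UNIV"
proof -
  let ?L = "lattice_const z"
  have s: "(\<lambda>n::int. ?L\<^sup>2 * (1 + \<bar>real_of_int n\<bar>) powr (-2)) summable_on UNIV"
    by (intro summable_on_cmult_right summable_on_int_powr) auto
  show ?thesis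
  proof (rule summable_on_comparison_test[OF s])
    fix n :: int
    define a where "a = cmod (z + of_int n)"
    have "1 + \<bar>real_of_int n\<bar> \<le> ?L * a"
      using lattice_lower_bound[OF assms, of 1 "real_of_int n"] by (simp add: a_def)
    hence "(1 + \<bar>real_of_int n\<bar>)\<^sup>2 \<le> (?L * a)\<^sup>2"
      by (intro power_mono) auto
    hence "(1 + \<bar>real_of_int n\<bar>)\<^sup>2 \<le> ?L\<^sup>2 * a\<^sup>2"
      by (simp add: power_mult_distrib)
    moreover have "a > 0"
    proof -
      have "z + of_int n \<noteq> 0" using assms by (auto simp: complex_eq_iff)
      thus ?thesis by (simp add: a_def)
    qed
    ultimately have "1 / a\<^sup>2 \<le> ?L\<^sup>2 / (1 + \<bar>real_of_int n\<bar>)\<^sup>2"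
      by (simp add: divide_simps add_pos_nonneg)
    thus "norm (1 / (z + of_int n)\<^sup>2) \<le> ?L\<^sup>2 * (1 + \<bar>real_of_int n\<bar>) powr (-2)"
      by (simp add: a_def norm_inverse norm_power powr_minus powr_numeral divide_inverse)
  qed auto
qed

text \<open>The contribution of one row \<open>m * z + \<int>\<close> of the lattice to the conditionally convergent Eisenstein series
  of weight 2.\<close>

definition row_sum :: "complex \<Rightarrow> complex" where
  "row_sum z = (\<Sum>\<^sub>\<infinity>n::int. 1 / (z + of_int n)\<^sup>2)"

lemma inverse_square_reflect: "1 / (- z + of_int n)\<^sup>2 = 1 / (z + of_int (- n) :: complex)\<^sup>2"
proof -
  have "(- z + of_int n)\<^sup>2 = (- (z + of_int (- n)))\<^sup>2" by simp
  thus ?thesis by (simp only: power2_minus)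
qed

lemma row_sum_has_sum:
  assumes "Im z \<noteq> 0"
  shows "((\<lambda>n::int. 1 / (z + of_int n)\<^sup>2) has_sum row_sum z) UNIV"
proof (cases "Im z > 0")
  case True
  show ?thesis unfolding row_sum_def
    by (rule has_sum_infsum[OF abs_summable_summable[OF abs_summable_inverse_square_shift[OF True]]])
next
  case False
  hence "Im (-z) > 0" using assms by auto
  hence "(\<lambda>n::int. 1 / (-z + of_int n)\<^sup>2) summable_on UNIV"
    by (rule abs_summable_summable[OF abs_summable_inverse_square_shift])
  also have "?this \<longleftrightarrow> (\<lambda>n::int. 1 / (z + of_int n)\<^sup>2) summable_on UNIV"
    unfolding inverse_square_reflect
    by (rule summable_on_reindex_bij_witness[of _ uminus uminus]) auto
  finally show ?thesis unfolding row_sum_def by (rule has_sum_infsum)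
qed

lemma row_sum_uminus: "row_sum (-z) = row_sum z"
  unfolding row_sum_def inverse_square_reflect
  by (rule infsum_reindex_bij_witness[of _ uminus uminus]) auto

lemma sin_square_nome:
  "of_real pi ^ 2 / sin (of_real pi * z) ^ 2 = - 4 * of_real pi ^ 2 * nome z / (1 - nome z) ^ 2"
proof -
  define e where "e = exp (\<i> * of_real pi * z)"
  have e: "e \<noteq> 0" by (simp add: e_def)
  have n: "nome z = e\<^sup>2"
    by (simp add: e_def nome_def power2_eq_square exp_add [symmetric] algebra_simps)
  have s: "sin (of_real pi * z) = (e - inverse e) / (2 * \<i>)"
    by (simp add: sin_exp_eq e_def exp_minus mult_ac)
  have r: "e * (e - inverse e) = e\<^sup>2 - 1"
    using e by (simp add: power2_eq_square right_diff_distrib)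
  have "sin (of_real pi * z) ^ 2 * (- 4 * e\<^sup>2) = (e * (e - inverse e))\<^sup>2"
    unfolding s by (simp add: power_divide power_mult_distrib)
  also have "\<dots> = (1 - e\<^sup>2)\<^sup>2" unfolding r by (rule power2_commute)
  finally have sq: "sin (of_real pi * z) ^ 2 * (- 4 * e\<^sup>2) = (1 - e\<^sup>2)\<^sup>2" .
  show ?thesis unfolding n sq [symmetric] using e by simp
qed

lemma norm_nome: "norm (nome z) = exp (- 2 * pi * Im z)"
  by (simp add: nome_def)

lemma norm_nome_less_1: "Im z > 0 \<Longrightarrow> norm (nome z) < 1"
  by (simp add: norm_nome)

text \<open>The Lipschitz formula in closed form: differentiating the reflection formula of Digamma gives
  \<open>pi\<^sup>2 / sin\<^sup>2\<close>, a rational function of the nome.\<close>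

lemma row_sum_nome:
  assumes z: "Im z > 0"
  shows "row_sum z = - 4 * of_real pi ^ 2 * nome z / (1 - nome z) ^ 2"
proof -
  have zi: "z + of_int k \<notin> \<int>" for k
    using z by (auto elim!: Ints_cases simp: complex_eq_iff)
  from zi[of 0] have zn: "z \<notin> \<int>" by simp
  have z1: "z \<notin> \<int>\<^sub>\<le>\<^sub>0" "1 - z \<notin> \<int>\<^sub>\<le>\<^sub>0" "z \<noteq> 0" "1 - z \<noteq> 0"
    using zn Ints_diff[of 1 "1 - z"] by (auto dest!: nonpos_Ints_Int)
  have s: "sin (of_real pi * z) \<noteq> 0"
    using zn by (auto simp: sin_eq_0 mult.commute)
  have op: "open (- \<int> :: complex set)" by (simp add: closed_Ints open_Compl)
  have 1: "((\<lambda>z. Digamma (1 - z) - Digamma z) has_field_derivative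
      (- Polygamma 1 (1 - z) - Polygamma 1 z)) (at z)"
    using z1 by (auto intro!: derivative_eq_intros)
  have 2: "((\<lambda>z. of_real pi * cot (of_real pi * z)) has_field_derivative
      - (of_real pi ^ 2 / sin (of_real pi * z) ^ 2)) (at z)"
    using s by (auto intro!: derivative_eq_intros DERIV_chain2[OF DERIV_cot]
        simp: divide_simps power2_eq_square)
  have 3: "((\<lambda>z. of_real pi * cot (of_real pi * z)) has_field_derivative
      (- Polygamma 1 (1 - z) - Polygamma 1 z)) (at z)"
    by (rule has_field_derivative_transform_within_open[OF 1 op])
       (use zn cot_eq_Digamma in auto)
  from DERIV_unique[OF 2 3] have e: "of_real pi ^ 2 / sin (of_real pi * z) ^ 2 = Polygamma 1 (1 - z) + Polygamma 1 z"
    by (simp add: algebra_simps)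
  have p: "(\<lambda>k. inverse ((z + of_nat k) ^ 2)) sums Polygamma 1 z"
    using Polygamma_LIMSEQ[OF z1(3), of 1] by (simp add: numeral_2_eq_2)
  have p': "(\<lambda>k. inverse ((1 - z + of_nat k) ^ 2)) sums Polygamma 1 (1 - z)"
    using Polygamma_LIMSEQ[OF z1(4), of 1] by (simp add: numeral_2_eq_2)
  let ?f = "\<lambda>n::int. 1 / (z + of_int n)\<^sup>2"
  have as: "?f abs_summable_on UNIV" by (rule abs_summable_inverse_square_shift[OF z])
  have s1: "(\<lambda>n::nat. ?f (int n)) summable_on UNIV"
  proof -
    have "?f summable_on range int"
      by (rule summable_on_subset_banach[OF abs_summable_summable[OF as]]) auto
    thus ?thesis by (subst (asm) summable_on_reindex) (auto simp: o_def)
  qed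
  have s2: "(\<lambda>n::nat. ?f (- int (Suc n))) summable_on UNIV"
  proof -
    have "?f summable_on range (\<lambda>n. - int (Suc n))"
      by (rule summable_on_subset_banach[OF abs_summable_summable[OF as]]) auto
    thus ?thesis by (subst (asm) summable_on_reindex) (auto simp: o_def inj_on_def)
  qed
  have h1: "((\<lambda>n::nat. ?f (int n)) has_sum Polygamma 1 z) UNIV"
    using has_sum_imp_sums[OF has_sum_infsum[OF s1]] p s1
    by (simp add: divide_inverse sums_iff has_sum_iff)
  have "?f (- int (Suc n)) = inverse ((1 - z + of_nat n) ^ 2)" for n
    by (simp add: divide_inverse power2_eq_square algebra_simps)
  hence h2: "((\<lambda>n::nat. ?f (- int (Suc n))) has_sum Polygamma 1 (1 - z)) UNIV"
    using has_sum_imp_sums[OF has_sum_infsum[OF s2]] p' s2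
    by (simp add: sums_iff has_sum_iff)
  have "(?f has_sum (Polygamma 1 z + Polygamma 1 (1 - z))) UNIV"
    by (rule has_sum_int_split[OF h1 h2])
  hence "row_sum z = Polygamma 1 z + Polygamma 1 (1 - z)"
    using has_sum_unique[OF row_sum_has_sum[of z]] z by auto
  also have "\<dots> = of_real pi ^ 2 / sin (of_real pi * z) ^ 2" using e by simp
  also have "\<dots> = - 4 * of_real pi ^ 2 * nome z / (1 - nome z) ^ 2" by (rule sin_square_nome)
  finally show ?thesis .
qed

section \<open>Quasimodularity of \<open>E2\<close>\<close>

lemma nome_mult_nat: "nome (of_nat n * z) = nome z ^ n"
  by (simp add: nome_def exp_of_nat_mult [symmetric] mult_ac)

lemma nome_periodic: "nome (z + of_int n) = nome z"
proof -
  have "nome (z + of_int n) = nome z * exp (2 * of_real pi * \<i> * of_int n)"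
    by (simp add: nome_def exp_add [symmetric] algebra_simps)
  also have "exp (2 * of_real pi * \<i> * of_int n) = (1 :: complex)"
    using exp_integer_2pi[of "of_int n"] by (simp add: mult_ac)
  finally show ?thesis by simp
qed

lemma lambert_has_sum:
  fixes x :: "'a :: {real_normed_field, banach}"
  assumes "norm x < 1"
  shows "((\<lambda>n. of_nat (Suc n) * x ^ Suc n) has_sum (x / (1 - x)\<^sup>2)) UNIV"
proof -
  have 1: "(\<lambda>n. of_nat (Suc n) * y ^ Suc n) sums (y / (1 - y)\<^sup>2)"
    if "norm y < 1" for y :: "'b :: {real_normed_field, banach}"
    using sums_mult[OF geometric_deriv_sums[OF that], of y] by (simp add: mult_ac)
  have "summable (\<lambda>n. norm (of_nat (Suc n) * x ^ Suc n))"
    using 1[of "norm x"] assms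
    by (simp add: sums_iff norm_mult norm_power del: of_nat_Suc)
  moreover have "(\<lambda>n. of_nat (Suc n) * x ^ Suc n) sums (x / (1 - x)\<^sup>2)" by (rule 1[OF assms])
  ultimately show ?thesis by (rule norm_summable_imp_has_sum)
qed

text \<open>The divisor sum in the definition of \<open>E2\<close> is regrouped as a Lambert series by writing each \<open>n\<close> as a product in all
  possible ways.\<close>

lemma E2_lambert:
  assumes z: "Im z > 0"
  shows "((\<lambda>m. nome z ^ Suc m / (1 - nome z ^ Suc m)\<^sup>2) has_sum ((1 - E2 z) / 24)) UNIV"
proof -
  define q where "q = nome z"
  define r where "r = norm q"
  have r: "0 \<le> r" "r < 1" using norm_nome_less_1[OF z] by (auto simp: r_def q_def)
  have rm: "r ^ Suc m < 1" "r ^ Suc m \<le> r" for m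
    using r power_le_one[of r m] mult_left_le[of "r ^ m" r] by (auto intro: le_less_trans)
  define f where "f = (\<lambda>(m::nat, d::nat). of_nat (Suc d) * q ^ (Suc m * Suc d))"
  have "(\<lambda>(m, d). real (Suc d) * r ^ (Suc m * Suc d)) summable_on UNIV \<times> UNIV"
  proof (rule summable_on_SigmaI)
    fix m :: nat
    show "((\<lambda>d. case (m, d) of (m, d) \<Rightarrow> real (Suc d) * r ^ (Suc m * Suc d)) has_sum
            r ^ Suc m / (1 - r ^ Suc m)\<^sup>2) UNIV"
      using lambert_has_sum[of "r ^ Suc m"] rm(1)[of m] r
      unfolding prod.case power_mult by (simp del: of_nat_Suc power_Suc)
  next
    have "(\<lambda>m. r ^ Suc m / (1 - r)\<^sup>2) summable_on UNIV"
      by (rule summable_nonneg_imp_summable_on) (use r in \<open>auto intro!: summable_divide summable_mult summable_geometric\<close>)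
    thus "(\<lambda>m. r ^ Suc m / (1 - r ^ Suc m)\<^sup>2) summable_on UNIV"
    proof (rule summable_on_comparison_test)
      fix m :: nat
      have "(1 - r)\<^sup>2 \<le> (1 - r ^ Suc m)\<^sup>2"
        by (rule power_mono) (use rm[of m] r in auto)
      thus "r ^ Suc m / (1 - r ^ Suc m)\<^sup>2 \<le> r ^ Suc m / (1 - r)\<^sup>2"
        by (intro divide_left_mono mult_pos_pos zero_less_power zero_le_power) (use r rm(1)[of m] in auto)
    qed (use r in auto)
  qed (use r in auto)
  hence "(\<lambda>x. norm (f x)) summable_on UNIV \<times> UNIV"
    by (simp add: f_def r_def case_prod_unfold norm_mult norm_power del: of_nat_Suc)
  hence sf: "f summable_on UNIV \<times> UNIV" by (rule abs_summable_summable)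
  define T where "T = infsum f (UNIV \<times> UNIV)"
  have hf: "(f has_sum T) (UNIV \<times> UNIV)" unfolding T_def by (rule has_sum_infsum[OF sf])
  have A: "((\<lambda>m. q ^ Suc m / (1 - q ^ Suc m)\<^sup>2) has_sum T) UNIV"
  proof (rule has_sum_SigmaD[OF hf])
    fix m :: nat
    show "((\<lambda>d. f (m, d)) has_sum q ^ Suc m / (1 - q ^ Suc m)\<^sup>2) UNIV"
      using lambert_has_sum[of "q ^ Suc m"] rm(1)[of m]
      unfolding f_def prod.case power_mult by (simp add: norm_power r_def del: of_nat_Suc power_Suc)
  qed
  define g where "g = (\<lambda>(n, d). of_nat d * q ^ Suc n)"
  have "(g has_sum T) (Sigma UNIV (\<lambda>n. {d. d dvd Suc n})) \<longleftrightarrow> (f has_sum T) (UNIV \<times> UNIV)"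
  proof (rule has_sum_reindex_bij_witness[of _ "\<lambda>(m, d). (Suc m * Suc d - 1, Suc d)" "\<lambda>(n, d). (Suc n div d - 1, d - 1)"])
    fix a :: "nat \<times> nat" assume "a \<in> Sigma UNIV (\<lambda>n. {d. d dvd Suc n})"
    then obtain n d where a: "a = (n, d)" "d dvd Suc n" by auto
    from a(2) obtain e where e: "Suc n = d * e" by (auto elim: dvdE)
    have d: "d > 0" and e0: "e > 0" using e by (auto intro: Nat.gr0I)
    have [simp]: "Suc n div d = e" unfolding e using d by simp
    have se: "Suc (e - 1) = e" "Suc (d - 1) = d" using d e0 by auto
    show "(case case a of (n, d) \<Rightarrow> (Suc n div d - 1, d - 1) of (m, d) \<Rightarrow> (Suc m * Suc d - 1, Suc d)) = a"
      unfolding a prod.case \<open>Suc n div d = e\<close> se using e by (simp add: mult.commute)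
    show "f (case a of (n, d) \<Rightarrow> (Suc n div d - 1, d - 1)) = g a"
      unfolding a prod.case f_def g_def \<open>Suc n div d = e\<close> se using e by (simp add: mult.commute)
  qed (auto simp del: mult_Suc mult_Suc_right)
  hence hg: "(g has_sum T) (Sigma UNIV (\<lambda>n. {d. d dvd Suc n}))" using hf by blast
  have "((\<lambda>n. \<Sum>d | d dvd Suc n. g (n, d)) has_sum T) UNIV"
    by (rule has_sum_SigmaD[OF hg]) auto
  hence "(\<lambda>n. \<Sum>d | d dvd Suc n. g (n, d)) sums T" by (rule has_sum_imp_sums)
  hence "(\<lambda>n. of_nat (\<Sum>d | d dvd Suc n. d) * q ^ Suc n) sums T"
    by (simp add: g_def sum_distrib_right del: power_Suc)
  hence "E2 z = 1 - 24 * T" unfolding E2_def q_def by (simp add: sums_iff del: power_Suc)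
  hence "T = (1 - E2 z) / 24" by simp
  show ?thesis using A unfolding \<open>T = (1 - E2 z) / 24\<close> q_def .
qed

lemma E2_row_sums:
  assumes z: "Im z > 0"
  shows "((\<lambda>m. row_sum (of_nat (Suc m) * z)) has_sum (of_real pi ^ 2 / 6 * (E2 z - 1))) UNIV"
proof -
  have im: "Im (of_nat (Suc m) * z) > 0" for m using z by (simp del: of_nat_Suc)
  have 1: "row_sum (of_nat (Suc m) * z) = (- 4 * of_real pi ^ 2) * (nome z ^ Suc m / (1 - nome z ^ Suc m)\<^sup>2)" for m
    by (subst row_sum_nome[OF im]) (simp only: nome_mult_nat times_divide_eq_right)
  have 2: "((\<lambda>m. (- 4 * of_real pi ^ 2) * (nome z ^ Suc m / (1 - nome z ^ Suc m)\<^sup>2)) has_sum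
      (- 4 * of_real pi ^ 2) * ((1 - E2 z) / 24)) UNIV"
    by (rule has_sum_cmult_right[OF E2_lambert[OF z]])
  have 3: "(- 4 * of_real pi ^ 2) * ((1 - E2 z) / 24) = of_real pi ^ 2 / 6 * (E2 z - 1)"
    by (simp add: field_simps)
  show ?thesis using 2 unfolding 1 3 .
qed

text \<open>Thus \<open>E2\<close> is, up to normalisation, the weight 2 Eisenstein series summed row by row. The
  order of summation matters, and this is what makes \<open>E2\<close> quasimodular.\<close>

lemma E2_row_sums_int:
  assumes z: "Im z > 0"
  shows "((\<lambda>m::int. row_sum (of_int m * z)) has_sum (of_real pi ^ 2 / 3 * (E2 z - 1))) (-{0})"
proof -
  have 1: "((\<lambda>n::nat. row_sum (of_int (int (Suc n)) * z)) has_sum (of_real pi ^ 2 / 6 * (E2 z - 1))) UNIV"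
    using E2_row_sums[OF z] by simp
  have "row_sum (of_int (- int (Suc n)) * z) = row_sum (of_int (int (Suc n)) * z)" for n
    using row_sum_uminus[of "of_int (int (Suc n)) * z"] by (simp only: of_int_minus mult_minus_left)
  hence 2: "((\<lambda>n::nat. row_sum (of_int (- int (Suc n)) * z)) has_sum (of_real pi ^ 2 / 6 * (E2 z - 1))) UNIV"
    using 1 by simp
  have e: "of_real pi ^ 2 / 6 * (E2 z - 1) + of_real pi ^ 2 / 6 * (E2 z - 1) = of_real pi ^ 2 / 3 * (E2 z - 1)"
    by simp
  show ?thesis using has_sum_nonzero_int_split[OF 1 2] unfolding e .
qed

lemma has_sum_inverse_squares_int:
  "((\<lambda>n::int. 1 / of_int n ^ 2 :: complex) has_sum (of_real pi ^ 2 / 3)) (-{0})"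
proof -
  have "((\<lambda>n. 1 / (real n + 1)\<^sup>2) has_sum (pi\<^sup>2 / 6)) UNIV"
    using sums_nonneg_imp_has_sum[OF inverse_squares_sums] by (simp add: add.commute)
  hence "((\<lambda>n. of_real (1 / (real n + 1)\<^sup>2) :: complex) has_sum of_real (pi\<^sup>2 / 6)) UNIV"
    by (rule has_sum_of_real)
  hence 1: "((\<lambda>n::nat. 1 / of_int (int (Suc n)) ^ 2 :: complex) has_sum of_real (pi\<^sup>2 / 6)) UNIV"
    by (simp add: add.commute)
  have 2: "((\<lambda>n::nat. 1 / of_int (- int (Suc n)) ^ 2 :: complex) has_sum of_real (pi\<^sup>2 / 6)) UNIV"
    using 1 by (simp only: of_int_minus power2_minus)
  have e: "complex_of_real (pi\<^sup>2 / 6) + of_real (pi\<^sup>2 / 6) = of_real pi ^ 2 / 3" by simp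
  show ?thesis using has_sum_nonzero_int_split[OF 1 2] unfolding e .
qed

lemma has_sum_telescope_int:
  fixes u :: complex
  assumes u: "Im u \<noteq> 0"
      and s: "(\<lambda>n::int. 1 / (u + of_int n) - 1 / (u + of_int n + 1)) summable_on UNIV"
  shows "((\<lambda>n::int. 1 / (u + of_int n) - 1 / (u + of_int n + 1)) has_sum 0) UNIV"
proof -
  let ?f = "\<lambda>n::int. 1 / (u + of_int n) - 1 / (u + of_int n + 1)"
  have lim: "(\<lambda>n. 1 / (v + of_nat n)) \<longlonglongrightarrow> 0" for v :: complex
    unfolding divide_inverse mult_1_left
    by (rule tendsto_inverse_0[THEN filterlim_compose])
       (intro tendsto_add_filterlim_at_infinity[OF tendsto_const] tendsto_of_nat)
  have s1: "(\<lambda>n::nat. ?f (int n)) summable_on UNIV"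
  proof -
    have "?f summable_on range int" by (rule summable_on_subset_banach[OF s]) auto
    thus ?thesis by (subst (asm) summable_on_reindex) (auto simp: o_def)
  qed
  have s2: "(\<lambda>n::nat. ?f (- int (Suc n))) summable_on UNIV"
  proof -
    have "?f summable_on range (\<lambda>n. - int (Suc n))" by (rule summable_on_subset_banach[OF s]) auto
    thus ?thesis by (subst (asm) summable_on_reindex) (auto simp: o_def inj_on_def)
  qed
  have "(\<lambda>n. ?f (int n)) sums (1 / u - 0)"
    using telescope_sums'[OF lim[of u]] by (simp add: add_ac)
  hence 1: "((\<lambda>n. ?f (int n)) has_sum (1 / u)) UNIV"
    using has_sum_imp_sums[OF has_sum_infsum[OF s1]] s1 by (simp add: sums_iff has_sum_iff)
  have eq: "?f (- int (Suc n)) = 1 / (- u + of_nat n) - 1 / (- u + of_nat (Suc n))" for n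
  proof -
    have "u + of_int (- int (Suc n)) = - (- u + of_nat (Suc n))"
         "u + of_int (- int (Suc n)) + 1 = - (- u + of_nat n)" by auto
    thus ?thesis by (simp only: divide_minus_right) simp
  qed
  have "(\<lambda>n. ?f (- int (Suc n))) sums (1 / (- u) - 0)"
    unfolding eq using telescope_sums'[OF lim[of "-u"]] by simp
  hence 2: "((\<lambda>n. ?f (- int (Suc n))) has_sum (1 / (- u))) UNIV"
    using has_sum_imp_sums[OF has_sum_infsum[OF s2]] s2 by (simp add: sums_iff has_sum_iff)
  show ?thesis using has_sum_int_split[OF 1 2] by simp
qed

text \<open>Subtracting the telescoping term \<open>1 / ((m * z + n) * (m * z + n + 1))\<close> from \<open>1 / (m * z + n)\<^sup>2\<close> leaves a summand
  of order \<open>-3\<close>, for which rows and columns may be exchanged.\<close>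

lemma summable_on_serre_difference:
  assumes z: "Im z > 0"
  shows "(\<lambda>(m::int, n::int). 1 / ((of_int m * z + of_int n)\<^sup>2 * (of_int m * z + of_int n + 1)))
           summable_on (-{0}) \<times> UNIV"
proof -
  let ?L = "lattice_const z"
  have L: "?L \<ge> 1" by (rule lattice_const_ge_1[OF z])
  have s: "(\<lambda>(m::int, n::int). 1 / (\<bar>real_of_int m\<bar> + \<bar>real_of_int n\<bar>) ^ 3) summable_on (-{0}) \<times> UNIV"
    by (rule summable_on_subset_banach[OF summable_on_lattice]) auto
  have s': "(\<lambda>x. (2 * ?L ^ 3) * (case x of (m::int, n::int) \<Rightarrow> 1 / (\<bar>real_of_int m\<bar> + \<bar>real_of_int n\<bar>) ^ 3))
              summable_on (-{0}) \<times> UNIV"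
    by (rule summable_on_cmult_right[OF s])
  have "(\<lambda>x. norm (case x of (m::int, n::int) \<Rightarrow> 1 / ((of_int m * z + of_int n)\<^sup>2 * (of_int m * z + of_int n + 1))))
           summable_on (-{0}) \<times> UNIV"
  proof (rule summable_on_comparison_test[OF s'])
    fix x :: "int \<times> int" assume x: "x \<in> (-{0}) \<times> UNIV"
    obtain m n where mn: "x = (m, n)" "m \<noteq> 0" using x by auto
    define S where "S = \<bar>real_of_int m\<bar> + \<bar>real_of_int n\<bar>"
    define A where "A = cmod (of_int m * z + of_int n)"
    define B where "B = cmod (of_int m * z + of_int n + 1)"
    have m1: "\<bar>real_of_int m\<bar> \<ge> 1" using mn(2) by linarith
    hence S: "S \<ge> 1" unfolding S_def by linarith
    have a: "S \<le> ?L * A"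
      using lattice_lower_bound[OF z, of "of_int m" "of_int n"] by (simp add: S_def A_def)
    have b': "\<bar>real_of_int m\<bar> + \<bar>real_of_int n + 1\<bar> \<le> ?L * B"
      using lattice_lower_bound[OF z, of "of_int m" "of_int n + 1"] by (simp add: B_def add_ac)
    have "\<bar>real_of_int n\<bar> \<le> \<bar>real_of_int n + 1\<bar> + 1"
      using abs_triangle_ineq4[of "real_of_int n + 1" 1] by simp
    hence "\<bar>real_of_int m\<bar> + \<bar>real_of_int n\<bar> \<le> \<bar>real_of_int m\<bar> + (\<bar>real_of_int n + 1\<bar> + \<bar>real_of_int m\<bar>)"
      using m1 by (meson add_left_mono add_mono order_trans order_refl)
    also have "\<dots> \<le> 2 * (\<bar>real_of_int m\<bar> + \<bar>real_of_int n + 1\<bar>)" by simp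
    finally have "S \<le> 2 * (\<bar>real_of_int m\<bar> + \<bar>real_of_int n + 1\<bar>)" unfolding S_def .
    from order_trans[OF this mult_left_mono[OF b']] have b: "S \<le> 2 * (?L * B)" by simp
    have pos: "A > 0" "B > 0" using a b S L by (auto simp: A_def B_def)
    have "S ^ 2 * S \<le> (?L * A) ^ 2 * (2 * (?L * B))"
      by (intro mult_mono power_mono a b) (use S L in auto)
    hence "S ^ 3 \<le> (2 * ?L ^ 3) * (A ^ 2 * B)"
      by (simp add: power3_eq_cube power2_eq_square mult_ac)
    hence "1 / (A ^ 2 * B) \<le> (2 * ?L ^ 3) * (1 / S ^ 3)"
      using pos S by (simp add: field_simps)
    thus "norm (case x of (m, n) \<Rightarrow> 1 / ((of_int m * z + of_int n)\<^sup>2 * (of_int m * z + of_int n + 1)))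
        \<le> (2 * ?L ^ 3) * (case x of (m, n) \<Rightarrow> 1 / (\<bar>real_of_int m\<bar> + \<bar>real_of_int n\<bar>) ^ 3)"
      unfolding mn prod.case by (simp only: S_def A_def B_def norm_divide norm_mult norm_power norm_one)
  qed simp
  thus ?thesis by (rule abs_summable_summable)
qed

text \<open>The points \<open>N / z\<close> tend to infinity in the lower half-plane, where the cotangent tends to \<open>\<i>\<close>.\<close>

lemma cot_tendsto:
  assumes z: "Im z > 0"
  shows "(\<lambda>N. cot (of_real pi * (of_nat N / z))) \<longlonglongrightarrow> \<i>"
proof -
  define w where "w = exp (- 2 * of_real pi * \<i> / z)"
  have "Re (- 2 * of_real pi * \<i> / z) < 0"
    using z by (auto simp: Re_divide divide_neg_pos sum_power2_gt_zero_iff)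
  hence w: "norm w < 1" by (simp add: w_def)
  have eq: "cot (of_real pi * (of_nat N / z)) = \<i> * (1 + w ^ N) / (1 - w ^ N)" for N
  proof -
    define x where "x = of_real pi * (of_nat N / z)"
    define e where "e = exp (- \<i> * x)"
    have e: "e \<noteq> 0" "exp (\<i> * x) = inverse e" by (auto simp: e_def exp_minus)
    have we: "w ^ N = e * e"
      by (simp add: w_def e_def x_def exp_of_nat_mult [symmetric] exp_add [symmetric] algebra_simps)
    have "cot x = ((inverse e + e) / 2) / ((inverse e - e) / (2 * \<i>))"
      unfolding cot_def cos_exp_eq sin_exp_eq e(2) by (simp add: e_def)
    also have "\<dots> = \<i> * (inverse e + e) / (inverse e - e)"
      unfolding divide_divide_eq_right by simp
    also have "\<dots> = \<i> * (e * (inverse e + e)) / (e * (inverse e - e))" using e(1) by simp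
    also have "\<dots> = \<i> * (1 + e * e) / (1 - e * e)"
      using e(1) by (simp add: distrib_left right_diff_distrib)
    finally show ?thesis by (simp add: we x_def)
  qed
  have "(\<lambda>N. w ^ N) \<longlonglongrightarrow> 0" by (rule LIMSEQ_power_zero[OF w])
  hence "(\<lambda>N. \<i> * (1 + w ^ N) / (1 - w ^ N)) \<longlonglongrightarrow> \<i> * (1 + 0) / (1 - 0)"
    by (intro tendsto_mult tendsto_divide tendsto_add tendsto_diff tendsto_const) auto
  thus ?thesis unfolding eq by simp
qed

lemma column_square_has_sum:
  assumes z: "Im z > 0"
  shows "((\<lambda>m::int. 1 / (of_int m * z + of_int n)\<^sup>2) has_sum
           (if n = 0 then of_real pi ^ 2 / (3 * z\<^sup>2) else row_sum (of_int n / z) / z\<^sup>2 - 1 / of_int n ^ 2)) (-{0})"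
proof (cases "n = 0")
  case True
  have "((\<lambda>m::int. (1 / of_int m ^ 2) * (1 / z\<^sup>2)) has_sum (of_real pi ^ 2 / 3) * (1 / z\<^sup>2)) (-{0})"
    by (rule has_sum_cmult_left[OF has_sum_inverse_squares_int])
  thus ?thesis using True by (simp add: power_mult_distrib)
next
  case False
  have z0: "z \<noteq> 0" using z by auto
  have im: "Im (of_int n / z) \<noteq> 0"
    using z False by (auto simp: Im_divide sum_power2_eq_zero_iff)
  have "((\<lambda>m::int. 1 / (of_int n / z + of_int m)\<^sup>2 * (1 / z\<^sup>2)) has_sum row_sum (of_int n / z) * (1 / z\<^sup>2)) UNIV"
    by (rule has_sum_cmult_left[OF row_sum_has_sum[OF im]])
  moreover have "1 / (of_int n / z + of_int m)\<^sup>2 * (1 / z\<^sup>2) = 1 / (of_int m * z + of_int n)\<^sup>2" for m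
  proof -
    have "of_int m * z + of_int n = (of_int n / z + of_int m) * z" using z0 by (simp add: field_simps)
    thus ?thesis by (simp add: power_mult_distrib)
  qed
  ultimately have "((\<lambda>m::int. 1 / (of_int m * z + of_int n)\<^sup>2) has_sum row_sum (of_int n / z) / z\<^sup>2) UNIV"
    by simp
  from has_sum_Diff[OF this has_sum_finite[of "{0}"]] False
  show ?thesis by (simp add: Compl_eq_Diff_UNIV)
qed

text \<open>This is what remains of a block of columns of the telescoping term. The summand is even in \<open>m\<close>, so
  the partial fractions of the cotangent apply.\<close>

lemma serre_column_partial_sums:
  assumes z: "Im z > 0" and N: "N > 0"
    and summ: "(\<lambda>m::int. 1 / (of_int m * z - of_nat N) - 1 / (of_int m * z + of_nat N)) summable_on (-{0})"
  shows "((\<lambda>m::int. 1 / (of_int m * z - of_nat N) - 1 / (of_int m * z + of_nat N)) has_sum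
           (- (2 / z) * (of_real pi * cot (of_real pi * (of_nat N / z)) - z / of_nat N))) (-{0})"
proof -
  let ?g = "\<lambda>m::int. 1 / (of_int m * z - of_nat N) - 1 / (of_int m * z + of_nat N)"
  define u where "u = of_nat N / z"
  define W where "W = of_real pi * cot (of_real pi * u) - 1 / u"
  have z0: "z \<noteq> 0" using z by auto
  have uI: "u \<notin> \<int>"
    using z N by (auto elim!: Ints_cases simp: u_def complex_eq_iff field_simps Im_divide sum_power2_eq_zero_iff)
  have u0: "u \<noteq> 0" using uI by auto
  have zu: "of_nat N = u * z" using z0 by (simp add: u_def)
  have even: "?g (- m) = ?g m" for m
  proof -
    have "of_int (- m) * z - of_nat N = - (of_int m * z + of_nat N)"
         "of_int (- m) * z + of_nat N = - (of_int m * z - of_nat N)" by auto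
    thus ?thesis by (simp only: divide_minus_right) simp
  qed
  have tm: "?g (int (Suc n)) = (- (1 / z)) * (2 * u / (u\<^sup>2 - of_nat (Suc n) ^ 2))" for n
  proof -
    define k :: complex where "k = of_nat (Suc n)"
    have nk: "k - u \<noteq> 0" "k + u \<noteq> 0"
      using uI Ints_of_nat[of "Suc n"] Ints_minus[of "of_nat (Suc n)"] unfolding k_def
      by (metis right_minus_eq, metis add_eq_0_iff)
    have "of_int (int (Suc n)) * z - of_nat N = (k - u) * z"
         "of_int (int (Suc n)) * z + of_nat N = (k + u) * z"
      unfolding zu k_def left_diff_distrib distrib_right by simp_all
    hence "?g (int (Suc n)) = 1 / ((k - u) * z) - 1 / ((k + u) * z)" by (simp only:)
    also have "\<dots> = (1 / z) * (1 / (k - u) - 1 / (k + u))"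
      by (simp only: right_diff_distrib [of "1 / z"] times_divide_times_eq mult_1_left) (simp only: mult.commute)
    also have "1 / (k - u) - 1 / (k + u) = - (2 * u / ((u - k) * (u + k)))"
      using nk by (simp add: divide_simps) (simp add: algebra_simps)
    also have "(u - k) * (u + k) = u\<^sup>2 - k\<^sup>2" by (simp add: power2_eq_square algebra_simps)
    finally show ?thesis by (simp add: k_def)
  qed
  have s1: "(\<lambda>n::nat. ?g (int (Suc n))) summable_on UNIV"
  proof -
    have "?g summable_on range (\<lambda>n. int (Suc n))" by (rule summable_on_subset_banach[OF summ]) auto
    thus ?thesis by (subst (asm) summable_on_reindex) (auto simp: o_def inj_on_def)
  qed
  have "(\<lambda>n. ?g (int (Suc n))) sums (- (1 / z) * W)"
    unfolding tm W_def by (intro sums_mult cot_sums uI)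
  hence 1: "((\<lambda>n. ?g (int (Suc n))) has_sum (- (1 / z) * W)) UNIV"
    using has_sum_imp_sums[OF has_sum_infsum[OF s1]] s1 by (simp add: sums_iff has_sum_iff)
  hence 2: "((\<lambda>n. ?g (- int (Suc n))) has_sum (- (1 / z) * W)) UNIV"
    unfolding even .
  have e: "- (1 / z) * W + - (1 / z) * W = - (2 / z) * W" by simp
  have "(?g has_sum (- (2 / z) * W)) (-{0})"
    using has_sum_nonzero_int_split[OF 1 2] unfolding e .
  thus ?thesis by (simp add: W_def u_def)
qed

text \<open>Inverting \<open>z\<close> exchanges the roles of rows and columns in the lattice sum, so the law measures the difference of
  the two orders of summation. After the correction by a telescoping term the orders agree; the telescoping term itself
  contributes 0 row by row, but the limit of a cotangent column by column.\<close>

lemma E2_inversion: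
  assumes z: "Im z > 0"
  shows "E2 (- 1 / z) = z\<^sup>2 * E2 z + 6 / (of_real pi * \<i>) * z"
proof -
  have z0: "z \<noteq> 0" using z by auto
  define P where "P = complex_of_real pi"
  have P0: "P \<noteq> 0" by (simp add: P_def)
  let ?M = "-{0} :: int set"
  define w where "w = - 1 / z"
  have w: "Im w > 0" using z by (auto simp: w_def Im_divide sum_power2_gt_zero_iff)
  define h where "h = (\<lambda>(m::int, n::int). 1 / ((of_int m * z + of_int n)\<^sup>2 * (of_int m * z + of_int n + 1)))"
  define b where "b = (\<lambda>m n::int. 1 / (of_int m * z + of_int n)\<^sup>2)"
  define c where "c = (\<lambda>m n::int. 1 / (of_int m * z + of_int n) - 1 / (of_int m * z + of_int n + 1))"
  have nz: "of_int m * z + of_int n \<noteq> 0" if "m \<noteq> 0" for m n :: int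
    using that z by (auto simp: complex_eq_iff)
  have hbc: "h (m, n) = b m n - c m n" if "m \<noteq> 0" for m n
    using nz[OF that, of n] nz[OF that, of "n + 1"]
    unfolding h_def b_def c_def prod.case
    by (simp add: add.assoc [symmetric] divide_simps power2_eq_square)
  have sh: "h summable_on ?M \<times> UNIV" unfolding h_def by (rule summable_on_serre_difference[OF z])
  define T where "T = infsum h (?M \<times> UNIV)"
  have hT: "(h has_sum T) (?M \<times> UNIV)" unfolding T_def by (rule has_sum_infsum[OF sh])
  have hT': "((\<lambda>(n, m). h (m, n)) has_sum T) (UNIV \<times> ?M)" using hT by (subst (asm) has_sum_swap)
  \<comment> \<open>Summing the rows first: the correction telescopes to 0 over all integers.\<close>
  have rows: "((\<lambda>n. h (m, n)) has_sum row_sum (of_int m * z)) UNIV" if m: "m \<in> ?M" for m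
  proof -
    have im: "Im (of_int m * z) \<noteq> 0" using m z by auto
    have bs: "(b m has_sum row_sum (of_int m * z)) UNIV"
      unfolding b_def by (rule row_sum_has_sum[OF im])
    have hs: "(\<lambda>n. h (m, n)) summable_on UNIV"
      using summable_on_SigmaD1[of "\<lambda>m n. h (m, n)" ?M "\<lambda>_. UNIV" m] sh m by (simp add: case_prod_unfold)
    have "(\<lambda>n. b m n + - h (m, n)) summable_on UNIV"
      by (intro summable_on_add summable_on_uminus[THEN iffD2] hs has_sum_imp_summable[OF bs])
    hence "c m summable_on UNIV" using hbc m by simp
    hence "(c m has_sum 0) UNIV" unfolding c_def by (intro has_sum_telescope_int im)
    hence "((\<lambda>n. b m n + - c m n) has_sum (row_sum (of_int m * z) + - 0)) UNIV"
      by (intro has_sum_add has_sum_uminusI bs)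
    thus ?thesis using hbc m by simp
  qed
  have "((\<lambda>m. row_sum (of_int m * z)) has_sum T) ?M"
    by (rule has_sum_SigmaD[OF hT rows])
  hence T1: "T = P ^ 2 / 3 * (E2 z - 1)"
    using has_sum_unique[OF E2_row_sums_int[OF z]] by (simp add: P_def)
  \<comment> \<open>Summing the columns first: \<open>p n\<close> is the column sum of the squares and \<open>H n\<close> that of the difference.\<close>
  define p where "p = (\<lambda>n::int. if n = 0 then P ^ 2 / (3 * z\<^sup>2) else row_sum (of_int n / z) / z\<^sup>2 - 1 / of_int n ^ 2)"
  define H where "H = (\<lambda>n. \<Sum>\<^sub>\<infinity>m\<in>?M. h (m, n))"
  have hs: "(\<lambda>m. h (m, n)) summable_on ?M" for n
    using summable_on_SigmaD1[of "\<lambda>n m. h (m, n)" UNIV "\<lambda>_. ?M" n] has_sum_imp_summable[OF hT'] by simp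
  have bs: "((\<lambda>m. b m n) has_sum p n) ?M" for n
    unfolding b_def p_def P_def by (rule column_square_has_sum[OF z])
  have cs: "((\<lambda>m. c m n) has_sum (p n - H n)) ?M" for n
  proof -
    have "((\<lambda>m. b m n + - h (m, n)) has_sum (p n + - H n)) ?M"
      unfolding H_def by (intro has_sum_add has_sum_uminusI bs has_sum_infsum hs)
    also have "?this \<longleftrightarrow> ((\<lambda>m. c m n) has_sum (p n + - H n)) ?M"
      by (rule has_sum_cong) (simp add: hbc)
    finally show ?thesis by simp
  qed
  have HT: "(H has_sum T) UNIV"
    by (rule has_sum_SigmaD[OF hT']) (simp add: H_def hs)
  have pT: "(p has_sum (P ^ 2 / (3 * z\<^sup>2) * E2 w - P ^ 2 / 3)) UNIV"
  proof -
    have 1: "((\<lambda>n::int. row_sum (of_int n * w) * (1 / z\<^sup>2) + - (1 / of_int n ^ 2)) has_sum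
             (P ^ 2 / 3 * (E2 w - 1) * (1 / z\<^sup>2) + - (P ^ 2 / 3))) ?M"
      unfolding P_def
      by (intro has_sum_add has_sum_uminusI has_sum_cmult_left E2_row_sums_int w has_sum_inverse_squares_int)
    have "row_sum (of_int n * w) = row_sum (of_int n / z)" for n
      using row_sum_uminus[of "of_int n / z"] by (simp add: w_def)
    hence "((\<lambda>n. p n) has_sum (P ^ 2 / 3 * (E2 w - 1) * (1 / z\<^sup>2) + - (P ^ 2 / 3))) ?M"
      using 1 by (subst has_sum_cong[of _ _ "\<lambda>n::int. row_sum (of_int n * w) * (1 / z\<^sup>2) + - (1 / of_int n ^ 2)"])
                 (auto simp: p_def)
    from has_sum_insert[OF _ this, of 0]
    have "(p has_sum (p 0 + (P ^ 2 / 3 * (E2 w - 1) * (1 / z\<^sup>2) + - (P ^ 2 / 3)))) (insert 0 ?M)" by simp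
    moreover have "insert 0 ?M = UNIV" by auto
    moreover have "p 0 + (P ^ 2 / 3 * (E2 w - 1) * (1 / z\<^sup>2) + - (P ^ 2 / 3)) = P ^ 2 / (3 * z\<^sup>2) * E2 w - P ^ 2 / 3"
      using z0 by (simp add: p_def field_simps)
    ultimately show ?thesis by (simp only:)
  qed
  define D where "D = (\<lambda>n. p n - H n)"
  have DT: "(D has_sum (P ^ 2 / (3 * z\<^sup>2) * E2 w - P ^ 2 / 3 - T)) UNIV"
    using has_sum_add[OF pT has_sum_uminusI[OF HT]] by (simp add: D_def)
  \<comment> \<open>The columns of the correction telescope into a cotangent, whose limit is the failure of the two orders to agree.\<close>
  have part: "(\<Sum>n\<in>{- int N..<int N}. D n) =
      - (2 / z) * (P * cot (P * (of_nat N / z)) - z / of_nat N)" if N: "N > 0" for N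
  proof -
    have "((\<lambda>m. \<Sum>n\<in>{- int N..<int N}. c m n) has_sum (\<Sum>n\<in>{- int N..<int N}. D n)) ?M"
    proof -
      have "((\<lambda>m. \<Sum>n\<in>X. c m n) has_sum (\<Sum>n\<in>X. D n)) ?M" if "finite X" for X
        using that
      proof (induction X rule: finite_induct)
        case (insert x X)
        thus ?case using has_sum_add[OF cs[of x] insert.IH] by (simp add: D_def)
      qed auto
      thus ?thesis by simp
    qed
    moreover have "(\<Sum>n\<in>{- int N..<int N}. c m n) = 1 / (of_int m * z - of_nat N) - 1 / (of_int m * z + of_nat N)" for m
    proof -
      have tel: "(\<Sum>n\<in>{a..<a + int k}. c m n) = 1 / (of_int m * z + of_int a) - 1 / (of_int m * z + of_int a + of_nat k)" for a k
      proof (induction k)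
        case (Suc k)
        have "{a..<a + int (Suc k)} = insert (a + int k) {a..<a + int k}" by auto
        hence "(\<Sum>n\<in>{a..<a + int (Suc k)}. c m n) = c m (a + int k) + (\<Sum>n\<in>{a..<a + int k}. c m n)"
          by simp
        also have "\<dots> = 1 / (of_int m * z + of_int a) - 1 / (of_int m * z + of_int a + of_nat (Suc k))"
          unfolding Suc by (simp add: c_def add_ac)
        finally show ?case .
      qed auto
      show ?thesis using tel[of "- int N" "2 * N"] by (simp add: add_ac)
    qed
    ultimately have hh: "((\<lambda>m. 1 / (of_int m * z - of_nat N) - 1 / (of_int m * z + of_nat N)) has_sum (\<Sum>n\<in>{- int N..<int N}. D n)) ?M"
      by simp
    show ?thesis
      using has_sum_unique[OF hh serre_column_partial_sums[OF z N has_sum_imp_summable[OF hh]]] by (simp add: P_def)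
  qed
  have fl: "filterlim (\<lambda>N. {- int N..<int N}) (finite_subsets_at_top UNIV) sequentially"
    unfolding filterlim_finite_subsets_at_top
  proof (intro allI impI)
    fix X :: "int set" assume X: "finite X \<and> X \<subseteq> UNIV"
    obtain B where B: "\<And>x. x \<in> X \<Longrightarrow> \<bar>x\<bar> \<le> B"
      using X finite_abs_int_segment by (metis finite_imageI imageI bdd_above.E bdd_above_finite)
    show "\<forall>\<^sub>F N in sequentially. finite {- int N..<int N} \<and> X \<subseteq> {- int N..<int N} \<and> {- int N..<int N} \<subseteq> UNIV"
      using eventually_gt_at_top[of "nat \<bar>B\<bar>"]
    proof eventually_elim
      case (elim N)
      have "x \<in> {- int N..<int N}" if "x \<in> X" for x using B[OF that] elim by auto
      thus ?case by auto
    qed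
  qed
  have "(\<lambda>N. \<Sum>n\<in>{- int N..<int N}. D n) \<longlonglongrightarrow> (P ^ 2 / (3 * z\<^sup>2) * E2 w - P ^ 2 / 3 - T)"
    using filterlim_compose[OF DT[unfolded has_sum_def] fl] .
  hence l1: "(\<lambda>N. - (2 / z) * (P * cot (P * (of_nat N / z)) - z / of_nat N)) \<longlonglongrightarrow> (P ^ 2 / (3 * z\<^sup>2) * E2 w - P ^ 2 / 3 - T)"
    by (rule Lim_transform_eventually) (rule eventually_mono[OF eventually_gt_at_top[of 0]], rule part)
  have l2: "(\<lambda>N. - (2 / z) * (P * cot (P * (of_nat N / z)) - z / of_nat N)) \<longlonglongrightarrow> - (2 / z) * (P * \<i> - 0)"
    unfolding P_def by (intro tendsto_intros cot_tendsto[OF z] lim_const_over_n)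
  have "P ^ 2 / (3 * z\<^sup>2) * E2 w - P ^ 2 / 3 - T = - (2 / z) * (P * \<i>)"
    using LIMSEQ_unique[OF l1 l2] by simp
  hence "P ^ 2 / (3 * z\<^sup>2) * E2 w = - (2 / z) * (P * \<i>) + (P ^ 2 / 3 + T)"
    by (simp only: diff_eq_eq) (simp only: add_ac)
  moreover have "P ^ 2 / 3 + T = P ^ 2 / 3 * E2 z" unfolding T1 right_diff_distrib by simp
  ultimately have "P ^ 2 / (3 * z\<^sup>2) * E2 w = P ^ 2 / 3 * E2 z - 2 / z * (P * \<i>)"
    by simp
  hence "P ^ 2 * E2 w = P ^ 2 * (z\<^sup>2 * E2 z) - 6 * z * (P * \<i>)"
    using z0 by (simp add: field_simps power2_eq_square)
  hence "P * (P * E2 w) = P * (P * (z\<^sup>2 * E2 z) - 6 * z * \<i>)"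
    by (simp add: algebra_simps power2_eq_square)
  hence "P * E2 w = P * (z\<^sup>2 * E2 z) - 6 * z * \<i>" using P0 by simp
  hence "E2 w = z\<^sup>2 * E2 z - 6 * z * \<i> / P"
    using P0 by (simp add: field_simps)
  also have "- (6 * z * \<i> / P) = 6 / (P * \<i>) * z"
    using P0 by (simp add: field_simps)
  hence "z\<^sup>2 * E2 z - 6 * z * \<i> / P = z\<^sup>2 * E2 z + 6 / (P * \<i>) * z" by (metis add_uminus_conv_diff)
  finally show ?thesis by (simp add: w_def P_def)
qed

lemma E2_periodic: "E2 (z + of_int n) = E2 z"
  by (simp add: E2_def nome_periodic)

text \<open>Euclid's algorithm on the bottom row reduces every unimodular matrix to translations and the inversion.\<close>

theorem E2_quasimodular:
  fixes a b c d :: int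
  assumes "a * d - b * c = 1" "Im w > 0"
  shows "E2 ((of_int a * w + of_int b) / (of_int c * w + of_int d)) =
           (of_int c * w + of_int d)\<^sup>2 * E2 w + 6 / (of_real pi * \<i>) * of_int c * (of_int c * w + of_int d)"
  using assms
proof (induction "nat \<bar>c\<bar>" arbitrary: a b c d w rule: less_induct)
  case less
  show ?case
  proof (cases "c = 0")
    case True
    hence "a * d = 1" using less.prems by simp
    hence "(a = 1 \<and> d = 1) \<or> (a = -1 \<and> d = -1)" by (simp add: zmult_eq_1_iff)
    hence "(of_int a * w + of_int b) / (of_int c * w + of_int d) = w + of_int (d * b)" "d\<^sup>2 = 1"
      using True by auto
    thus ?thesis using True E2_periodic[of w "d * b"] by (simp flip: of_int_power)
  next
    case False
    \<comment> \<open>Translate by \<open>n\<close> to reduce \<open>d\<close> modulo \<open>c\<close>, then invert to swap the entries of the bottom row.\<close>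
    define n where "n = d div c"
    define d' where "d' = d mod c"
    define b' where "b' = b - a * n"
    have d: "d = d' + c * n" by (simp add: d'_def n_def)
    define w' where "w' = w + of_int n"
    have w': "Im w' > 0" using less.prems by (simp add: w'_def)
    hence w'0: "w' \<noteq> 0" by auto
    define u where "u = - 1 / w'"
    have u: "Im u > 0" using w' by (auto simp: u_def Im_divide sum_power2_gt_zero_iff)
    have det: "b' * (- c) - (- a) * d' = 1"
      using less.prems(1) by (simp add: b'_def d algebra_simps)
    have "nat \<bar>d'\<bar> < nat \<bar>c\<bar>" unfolding d'_def using False abs_mod_less[of c d] by simp
    note IH = less.hyps[OF this det u]
    have j: "of_int c * w + of_int d = of_int c * w' + of_int d'"
      by (simp add: w'_def d algebra_simps)
    have j0: "of_int c * w' + of_int d' \<noteq> 0" using False w' by (auto simp: complex_eq_iff)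
    have j': "of_int d' * u + of_int (- c) = - (of_int c * w' + of_int d') / w'"
      using w'0 by (simp add: u_def field_simps)
    have num: "of_int b' * u + of_int (- a) = - (of_int a * w' + of_int b') / w'"
      using w'0 by (simp add: u_def field_simps)
    have num': "of_int a * w + of_int b = of_int a * w' + of_int b'"
      by (simp add: w'_def b'_def algebra_simps)
    have q: "(of_int a * w + of_int b) / (of_int c * w + of_int d) =
            (of_int b' * u + of_int (- a)) / (of_int d' * u + of_int (- c))"
    proof -
      have "- X / w' / (- Y / w') = X / Y" for X Y :: complex using w'0 by simp
      thus ?thesis unfolding j num' j' num by (rule sym)
    qed
    have e: "E2 u = w'\<^sup>2 * E2 w + 6 / (of_real pi * \<i>) * w'"
      using E2_inversion[OF w'] E2_periodic[of w n] by (simp add: u_def w'_def)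
    define J where "J = of_int c * w' + of_int d'"
    define K where "K = 6 / (of_real pi * \<i>)"
    have c: "of_int c = (J - of_int d') / w'" using w'0 by (simp add: J_def)
    have "E2 ((of_int a * w + of_int b) / (of_int c * w + of_int d)) =
            (- J / w')\<^sup>2 * (w'\<^sup>2 * E2 w + K * w') + K * of_int d' * (- J / w')"
      unfolding q IH unfolding j' e J_def K_def ..
    also have "\<dots> = J\<^sup>2 * E2 w + K * ((J - of_int d') / w') * J"
      using w'0 by (simp add: field_simps power2_eq_square)
    finally show ?thesis unfolding j c [symmetric] J_def [symmetric] K_def .
  qed
qed

section \<open>Poincare series attached to the Cauchy kernel\<close>

text \<open>The Weierstrass test for unconditional sums, together with termwise differentiation.\<close>

lemma holomorphic_series_majorant:
  fixes g :: "'a \<Rightarrow> complex \<Rightarrow> complex"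
  assumes U: "open U"
      and hol: "\<And>p. p \<in> P \<Longrightarrow> g p holomorphic_on U"
      and le: "\<And>p w. p \<in> P \<Longrightarrow> w \<in> U \<Longrightarrow> norm (g p w) \<le> M p"
      and M: "M summable_on P"
  shows holomorphic_series_majorant_holomorphic: "(\<lambda>w. \<Sum>\<^sub>\<infinity>p\<in>P. g p w) holomorphic_on U"
    and holomorphic_series_majorant_summable: "w \<in> U \<Longrightarrow> (\<lambda>p. g p w) abs_summable_on P"
    and holomorphic_series_majorant_deriv:
          "w \<in> U \<Longrightarrow> ((\<lambda>p. deriv (g p) w) has_sum deriv (\<lambda>w. \<Sum>\<^sub>\<infinity>p\<in>P. g p w) w) P"
proof -
  let ?S = "\<lambda>w. \<Sum>\<^sub>\<infinity>p\<in>P. g p w"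
  have main: "?S field_differentiable (at w) \<and> ((\<lambda>p. deriv (g p) w) has_sum deriv ?S w) P" if w: "w \<in> U" for w
  proof -
    obtain r where r: "r > 0" "cball w r \<subseteq> U" using U w open_contains_cball by blast
    have ul: "uniform_limit (cball w r) (\<lambda>X w. \<Sum>p\<in>X. g p w) ?S (finite_subsets_at_top P)"
      by (rule Weierstrass_m_test_general[OF le M]) (use r in auto)
    have d: "(g p has_field_derivative deriv (g p) v) (at v)" if "p \<in> P" "v \<in> U" for p v
      by (rule holomorphic_derivI[OF hol U]) (use that in auto)
    have ev: "\<forall>\<^sub>F X in finite_subsets_at_top P. continuous_on (cball w r) (\<lambda>w. \<Sum>p\<in>X. g p w) \<and>
        (\<forall>v\<in>ball w r. ((\<lambda>w. \<Sum>p\<in>X. g p w) has_field_derivative (\<Sum>p\<in>X. deriv (g p) v)) (at v))"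
      by (rule eventually_finite_subsets_at_top_weakI)
         (use r in \<open>auto intro!: continuous_on_sum DERIV_sum d
            intro: holomorphic_on_imp_continuous_on holomorphic_on_subset[OF hol]\<close>)
    obtain S' where S': "\<And>v. v \<in> ball w r \<Longrightarrow> (?S has_field_derivative S' v) (at v) \<and>
        ((\<lambda>X. \<Sum>p\<in>X. deriv (g p) v) \<longlongrightarrow> S' v) (finite_subsets_at_top P)"
      using has_complex_derivative_uniform_limit[OF ev ul _ r(1)] by auto
    have "w \<in> ball w r" using r by simp
    from S'[OF this] show ?thesis
      by (auto simp: has_sum_def DERIV_imp_deriv field_differentiable_def)
  qed
  show "?S holomorphic_on U"
    using main by (auto simp: holomorphic_on_def intro: field_differentiable_at_within)
  show "((\<lambda>p. deriv (g p) w) has_sum deriv ?S w) P" if "w \<in> U" using main that by blast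
  show "(\<lambda>p. g p w) abs_summable_on P" if "w \<in> U"
    by (rule summable_on_comparison_test[OF M]) (use le that in auto)
qed

text \<open>Bottom rows of unimodular matrices. They represent the cosets of the modular group modulo integral translations on
  the left.\<close>

definition coprime_pairs :: "(int \<times> int) set" where
  "coprime_pairs = {(c, d). coprime c d}"

text \<open>Some top row completing \<open>p\<close> to a matrix of determinant 1. Another choice changes the Moebius transformation by
  an integral translation, so only 1-periodic functions of \<open>moebius_of\<close> are meaningful.\<close>

definition completion :: "int \<times> int \<Rightarrow> int \<times> int" where
  "completion p = (SOME q. fst q * snd p - snd q * fst p = 1)"

definition moebius_of :: "int \<times> int \<Rightarrow> complex \<Rightarrow> complex" where
  "moebius_of p w = (of_int (fst (completion p)) * w + of_int (snd (completion p))) /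
                    (of_int (fst p) * w + of_int (snd p))"

definition jfactor :: "int \<times> int \<Rightarrow> complex \<Rightarrow> complex" where
  "jfactor p w = of_int (fst p) * w + of_int (snd p)"

lemma completion_det:
  assumes "p \<in> coprime_pairs"
  shows "fst (completion p) * snd p - snd (completion p) * fst p = 1"
proof -
  obtain c d where p: "p = (c, d)" "coprime c d" using assms by (auto simp: coprime_pairs_def)
  obtain u v where "u * c + v * d = 1" using p(2) by (metis bezout_int coprime_imp_gcd_eq_1)
  hence "fst (v, - u) * snd p - snd (v, - u) * fst p = 1" by (simp add: p algebra_simps)
  thus ?thesis unfolding completion_def by (rule someI)
qed

lemma det_imp_coprime: "a * d - b * c = (1::int) \<Longrightarrow> (c, d) \<in> coprime_pairs"
proof -
  assume "a * d - b * c = 1"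
  hence "g dvd c \<Longrightarrow> g dvd d \<Longrightarrow> is_unit g" for g
    by (metis dvd_diff dvd_mult)
  thus ?thesis unfolding coprime_pairs_def by (auto intro: coprimeI)
qed

lemma jfactor_nonzero: "p \<in> coprime_pairs \<Longrightarrow> Im w > 0 \<Longrightarrow> jfactor p w \<noteq> 0"
  by (auto simp: jfactor_def coprime_pairs_def complex_eq_iff)

lemma moebius_of_eq:
  assumes det: "a * d - b * c = 1" and w: "Im w > 0"
  shows "\<exists>n. moebius_of (c, d) w = (of_int a * w + of_int b) / (of_int c * w + of_int d) + of_int n"
proof -
  define a' b' where "a' = fst (completion (c, d))" and "b' = snd (completion (c, d))"
  have p: "(c, d) \<in> coprime_pairs" by (rule det_imp_coprime[OF det])
  have det': "a' * d - b' * c = 1" using completion_det[OF p] by (simp add: a'_def b'_def)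
  \<comment> \<open>The two top rows differ by the multiple \<open>-n\<close> of the bottom row.\<close>
  define n where "n = a' * b - b' * a"
  have "n * c = a' * (a * d - 1) - b' * a * c" using det by (simp add: n_def algebra_simps flip: det)
  also have "\<dots> = a * (a' * d - b' * c) - a'" by (simp add: algebra_simps)
  finally have nc: "a' = a + (- n) * c" using det' by simp
  have "n * d = a' * b * d - b' * (1 + b * c)" using det by (simp add: n_def algebra_simps flip: det)
  also have "\<dots> = b * (a' * d - b' * c) - b'" by (simp add: algebra_simps)
  finally have nd: "b' = b + (- n) * d" using det' by simp
  have j: "of_int c * w + of_int d \<noteq> 0" using jfactor_nonzero[OF p w] by (simp add: jfactor_def)
  have "of_int a' * w + of_int b' = (of_int a * w + of_int b) + of_int (- n) * (of_int c * w + of_int d)"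
    unfolding nc nd by (simp add: algebra_simps)
  moreover have "(X + N * J) / J = X / J + N" if "J \<noteq> 0" for X N J :: complex
    using that by (simp add: add_divide_distrib)
  ultimately have "(of_int a' * w + of_int b') / (of_int c * w + of_int d) =
     (of_int a * w + of_int b) / (of_int c * w + of_int d) + of_int (- n)"
    using j by metis
  thus ?thesis unfolding moebius_of_def a'_def b'_def fst_conv snd_conv by blast
qed

lemma Im_moebius:
  assumes det: "a * d - b * c = (1::int)" and w: "Im w > 0"
  shows "Im ((of_int a * w + of_int b) / (of_int c * w + of_int d)) = Im w / (cmod (of_int c * w + of_int d))\<^sup>2"
proof -
  have d: "real_of_int a * of_int d - of_int b * of_int c = 1"
    using det by (metis of_int_1 of_int_diff of_int_mult)
  have "real_of_int a * Im w * (of_int c * Re w + of_int d) - (of_int a * Re w + of_int b) * (of_int c * Im w)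
          = Im w * (of_int a * of_int d - of_int b * of_int c)" by (simp add: algebra_simps)
  thus ?thesis unfolding d by (subst Im_divide) (simp add: cmod_power2)
qed

lemma Im_moebius_of:
  assumes "p \<in> coprime_pairs" "Im w > 0"
  shows "Im (moebius_of p w) = Im w / (cmod (jfactor p w))\<^sup>2"
  unfolding moebius_of_def jfactor_def
  by (rule Im_moebius) (use completion_det[OF assms(1)] assms(2) in auto)

lemma Im_moebius_of_pos: "p \<in> coprime_pairs \<Longrightarrow> Im w > 0 \<Longrightarrow> Im (moebius_of p w) > 0"
  by (simp add: Im_moebius_of jfactor_nonzero)

lemma moebius_of_holomorphic [holomorphic_intros]:
  "p \<in> coprime_pairs \<Longrightarrow> U \<subseteq> {w. Im w > 0} \<Longrightarrow> moebius_of p holomorphic_on U"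
  unfolding moebius_of_def [abs_def]
  by (intro holomorphic_intros) (use jfactor_nonzero[of p] in \<open>auto simp: jfactor_def\<close>)

lemma has_field_derivative_moebius_of:
  assumes p: "p \<in> coprime_pairs" and w: "Im w > 0"
  shows "(moebius_of p has_field_derivative 1 / (jfactor p w)\<^sup>2) (at w)"
proof -
  define a b c d where "a = complex_of_int (fst (completion p))" and "b = complex_of_int (snd (completion p))"
    and "c = complex_of_int (fst p)" and "d = complex_of_int (snd p)"
  have j: "c * w + d \<noteq> 0" using jfactor_nonzero[OF p w] by (simp add: jfactor_def c_def d_def)
  have det: "a * d - b * c = 1"
    using arg_cong[OF completion_det[OF p], of complex_of_int] by (simp add: a_def b_def c_def d_def)
  have "((\<lambda>w. (a * w + b) / (c * w + d)) has_field_derivative (a * (c * w + d) - (a * w + b) * c) / ((c * w + d) * (c * w + d))) (at w)"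
    using j by (auto intro!: derivative_eq_intros)
  also have "a * (c * w + d) - (a * w + b) * c = 1" using det by (simp add: algebra_simps)
  finally show ?thesis
    by (simp add: moebius_of_def [abs_def] jfactor_def a_def b_def c_def d_def power2_eq_square)
qed

text \<open>One summand of a Poincare series of weight \<open>m\<close> with a 1-periodic seed \<open>\<phi>\<close>.\<close>

definition poincare_term :: "(complex \<Rightarrow> complex) \<Rightarrow> nat \<Rightarrow> int \<times> int \<Rightarrow> complex \<Rightarrow> complex" where
  "poincare_term \<phi> m p w = \<phi> (moebius_of p w) / jfactor p w ^ m"

definition poincare :: "(complex \<Rightarrow> complex) \<Rightarrow> nat \<Rightarrow> complex \<Rightarrow> complex" where
  "poincare \<phi> m w = (\<Sum>\<^sub>\<infinity>p\<in>coprime_pairs. poincare_term \<phi> m p w)"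

text \<open>Right multiplication of a bottom row by the matrix with rows \<open>(a, b)\<close> and \<open>(c, d)\<close>.\<close>

definition act_right :: "int \<Rightarrow> int \<Rightarrow> int \<Rightarrow> int \<Rightarrow> int \<times> int \<Rightarrow> int \<times> int" where
  "act_right a b c d p = (fst p * a + snd p * c, fst p * b + snd p * d)"

lemma act_right_coprime:
  assumes det: "a * d - b * c = 1" and p: "p \<in> coprime_pairs"
  shows "act_right a b c d p \<in> coprime_pairs"
proof -
  obtain e f where e: "e = fst (completion p)" "f = snd (completion p)" by auto
  have "(e * a + f * c) * (fst p * b + snd p * d) - (e * b + f * d) * (fst p * a + snd p * c)
          = (e * snd p - f * fst p) * (a * d - b * c)" by (simp add: algebra_simps)
  also have "\<dots> = 1" using completion_det[OF p] det e by simp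
  finally show ?thesis unfolding act_right_def by (rule det_imp_coprime)
qed

lemma act_right_inverse:
  assumes det: "a * d - b * c = 1"
  shows "act_right d (- b) (- c) a (act_right a b c d p) = p"
        "act_right a b c d (act_right d (- b) (- c) a p) = p"
proof -
  have 1: "x * a * d - x * b * c = x" for x
    using arg_cong[OF det, of "\<lambda>y. x * y"] by (simp add: algebra_simps)
  show "act_right d (- b) (- c) a (act_right a b c d p) = p"
       "act_right a b c d (act_right d (- b) (- c) a p) = p"
    using 1[of "fst p"] 1[of "snd p"] by (auto simp: act_right_def prod_eq_iff algebra_simps)
qed

lemma act_right_bij:
  assumes det: "a * d - b * c = 1"
  shows "bij_betw (act_right a b c d) coprime_pairs coprime_pairs"
proof -
  have det': "d * a - (- b) * (- c) = 1" using det by (simp add: algebra_simps)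
  show ?thesis
    by (rule bij_betwI[where g = "act_right d (- b) (- c) a"])
       (auto simp: act_right_inverse[OF det] act_right_coprime[OF det] act_right_coprime[OF det'])
qed

text \<open>The cocycle property of the automorphy factor: a modular substitution in \<open>w\<close> permutes the summands.\<close>

lemma poincare_term_act:
  assumes per: "\<And>u n. \<phi> (u + of_int n) = \<phi> u"
      and det: "a * d - b * c = 1" and p: "p \<in> coprime_pairs" and w: "Im w > 0"
  shows "jfactor (act_right a b c d p) w = jfactor p ((of_int a * w + of_int b) / (of_int c * w + of_int d)) * jfactor (c, d) w"
    and "\<phi> (moebius_of p ((of_int a * w + of_int b) / (of_int c * w + of_int d))) = \<phi> (moebius_of (act_right a b c d p) w)"
    and "poincare_term \<phi> m p ((of_int a * w + of_int b) / (of_int c * w + of_int d)) =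
           jfactor (c, d) w ^ m * poincare_term \<phi> m (act_right a b c d p) w"
proof -
  define sw where "sw = (of_int a * w + of_int b) / (of_int c * w + of_int d)"
  define e f where "e = fst (completion p)" and "f = snd (completion p)"
  define g h where "g = fst p" and "h = snd p"
  have efgh: "e * h - f * g = 1" using completion_det[OF p] by (simp add: e_def f_def g_def h_def)
  have j: "jfactor (c, d) w \<noteq> 0" by (rule jfactor_nonzero[OF det_imp_coprime[OF det] w])
  hence j': "of_int c * w + of_int d \<noteq> 0" by (simp add: jfactor_def)
  have sw: "sw * jfactor (c, d) w = of_int a * w + of_int b" using j' by (simp add: sw_def jfactor_def)
  show J: "jfactor (act_right a b c d p) w = jfactor p sw * jfactor (c, d) w"
  proof -
    have "jfactor p sw * jfactor (c, d) w = of_int g * (sw * jfactor (c, d) w) + of_int h * jfactor (c, d) w"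
      by (simp add: jfactor_def g_def h_def algebra_simps)
    also have "\<dots> = jfactor (act_right a b c d p) w"
      unfolding sw by (simp add: jfactor_def act_right_def g_def h_def algebra_simps)
    finally show ?thesis ..
  qed
  have Jn: "jfactor (act_right a b c d p) w \<noteq> 0"
    by (rule jfactor_nonzero[OF act_right_coprime[OF det p] w])
  have num: "(of_int e * sw + of_int f) * jfactor (c, d) w = of_int (e * a + f * c) * w + of_int (e * b + f * d)"
  proof -
    have "(of_int e * sw + of_int f) * jfactor (c, d) w = of_int e * (sw * jfactor (c, d) w) + of_int f * jfactor (c, d) w"
      by (simp add: algebra_simps)
    also have "\<dots> = of_int (e * a + f * c) * w + of_int (e * b + f * d)"
      unfolding sw by (simp add: jfactor_def algebra_simps)
    finally show ?thesis .
  qed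
  have "moebius_of p sw = (of_int e * sw + of_int f) / jfactor p sw"
    by (simp add: moebius_of_def e_def f_def jfactor_def)
  also have "\<dots> = ((of_int e * sw + of_int f) * jfactor (c, d) w) / (jfactor p sw * jfactor (c, d) w)"
    using j by simp
  also have "\<dots> = (of_int (e * a + f * c) * w + of_int (e * b + f * d)) / (of_int (g * a + h * c) * w + of_int (g * b + h * d))"
    unfolding num J [symmetric] by (simp add: jfactor_def act_right_def g_def h_def)
  finally have M: "moebius_of p sw = \<dots>" .
  have "(e * a + f * c) * (g * b + h * d) - (e * b + f * d) * (g * a + h * c) = (e * h - f * g) * (a * d - b * c)"
    by (simp add: algebra_simps)
  also have "\<dots> = 1" using efgh det by simp
  finally have D: "(e * a + f * c) * (g * b + h * d) - (e * b + f * d) * (g * a + h * c) = 1" .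
  have A: "act_right a b c d p = (g * a + h * c, g * b + h * d)" by (simp add: act_right_def g_def h_def)
  obtain n where "moebius_of (act_right a b c d p) w = moebius_of p sw + of_int n"
    using moebius_of_eq[OF D w] unfolding A M by auto
  thus P: "\<phi> (moebius_of p sw) = \<phi> (moebius_of (act_right a b c d p) w)"
    by (simp add: per)
  show "poincare_term \<phi> m p sw = jfactor (c, d) w ^ m * poincare_term \<phi> m (act_right a b c d p) w"
    unfolding poincare_term_def P J power_mult_distrib using j by simp
qed

lemma infsum_coprime_act:
  assumes det: "a * d - b * c = 1"
  shows "(\<Sum>\<^sub>\<infinity>p\<in>coprime_pairs. f (act_right a b c d p)) = infsum f coprime_pairs"
  by (rule infsum_reindex_bij_betw[OF act_right_bij[OF det]])

lemma poincare_modular: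
  assumes per: "\<And>u n. \<phi> (u + of_int n) = \<phi> u"
      and det: "a * d - b * c = 1" and w: "Im w > 0"
  shows "poincare \<phi> m ((of_int a * w + of_int b) / (of_int c * w + of_int d)) =
           (of_int c * w + of_int d) ^ m * poincare \<phi> m w"
proof -
  have "poincare \<phi> m ((of_int a * w + of_int b) / (of_int c * w + of_int d)) =
          (\<Sum>\<^sub>\<infinity>p\<in>coprime_pairs. jfactor (c, d) w ^ m * poincare_term \<phi> m (act_right a b c d p) w)"
    unfolding poincare_def
    by (rule infsum_cong) (rule poincare_term_act(3)[OF per det _ w])
  also have "\<dots> = jfactor (c, d) w ^ m * poincare \<phi> m w"
    unfolding poincare_def infsum_cmult_right'
    by (subst infsum_coprime_act[OF det, of "\<lambda>p. poincare_term \<phi> m p w"]) (rule refl)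
  finally show ?thesis by (simp add: jfactor_def)
qed

text \<open>The Cauchy kernel of the cylinder \<open>\<complex> / \<int>\<close>, with residue \<open>1 / (2 * pi * \<i>)\<close> at \<open>w = z\<close>; it vanishes as
  \<open>Im w\<close> tends to infinity.\<close>

definition cauchy_kernel :: "complex \<Rightarrow> complex \<Rightarrow> complex" where
  "cauchy_kernel z w = 1 / (1 - nome (z - w))"

text \<open>Averaging \<open>E2 ^ l\<close> together with the kernel makes the quasimodularity of \<open>E2\<close> invisible in the transformation law
  of the Poincare series; it is needed only for the estimates and for the values at the elliptic point.\<close>

definition seed :: "nat \<Rightarrow> complex \<Rightarrow> complex \<Rightarrow> complex" where
  "seed l z u = E2 u ^ l * cauchy_kernel z u"

lemma cauchy_kernel_periodic: "cauchy_kernel z (w + of_int n) = cauchy_kernel z w"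
  using nome_periodic[of "z - w" "-n"] by (simp add: cauchy_kernel_def algebra_simps)

lemma seed_periodic: "seed l z (u + of_int n) = seed l z u"
  by (simp add: seed_def E2_periodic cauchy_kernel_periodic)

lemma nome_eq_1_iff: "nome u = 1 \<longleftrightarrow> u \<in> \<int>"
proof -
  have "nome u = 1 \<longleftrightarrow> Im u = 0 \<and> (\<exists>n. 2 * pi * Re u = of_int (2 * n) * pi)"
    unfolding nome_def by (subst exp_eq_1) auto
  also have "\<dots> \<longleftrightarrow> u \<in> \<int>" unfolding complex_is_Int_iff by auto
  finally show ?thesis .
qed

lemma nome_holomorphic [holomorphic_intros]:
  "f holomorphic_on A \<Longrightarrow> (\<lambda>w. nome (f w)) holomorphic_on A"
  unfolding nome_def by (intro holomorphic_intros)

lemma cauchy_kernel_holomorphic: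
  assumes "\<And>w n. w \<in> A \<Longrightarrow> w \<noteq> z + of_int n"
  shows "cauchy_kernel z holomorphic_on A"
  unfolding cauchy_kernel_def [abs_def]
proof (intro holomorphic_intros)
  fix w assume w: "w \<in> A"
  show "1 - nome (z - w) \<noteq> 0"
  proof
    assume "1 - nome (z - w) = 0"
    hence "z - w \<in> \<int>" using nome_eq_1_iff[of "z - w"] by simp
    then obtain n where "z - w = of_int n" by (auto elim: Ints_cases)
    hence "w = z + of_int (- n)" by (simp add: algebra_simps)
    thus False using assms[OF w] by blast
  qed
qed

lemma E2_summable:
  fixes q :: complex
  assumes "norm q < 1"
  shows "summable (\<lambda>n. norm (of_nat (\<Sum>d | d dvd Suc n. d) * q ^ n))"
proof (rule summable_comparison_test')
  have 1: "summable (\<lambda>n. diffs (\<lambda>_. 1) n * x ^ n)" if "norm x < 1" for x :: real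
    by (rule termdiff_converges[OF that]) (simp add: summable_geometric)
  have "summable (\<lambda>n. diffs (diffs (\<lambda>_. 1)) n * norm q ^ n)"
    by (rule termdiff_converges[OF _ 1]) (use assms in auto)
  thus "summable (\<lambda>n. (real (Suc n) * real (Suc (Suc n))) * norm q ^ n)"
    by (simp add: diffs_def del: of_nat_Suc)
  fix n :: nat
  have "d \<in> {1..Suc n}" if "d dvd Suc n" for d
    using dvd_imp_le[OF that] dvd_pos_nat[OF _ that] by auto
  hence "(\<Sum>d | d dvd Suc n. d) \<le> (\<Sum>d\<in>{1..Suc n}. Suc n)"
    by (intro order.trans[OF sum_mono2[of "{1..Suc n}"] sum_mono]) auto
  hence "(\<Sum>d | d dvd Suc n. d) \<le> Suc n * Suc (Suc n)" by simp
  hence "real (\<Sum>d | d dvd Suc n. d) \<le> real (Suc n) * real (Suc (Suc n))"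
    by (metis of_nat_le_iff of_nat_mult)
  thus "norm (norm (of_nat (\<Sum>d | d dvd Suc n. d) * q ^ n)) \<le> (real (Suc n) * real (Suc (Suc n))) * norm q ^ n"
    by (simp add: norm_mult norm_power mult_right_mono del: of_nat_sum of_nat_Suc power_Suc)
qed

definition sigma_series :: "complex \<Rightarrow> complex" where
  "sigma_series q = (\<Sum>n. of_nat (\<Sum>d | d dvd Suc n. d) * q ^ n)"

lemma E2_eq_sigma_series:
  assumes "Im z > 0"
  shows "E2 z = 1 - 24 * (nome z * sigma_series (nome z))"
proof -
  have "summable (\<lambda>n. of_nat (\<Sum>d | d dvd Suc n. d) * nome z ^ n)"
    by (rule summable_norm_cancel[OF E2_summable[OF norm_nome_less_1[OF assms]]])
  from suminf_mult[OF this, of "nome z"] show ?thesis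
    unfolding E2_def sigma_series_def by (simp add: mult_ac del: of_nat_sum)
qed

lemma E2_holomorphic: "E2 holomorphic_on {w. Im w > 0}"
proof -
  have "sigma_series holomorphic_on ball 0 1"
  proof (rule power_series_holomorphic)
    fix w :: complex assume "w \<in> ball 0 1"
    hence "norm w < 1" by simp
    from summable_norm_cancel[OF E2_summable[OF this]]
    show "(\<lambda>n. of_nat (\<Sum>d | d dvd Suc n. d) * (w - 0) ^ n) sums sigma_series w"
      unfolding sigma_series_def by (simp add: summable_sums del: of_nat_sum)
  qed
  hence "(sigma_series \<circ> nome) holomorphic_on {w. Im w > 0}"
    by (rule holomorphic_on_compose_gen[rotated])
       (auto intro!: holomorphic_intros norm_nome_less_1)
  hence "(\<lambda>z. 1 - 24 * (nome z * sigma_series (nome z))) holomorphic_on {w. Im w > 0}"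
    by (intro holomorphic_intros) (auto simp: o_def)
  thus ?thesis by (rule holomorphic_transform) (simp add: E2_eq_sigma_series)
qed

lemma E2_bounded:
  assumes y: "y > 0"
  obtains E where "E \<ge> 0" "\<And>w. Im w \<ge> y \<Longrightarrow> norm (E2 w) \<le> E"
proof -
  define r where "r = exp (- 2 * pi * y)"
  have r: "0 < r" "r < 1" using y by (auto simp: r_def)
  define S where "S = (\<Sum>n. real (\<Sum>d | d dvd Suc n. d) * r ^ n)"
  have sr: "summable (\<lambda>n. real (\<Sum>d | d dvd Suc n. d) * r ^ n)"
    using E2_summable[of "of_real r"] r by (simp add: norm_mult norm_power del: of_nat_sum)
  have S: "S \<ge> 0" unfolding S_def
    by (intro suminf_nonneg sr mult_nonneg_nonneg) (use r in \<open>auto intro: sum_nonneg\<close>)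
  show ?thesis
  proof (rule that[of "1 + 24 * S"])
    show "1 + 24 * S \<ge> 0" using S by simp
    fix w :: complex assume w: "Im w \<ge> y"
    have q: "norm (nome w) \<le> r" using w by (simp add: norm_nome r_def)
    hence q1: "norm (nome w) < 1" using r by simp
    have "norm (sigma_series (nome w)) \<le> S"
      unfolding sigma_series_def S_def
    proof (rule order.trans[OF summable_norm[OF E2_summable[OF q1]] suminf_le[OF _ E2_summable[OF q1] sr]])
      show "norm (of_nat (\<Sum>d | d dvd Suc n. d) * nome w ^ n) \<le> real (\<Sum>d | d dvd Suc n. d) * r ^ n" for n
        unfolding norm_mult norm_power norm_of_nat by (intro mult_left_mono power_mono q) (auto intro: sum_nonneg)
    qed
    hence "norm (nome w * sigma_series (nome w)) \<le> 1 * S"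
      unfolding norm_mult using q1 by (intro mult_mono) auto
    moreover have "norm (E2 w) \<le> norm (1::complex) + norm (24 * (nome w * sigma_series (nome w)))"
      unfolding E2_eq_sigma_series[OF less_le_trans[OF y w]] by (rule norm_triangle_ineq4)
    ultimately show "norm (E2 w) \<le> 1 + 24 * S" by (simp add: norm_mult)
  qed
qed

lemma E2_moebius_of:
  assumes p: "p \<in> coprime_pairs" and w: "Im w > 0"
  shows "E2 (moebius_of p w) = (jfactor p w)\<^sup>2 * E2 w + 6 / (of_real pi * \<i>) * of_int (fst p) * jfactor p w"
  unfolding moebius_of_def jfactor_def
  using E2_quasimodular[OF completion_det[OF p] w] by simp

lemma norm_jfactor_ge:
  assumes "Im w > 0"
  shows "\<bar>real_of_int (fst p)\<bar> * Im w \<le> cmod (jfactor p w)"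
proof -
  have "\<bar>real_of_int (fst p)\<bar> * Im w = \<bar>Im (jfactor p w)\<bar>"
    using assms by (simp add: jfactor_def abs_mult)
  also have "\<dots> \<le> cmod (jfactor p w)" by (rule abs_Im_le_cmod)
  finally show ?thesis .
qed

lemma norm_cauchy_kernel_le:
  assumes "Im u + 1 \<le> Im z"
  shows "norm (cauchy_kernel z u) \<le> 2"
proof -
  have "2 * pi * (Im z - Im u) \<ge> 2 * pi * 1" using assms by (intro mult_left_mono) auto
  hence "norm (nome (z - u)) \<le> exp (-1)"
    using pi_gt3 by (simp add: norm_nome algebra_simps)
  also have "exp (-1 :: real) \<le> 1 / 2"
    using exp_ge_add_one_self[of "1::real"] by (simp add: exp_minus field_simps)
  finally have "1 / 2 \<le> norm (1 - nome (z - u))"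
    using norm_triangle_ineq2[of 1 "nome (z - u)"] by simp
  hence "1 / norm (1 - nome (z - u)) \<le> 1 / (1 / 2)" by (intro divide_left_mono) auto
  thus ?thesis by (simp add: cauchy_kernel_def norm_divide)
qed

text \<open>All pairs except \<open>(0, 1)\<close> and \<open>(0, -1)\<close>. For \<open>z\<close> far up, their terms have no pole near \<open>z\<close> and decay towards the cusp.\<close>

definition noncuspidal_pairs :: "(int \<times> int) set" where
  "noncuspidal_pairs = {p \<in> coprime_pairs. fst p \<noteq> 0}"

text \<open>Quasimodularity bounds \<open>E2\<close> at the transformed point by \<open>\<bar>j\<bar>\<^sup>2\<close>, so a term is of order
  \<open>2 * l - m \<le> -4\<close> in \<open>\<bar>j\<bar>\<close>. One of the four powers is spent on the factor \<open>1 / Im w\<close>, which later kills these terms at the cusp; the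
  other three suffice for summability. The transformed point has imaginary part at most 4, so the kernel stays bounded when
  \<open>Im z \<ge> 5\<close>.\<close>

lemma poincare_term_bound:
  assumes m: "m \<ge> 2 * l + 4"
  obtains K where "K \<ge> 0"
    "\<And>z w p. Im z \<ge> 5 \<Longrightarrow> Im w > 1/4 \<Longrightarrow> p \<in> noncuspidal_pairs \<Longrightarrow>
       norm (poincare_term (seed l z) m p w) \<le>
         K / Im w * (lattice_const w ^ 3 * (case p of (c, d) \<Rightarrow> 1 / (\<bar>real_of_int c\<bar> + \<bar>real_of_int d\<bar>) ^ 3))"
proof -
  obtain E where E: "E \<ge> 0" "\<And>w. Im w \<ge> 1/4 \<Longrightarrow> norm (E2 w) \<le> E"
    using E2_bounded[of "1/4"] by auto
  define E' where "E' = E + 24 / pi"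
  define e where "e = m - 2 * l - 4"
  have me: "m = 2 * l + 4 + e" using m by (simp add: e_def)
  define K where "K = 2 * E' ^ l * 4 ^ e"
  have E': "E' \<ge> 0" using E by (simp add: E'_def)
  show ?thesis
  proof (rule that[of K])
    show "K \<ge> 0" using E' by (simp add: K_def)
    fix z w p assume z: "Im z \<ge> 5" and w: "Im w > 1/4" and p: "p \<in> noncuspidal_pairs"
    have pc: "p \<in> coprime_pairs" and c0: "fst p \<noteq> 0" using p by (auto simp: noncuspidal_pairs_def)
    have w0: "Im w > 0" using w by simp
    define J where "J = cmod (jfactor p w)"
    have J0: "J > 0" using jfactor_nonzero[OF pc w0] by (simp add: J_def)
    have cJ: "\<bar>real_of_int (fst p)\<bar> * Im w \<le> J" unfolding J_def by (rule norm_jfactor_ge[OF w0])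
    have c1: "1 \<le> \<bar>real_of_int (fst p)\<bar>" using c0 by linarith
    have wJ: "Im w \<le> J" using order.trans[OF mult_right_mono[OF c1, of "Im w"] cJ] w0 by simp
    hence J4: "1 / 4 \<le> J" using w by simp
    have "\<bar>real_of_int (fst p)\<bar> * (1/4) \<le> J"
      using cJ mult_left_mono[of "1/4" "Im w" "\<bar>real_of_int (fst p)\<bar>"] w by simp
    hence c4: "\<bar>real_of_int (fst p)\<bar> \<le> 4 * J" by simp
    have "norm (E2 (moebius_of p w)) \<le> norm ((jfactor p w)\<^sup>2 * E2 w) + norm (6 / (of_real pi * \<i>) * of_int (fst p) * jfactor p w)"
      unfolding E2_moebius_of[OF pc w0] by (rule norm_triangle_ineq)
    also have "\<dots> = J\<^sup>2 * norm (E2 w) + 6 / pi * \<bar>real_of_int (fst p)\<bar> * J"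
      by (simp add: norm_mult norm_divide norm_power J_def)
    also have "\<dots> \<le> J\<^sup>2 * E + 6 / pi * (4 * J) * J"
      by (intro add_mono mult_left_mono mult_right_mono E c4) (use w J0 in auto)
    also have "\<dots> = E' * J\<^sup>2" by (simp add: E'_def power2_eq_square algebra_simps)
    finally have e2: "norm (E2 (moebius_of p w)) \<le> E' * J\<^sup>2" .
    have "Im (moebius_of p w) = Im w / J\<^sup>2" unfolding J_def by (rule Im_moebius_of[OF pc w0])
    also have "\<dots> \<le> Im w / (Im w)\<^sup>2"
      by (intro divide_left_mono power_mono wJ mult_pos_pos zero_less_power) (use w0 J0 in auto)
    also have "\<dots> = 1 / Im w" using w0 by (simp add: power2_eq_square)
    also have "\<dots> \<le> 4" using w by (simp add: field_simps)
    finally have k: "norm (cauchy_kernel z (moebius_of p w)) \<le> 2"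
      by (intro norm_cauchy_kernel_le) (use z in simp)
    have "norm (poincare_term (seed l z) m p w) =
        norm (E2 (moebius_of p w)) ^ l * norm (cauchy_kernel z (moebius_of p w)) / J ^ m"
      by (simp add: poincare_term_def seed_def norm_mult norm_divide norm_power J_def)
    also have "\<dots> \<le> (E' * J\<^sup>2) ^ l * 2 / J ^ m"
      by (intro divide_right_mono mult_mono power_mono e2 k) (use E' J0 in auto)
    also have "\<dots> = 2 * E' ^ l * ((1 / J) ^ e * ((1 / J) * (1 / J) ^ 3))"
      using J0 by (simp add: me power_mult_distrib power_add power_mult [symmetric] power_divide
          field_simps power4_eq_xxxx power3_eq_cube)
    also have "\<dots> \<le> 2 * E' ^ l * (4 ^ e * ((1 / Im w) * (lattice_const w / (\<bar>real_of_int (fst p)\<bar> + \<bar>real_of_int (snd p)\<bar>)) ^ 3))"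
    proof (intro mult_left_mono mult_mono power_mono)
      show "1 / J \<le> 4" using J4 J0 by (simp add: field_simps)
      show "1 / J \<le> 1 / Im w" using wJ w0 J0 by (simp add: field_simps)
      have "\<bar>real_of_int (fst p)\<bar> + \<bar>real_of_int (snd p)\<bar> \<le> lattice_const w * J"
        using lattice_lower_bound[OF w0, of "of_int (fst p)" "of_int (snd p)"] by (simp add: J_def jfactor_def)
      thus "1 / J \<le> lattice_const w / (\<bar>real_of_int (fst p)\<bar> + \<bar>real_of_int (snd p)\<bar>)"
        using J0 c1 by (simp add: field_simps)
    qed (use J0 w0 E' in auto)
    finally show "norm (poincare_term (seed l z) m p w) \<le>
         K / Im w * (lattice_const w ^ 3 * (case p of (c, d) \<Rightarrow> 1 / (\<bar>real_of_int c\<bar> + \<bar>real_of_int d\<bar>) ^ 3))"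
      by (simp add: K_def case_prod_unfold power_divide)
  qed
qed

definition poincare_tail :: "nat \<Rightarrow> nat \<Rightarrow> complex \<Rightarrow> complex \<Rightarrow> complex" where
  "poincare_tail l m z w = (\<Sum>\<^sub>\<infinity>p\<in>noncuspidal_pairs. poincare_term (seed l z) m p w)"

lemma summable_on_noncuspidal:
  "(\<lambda>(c::int, d::int). 1 / (\<bar>real_of_int c\<bar> + \<bar>real_of_int d\<bar>) ^ 3) summable_on noncuspidal_pairs"
  by (rule summable_on_subset_banach[OF summable_on_lattice]) (auto simp: noncuspidal_pairs_def)

lemma lattice_const_le:
  assumes "Im w > 1/4" "\<bar>Re w\<bar> \<le> B"
  shows "lattice_const w \<le> 1 + (1 + B) * 4"
proof -
  have "(1 + \<bar>Re w\<bar>) / Im w \<le> (1 + B) / (1 / 4)"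
    by (rule frac_le) (use assms in auto)
  thus ?thesis by (simp add: lattice_const_def)
qed

lemma seed_holomorphic:
  assumes "A \<subseteq> {w. Im w > 0}" "\<And>w n. w \<in> A \<Longrightarrow> w \<noteq> z + of_int n"
  shows "seed l z holomorphic_on A"
  unfolding seed_def [abs_def]
  by (intro holomorphic_intros holomorphic_on_subset[OF E2_holomorphic] cauchy_kernel_holomorphic assms)

lemma poincare_term_holomorphic:
  assumes z: "Im z \<ge> 5" and p: "p \<in> noncuspidal_pairs"
  shows "poincare_term (seed l z) m p holomorphic_on {w. Im w > 1/4}"
proof -
  have pc: "p \<in> coprime_pairs" and c0: "fst p \<noteq> 0" using p by (auto simp: noncuspidal_pairs_def)
  have *: "Im (moebius_of p w) > 0 \<and> Im (moebius_of p w) \<le> 4" if w: "Im w > 1/4" for w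
  proof -
    have w0: "Im w > 0" using w by simp
    have c1: "1 \<le> \<bar>real_of_int (fst p)\<bar>" using c0 by linarith
    have wJ: "Im w \<le> cmod (jfactor p w)" using order.trans[OF mult_right_mono[OF c1, of "Im w"] norm_jfactor_ge[OF w0, of p]] w0 by simp
    have "Im (moebius_of p w) \<le> Im w / (Im w)\<^sup>2" unfolding Im_moebius_of[OF pc w0]
      by (intro divide_left_mono power_mono wJ mult_pos_pos zero_less_power) (use w0 wJ in auto)
    also have "\<dots> = 1 / Im w" using w0 by (simp add: power2_eq_square)
    also have "\<dots> \<le> 4" using w by (simp add: field_simps)
    finally show ?thesis using Im_moebius_of_pos[OF pc w0] by simp
  qed
  have "(seed l z \<circ> moebius_of p) holomorphic_on {w. Im w > 1/4}"
  proof (rule holomorphic_on_compose_gen[OF _ seed_holomorphic[of "{u. 0 < Im u \<and> Im u \<le> 4}"]])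
    show "moebius_of p holomorphic_on {w. Im w > 1/4}"
      by (rule moebius_of_holomorphic[OF pc]) auto
  qed (use z * in auto)
  moreover have "(\<lambda>w. jfactor p w ^ m) holomorphic_on {w. Im w > 1/4}"
    unfolding jfactor_def by (intro holomorphic_intros)
  ultimately have "(\<lambda>w. (seed l z \<circ> moebius_of p) w / jfactor p w ^ m) holomorphic_on {w. Im w > 1/4}"
    by (rule holomorphic_on_divide) (use jfactor_nonzero[OF pc] in auto)
  thus ?thesis by (simp add: poincare_term_def [abs_def])
qed

lemma poincare_tail_properties:
  assumes m: "m \<ge> 2 * l + 4" and z: "Im z \<ge> 5"
  shows poincare_tail_holomorphic: "poincare_tail l m z holomorphic_on {w. Im w > 1/4}"
    and poincare_tail_summable: "Im w > 1/4 \<Longrightarrow> (\<lambda>p. poincare_term (seed l z) m p w) summable_on noncuspidal_pairs"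
    and poincare_tail_deriv: "Im w > 1/4 \<Longrightarrow>
          ((\<lambda>p. deriv (poincare_term (seed l z) m p) w) has_sum deriv (poincare_tail l m z) w) noncuspidal_pairs"
    and poincare_tail_bound: "\<exists>C. \<forall>w. Im w > 1/4 \<longrightarrow> \<bar>Re w\<bar> \<le> 2 \<longrightarrow> norm (poincare_tail l m z w) \<le> C / Im w"
proof -
  let ?f = "\<lambda>(c::int, d::int). 1 / (\<bar>real_of_int c\<bar> + \<bar>real_of_int d\<bar>) ^ 3"
  obtain K where K: "K \<ge> 0"
    "\<And>z w p. Im z \<ge> 5 \<Longrightarrow> Im w > 1/4 \<Longrightarrow> p \<in> noncuspidal_pairs \<Longrightarrow>
       norm (poincare_term (seed l z) m p w) \<le> K / Im w * (lattice_const w ^ 3 * ?f p)"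
    using poincare_term_bound[OF m] by blast
  have f0: "?f p \<ge> 0" for p by (simp add: case_prod_unfold)
  have bound: "norm (poincare_term (seed l z) m p w) \<le> K / Im w * ((1 + (1 + B) * 4) ^ 3 * ?f p)"
    if "Im w > 1/4" "\<bar>Re w\<bar> \<le> B" "p \<in> noncuspidal_pairs" for w p B
    by (rule order.trans[OF K(2)[OF z that(1,3)]],
        intro mult_left_mono mult_right_mono power_mono lattice_const_le that f0)
       (use that K(1) lattice_const_ge_1[of w] in auto)
  define U where "U = (\<lambda>B. {w. 1/4 < Im w \<and> Re w < B \<and> Re w > - B})"
  have oU: "open (U B)" for B
  proof -
    have "U B = {w. 1/4 < Im w} \<inter> {w. Re w < B} \<inter> {w. Re w > - B}" by (auto simp: U_def)
    thus ?thesis by (simp only: open_halfspace_Im_gt open_halfspace_Re_lt open_halfspace_Re_gt open_Int)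
  qed
  have hol: "poincare_term (seed l z) m p holomorphic_on U B" if "p \<in> noncuspidal_pairs" for p B
    by (rule holomorphic_on_subset[OF poincare_term_holomorphic[OF z that]]) (auto simp: U_def)
  have le: "norm (poincare_term (seed l z) m p w) \<le> K * 4 * ((1 + (1 + B) * 4) ^ 3 * ?f p)"
    if "p \<in> noncuspidal_pairs" "w \<in> U B" for p w B
  proof -
    have w: "Im w > 1/4" "\<bar>Re w\<bar> \<le> B" using that by (auto simp: U_def)
    have "K / Im w \<le> K * 4" using w(1) mult_left_mono[OF _ K(1), of 1 "4 * Im w"] by (simp add: field_simps)
    moreover have "(1 + (1 + B) * 4) ^ 3 * ?f p \<ge> 0" using w(2) by (intro mult_nonneg_nonneg f0) simp
    ultimately show ?thesis using bound[OF w that(1)] mult_right_mono order.trans by blast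
  qed
  have sM: "(\<lambda>p. K * 4 * ((1 + (1 + B) * 4) ^ 3 * ?f p)) summable_on noncuspidal_pairs" for B
    by (intro summable_on_cmult_right summable_on_noncuspidal)
  let ?S = "\<lambda>w. \<Sum>\<^sub>\<infinity>p\<in>noncuspidal_pairs. poincare_term (seed l z) m p w"
  have maj1: "?S holomorphic_on U B" for B
    by (rule holomorphic_series_majorant_holomorphic[OF oU _ _ sM[of B]]) (fact hol, fact le)
  have maj2: "(\<lambda>p. poincare_term (seed l z) m p w) abs_summable_on noncuspidal_pairs" if "w \<in> U B" for B w
    by (rule holomorphic_series_majorant_summable[OF oU _ _ sM[of B] that]) (fact hol, fact le)
  have maj3: "((\<lambda>p. deriv (poincare_term (seed l z) m p) w) has_sum deriv ?S w) noncuspidal_pairs" if "w \<in> U B" for B w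
    by (rule holomorphic_series_majorant_deriv[OF oU _ _ sM[of B] that]) (fact hol, fact le)
  have tail: "(\<lambda>w. \<Sum>\<^sub>\<infinity>p\<in>noncuspidal_pairs. poincare_term (seed l z) m p w) = poincare_tail l m z"
    by (simp add: fun_eq_iff poincare_tail_def)
  have cover: "w \<in> U (\<bar>Re w\<bar> + 1)" if "Im w > 1/4" for w using that by (auto simp: U_def)
  have "poincare_tail l m z field_differentiable (at w)" if "Im w > 1/4" for w
    using maj1[of "\<bar>Re w\<bar> + 1"] oU cover[OF that] unfolding tail
    by (rule holomorphic_on_imp_differentiable_at)
  thus "poincare_tail l m z holomorphic_on {w. Im w > 1/4}"
    by (auto simp: holomorphic_on_def intro: field_differentiable_at_within)
  show sm: "(\<lambda>p. poincare_term (seed l z) m p w) summable_on noncuspidal_pairs" if "Im w > 1/4" for w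
    by (rule abs_summable_summable[OF maj2[OF cover[OF that]]])
  show "((\<lambda>p. deriv (poincare_term (seed l z) m p) w) has_sum deriv (poincare_tail l m z) w) noncuspidal_pairs"
    if "Im w > 1/4" for w
    using maj3[OF cover[OF that]] unfolding tail .
  define C where "C = K * ((1 + (1 + 2) * 4) ^ 3 * infsum ?f noncuspidal_pairs)"
  show "\<exists>C. \<forall>w. Im w > 1/4 \<longrightarrow> \<bar>Re w\<bar> \<le> 2 \<longrightarrow> norm (poincare_tail l m z w) \<le> C / Im w"
  proof (intro exI[of _ C] allI impI)
    fix w assume w: "Im w > 1/4" "\<bar>Re w\<bar> \<le> 2"
    have "norm (poincare_tail l m z w) \<le> (\<Sum>\<^sub>\<infinity>p\<in>noncuspidal_pairs. K / Im w * ((1 + (1 + 2) * 4) ^ 3 * ?f p))"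
      unfolding poincare_tail_def
      by (rule norm_infsum_le[OF has_sum_infsum[OF sm[OF w(1)]] has_sum_infsum bound[OF w]])
         (intro summable_on_cmult_right summable_on_noncuspidal)
    also have "\<dots> = C / Im w" unfolding infsum_cmult_right' C_def by simp
    finally show "norm (poincare_tail l m z w) \<le> C / Im w" .
  qed
qed

text \<open>The two cuspidal pairs contribute equally because \<open>m\<close> is even.\<close>

lemma poincare_split:
  assumes m: "m \<ge> 2 * l + 4" and "even m" and z: "Im z \<ge> 5" and w: "Im w > 1/4"
  shows "poincare (seed l z) m w = poincare_tail l m z w + 2 * seed l z w"
    and "(\<lambda>p. poincare_term (seed l z) m p w) summable_on coprime_pairs"
proof -
  have w0: "Im w > 0" using w by simp
  have U: "coprime_pairs = noncuspidal_pairs \<union> {(0, 1), (0, -1)}"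
    by (auto simp: coprime_pairs_def noncuspidal_pairs_def)
  have n1: "seed l z (moebius_of (0, 1) w) = seed l z w"
    using moebius_of_eq[of 1 1 0 0 w] w0 seed_periodic by force
  have n2: "seed l z (moebius_of (0, -1) w) = seed l z w"
    using moebius_of_eq[of "-1" "-1" 0 0 w] w0 seed_periodic by force
  have "((\<lambda>p. poincare_term (seed l z) m p w) has_sum (poincare_tail l m z w + 2 * seed l z w))
          (noncuspidal_pairs \<union> {(0, 1), (0, -1)})"
  proof (rule has_sum_Un_disjoint)
    show "((\<lambda>p. poincare_term (seed l z) m p w) has_sum poincare_tail l m z w) noncuspidal_pairs"
      unfolding poincare_tail_def by (rule has_sum_infsum[OF poincare_tail_summable[OF m z w]])
    show "((\<lambda>p. poincare_term (seed l z) m p w) has_sum 2 * seed l z w) {(0, 1), (0, -1)}"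
      by (rule has_sum_finiteI)
         (use \<open>even m\<close> in \<open>auto simp: poincare_term_def jfactor_def n1 n2\<close>)
  qed (auto simp: noncuspidal_pairs_def)
  thus "poincare (seed l z) m w = poincare_tail l m z w + 2 * seed l z w"
    and "(\<lambda>p. poincare_term (seed l z) m p w) summable_on coprime_pairs"
    unfolding poincare_def U by (auto simp: has_sum_iff)
qed

section \<open>Periods of one-periodic functions and the elliptic relation\<close>

definition strip :: "real \<Rightarrow> real \<Rightarrow> complex set" where
  "strip A B = {w. A < Im w \<and> Im w < B}"

lemma open_strip: "open (strip A B)"
proof -
  have "strip A B = {w. A < Im w} \<inter> {w. Im w < B}" by (auto simp: strip_def)
  thus ?thesis by (simp add: open_halfspace_Im_gt open_halfspace_Im_lt open_Int)
qed

lemma convex_strip: "convex (strip A B)"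
proof -
  have "strip A B = {w. A < Im w} \<inter> {w. Im w < B}" by (auto simp: strip_def)
  thus ?thesis by (simp add: convex_halfspace_Im_gt convex_halfspace_Im_lt convex_Int)
qed

text \<open>The constant \<open>\<kappa>\<close> is the integral of \<open>f\<close> over one horizontal period. It is described by a primitive, so that its
  independence of the height and of the starting point needs no deformation of paths.\<close>

definition has_period :: "(complex \<Rightarrow> complex) \<Rightarrow> complex \<Rightarrow> real \<Rightarrow> real \<Rightarrow> bool" where
  "has_period f \<kappa> A B \<longleftrightarrow>
     (\<exists>G. \<forall>w\<in>strip A B. (G has_field_derivative f w) (at w) \<and> G (w + 1) = G w + \<kappa>)"

lemma ex_has_period:
  assumes hol: "f holomorphic_on strip A B" and per: "\<And>w. w \<in> strip A B \<Longrightarrow> f (w + 1) = f w"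
  shows "\<exists>\<kappa>. has_period f \<kappa> A B"
proof -
  obtain G where G: "\<And>w. w \<in> strip A B \<Longrightarrow> (G has_field_derivative f w) (at w within strip A B)"
    using holomorphic_convex_primitive'[OF convex_strip open_strip hol] by blast
  have G': "(G has_field_derivative f w) (at w)" if "w \<in> strip A B" for w
    using G[OF that] at_within_open[OF that open_strip] by simp
  have "\<exists>\<kappa>. \<forall>w\<in>strip A B. G (w + 1) - G w = \<kappa>"
  proof (rule has_field_derivative_zero_constant[OF convex_strip])
    fix w assume w: "w \<in> strip A B"
    hence w1: "w + 1 \<in> strip A B" by (simp add: strip_def)
    have "((\<lambda>w. G (w + 1)) has_field_derivative f (w + 1) * 1) (at w)"
      by (rule DERIV_chain2[where f = G and g = "\<lambda>w. w + 1", OF G'[OF w1]]) (auto intro!: derivative_eq_intros)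
    from DERIV_diff[OF this G'[OF w]] per[OF w]
    show "((\<lambda>w. G (w + 1) - G w) has_field_derivative 0) (at w within strip A B)"
      by (simp add: has_field_derivative_at_within)
  qed
  then obtain \<kappa> where "\<forall>w\<in>strip A B. G (w + 1) - G w = \<kappa>" by blast
  hence "\<forall>w\<in>strip A B. (G has_field_derivative f w) (at w) \<and> G (w + 1) = G w + \<kappa>"
    using G' by (auto simp: algebra_simps)
  thus ?thesis unfolding has_period_def by blast
qed

lemma has_period_contour_integral:
  assumes "has_period f \<kappa> A B" "w \<in> strip A B"
  shows "(f has_contour_integral \<kappa>) (linepath w (w + 1))"
proof -
  obtain G where G: "\<And>w. w \<in> strip A B \<Longrightarrow> (G has_field_derivative f w) (at w)"
     and P: "\<And>w. w \<in> strip A B \<Longrightarrow> G (w + 1) = G w + \<kappa>"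
    using assms(1) unfolding has_period_def by blast
  have "(f has_contour_integral (G (pathfinish (linepath w (w + 1))) - G (pathstart (linepath w (w + 1))))) (linepath w (w + 1))"
  proof (rule contour_integral_primitive[where S = "strip A B"])
    show "path_image (linepath w (w + 1)) \<subseteq> strip A B"
      using closed_segment_subset[OF assms(2) _ convex_strip, of "w + 1"] assms(2)
      by (auto simp: strip_def)
  qed (auto intro: has_field_derivative_at_within G)
  thus ?thesis using P[OF assms(2)] by simp
qed

lemma has_period_unique:
  assumes "has_period f \<kappa> A B" "has_period f \<kappa>' A' B'" "w \<in> strip A B" "w \<in> strip A' B'"
  shows "\<kappa> = \<kappa>'"
  using has_contour_integral_unique[OF has_period_contour_integral[OF assms(1,3)]
           has_period_contour_integral[OF assms(2,4)]] .

lemma convex_Re_Im_eq: "convex {w. Re w = x}" "convex {w. Im w = x}"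
proof -
  have "{w. Re w = x} = {w. Re w \<le> x} \<inter> {w. Re w \<ge> x}" "{w. Im w = x} = {w. Im w \<le> x} \<inter> {w. Im w \<ge> x}"
    by auto
  thus "convex {w. Re w = x}" "convex {w. Im w = x}"
    by (simp_all only: convex_Int convex_halfspace_Re_le convex_halfspace_Re_ge
          convex_halfspace_Im_le convex_halfspace_Im_ge)
qed

text \<open>The residue theorem on a rectangle of width 1 around \<open>p\<close>, whose vertical sides cancel by periodicity.\<close>

lemma period_jump:
  assumes AB: "A < Im p" "Im p < B"
      and hol: "f holomorphic_on strip A B - {p + of_int n | n. True}"
      and per: "\<And>w. w \<in> strip A B \<Longrightarrow> f (w + 1) = f w"
      and low: "has_period f \<kappa>1 A (Im p)" and high: "has_period f \<kappa>2 (Im p) B"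
  shows "\<kappa>1 - \<kappa>2 = 2 * of_real pi * \<i> * residue f p"
proof -
  define y1 where "y1 = (A + Im p) / 2"
  define y2 where "y2 = (Im p + B) / 2"
  have y: "A < y1" "y1 < Im p" "Im p < y2" "y2 < B" using AB by (auto simp: y1_def y2_def)
  define a where "a = Complex (Re p - 1/2) y1"
  define c where "c = Complex (Re p + 1/2) y2"
  define b where "b = Complex (Re p + 1/2) y1"
  define d where "d = Complex (Re p - 1/2) y2"
  have b1: "b = a + 1" and d1: "c = d + 1" by (auto simp: a_def b_def c_def d_def complex_eq_iff)
  define S where "S = strip A B \<inter> {w. Re w < Re p + 1} \<inter> {w. Re p - 1 < Re w}"
  have oS: "open S" unfolding S_def
    by (intro open_Int open_strip open_halfspace_Re_lt open_halfspace_Re_gt)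
  have cS: "convex S" unfolding S_def
    by (intro convex_Int convex_strip convex_halfspace_Re_lt convex_halfspace_Re_gt)
  have holS: "f holomorphic_on S - {p}"
  proof (rule holomorphic_on_subset[OF hol])
    show "S - {p} \<subseteq> strip A B - {p + of_int n | n. True}"
    proof
      fix w assume w: "w \<in> S - {p}"
      have "w \<noteq> p + of_int n" for n
      proof
        assume e: "w = p + of_int n"
        hence "\<bar>real_of_int n\<bar> < 1" using w by (auto simp: S_def)
        hence "n = 0" by linarith
        thus False using e w by simp
      qed
      thus "w \<in> strip A B - {p + of_int n | n. True}" using w by (auto simp: S_def)
    qed
  qed
  have abcd: "a \<in> S" "b \<in> S" "c \<in> S" "d \<in> S" using y by (auto simp: a_def b_def c_def d_def S_def strip_def)
  have ab: "(f has_contour_integral \<kappa>1) (linepath a b)"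
    unfolding b1 by (rule has_period_contour_integral[OF low]) (use y in \<open>auto simp: strip_def a_def\<close>)
  have dc: "(f has_contour_integral \<kappa>2) (linepath d c)"
    unfolding d1 by (rule has_period_contour_integral[OF high]) (use y in \<open>auto simp: strip_def d_def\<close>)
  have oSp: "open (S - {p})" using oS by (simp add: open_delete)
  have seg_ad: "closed_segment a d \<subseteq> S - {p}"
  proof -
    have "closed_segment a d \<subseteq> S \<inter> {w. Re w = Re p - 1/2}"
      by (rule closed_segment_subset) (use abcd in \<open>auto simp: a_def d_def intro!: convex_Int cS convex_Re_Im_eq\<close>)
    thus ?thesis by auto
  qed
  have seg_bc: "closed_segment b c \<subseteq> S - {p}"
  proof -
    have "closed_segment b c \<subseteq> S \<inter> {w. Re w = Re p + 1/2}"
      by (rule closed_segment_subset) (use abcd in \<open>auto simp: b_def c_def intro!: convex_Int cS convex_Re_Im_eq\<close>)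
    thus ?thesis by auto
  qed
  have seg_ab: "closed_segment a b \<subseteq> S - {p}"
  proof -
    have "closed_segment a b \<subseteq> S \<inter> {w. Im w = y1}"
      by (rule closed_segment_subset) (use abcd in \<open>auto simp: b_def a_def intro!: convex_Int cS convex_Re_Im_eq\<close>)
    thus ?thesis using y by auto
  qed
  have seg_dc: "closed_segment c d \<subseteq> S - {p}"
  proof -
    have "closed_segment c d \<subseteq> S \<inter> {w. Im w = y2}"
      by (rule closed_segment_subset) (use abcd in \<open>auto simp: c_def d_def intro!: convex_Int cS convex_Re_Im_eq\<close>)
    thus ?thesis using y by auto
  qed
  have "f contour_integrable_on linepath a d"
    by (rule contour_integrable_holomorphic_simple[OF holS oSp]) (use seg_ad in auto)
  then obtain I where ad: "(f has_contour_integral I) (linepath a d)"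
    using contour_integrable_on_def by blast
  have bc: "(f has_contour_integral I) (linepath b c)"
  proof -
    have "((\<lambda>x. f (linepath a d x) * (d - a)) has_integral I) {0..1}"
      using ad by (simp add: has_contour_integral_linepath)
    moreover have "f (linepath b c x) * (c - b) = f (linepath a d x) * (d - a)" if x: "x \<in> {0..1}" for x
    proof -
      have e: "linepath b c x = linepath a d x + 1"
        by (simp add: linepath_def b1 d1 algebra_simps)
      have "linepath a d x \<in> S" using seg_ad x by (metis Diff_subset linepath_in_path subset_iff)
      hence "f (linepath a d x + 1) = f (linepath a d x)" by (intro per) (auto simp: S_def)
      thus ?thesis unfolding e by (simp add: b1 d1)
    qed
    ultimately have "((\<lambda>x. f (linepath b c x) * (c - b)) has_integral I) {0..1}"
      by (subst has_integral_cong[where g = "\<lambda>x. f (linepath a d x) * (d - a)"]) auto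
    thus ?thesis by (simp add: has_contour_integral_linepath)
  qed
  have cd: "(f has_contour_integral (- \<kappa>2)) (linepath c d)"
    using has_contour_integral_reversepath[OF _ dc] by simp
  have da: "(f has_contour_integral (- I)) (linepath d a)"
    using has_contour_integral_reversepath[OF _ ad] by simp
  have rp: "rectpath a c = linepath a b +++ linepath b c +++ linepath c d +++ linepath d a"
    by (simp add: rectpath_def Let_def a_def b_def c_def d_def)
  have tot: "(f has_contour_integral (\<kappa>1 + (I + (- \<kappa>2 + - I)))) (rectpath a c)"
    unfolding rp by (intro has_contour_integral_join ab bc cd da) auto
  have "contour_integral (rectpath a c) f =
          2 * pi * \<i> * (\<Sum>q\<in>{p}. winding_number (rectpath a c) q * residue f q)"
  proof (rule Residue_theorem[OF oS])
    show "connected S" by (rule convex_connected[OF cS])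
    show "path_image (rectpath a c) \<subseteq> S - {p}"
      unfolding rp using seg_ab seg_bc seg_dc seg_ad by (auto simp: path_image_join closed_segment_commute)
    show "\<forall>z. z \<notin> S \<longrightarrow> winding_number (rectpath a c) z = 0"
    proof (intro allI impI)
      fix z assume z: "z \<notin> S"
      have "cbox a c \<subseteq> S"
      proof
        fix w assume "w \<in> cbox a c"
        thus "w \<in> S" using y by (auto simp: in_cbox_complex_iff a_def c_def S_def strip_def)
      qed
      thus "winding_number (rectpath a c) z = 0"
        using z y by (intro winding_number_rectpath_outside) (auto simp: a_def c_def)
    qed
  qed (use holS in auto)
  also have "winding_number (rectpath a c) p = 1"
    by (rule winding_number_rectpath) (use y in \<open>auto simp: in_box_complex_iff a_def c_def\<close>)
  hence "2 * pi * \<i> * (\<Sum>q\<in>{p}. winding_number (rectpath a c) q * residue f q) = 2 * of_real pi * \<i> * residue f p"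
    by simp
  finally show ?thesis using contour_integral_unique[OF tot] by simp
qed

text \<open>A convex region slit along a closed set is starlike about any point from which no segment to a point of the rest meets the slit.\<close>

lemma slit_primitive:
  assumes P: "a \<in> R" and R: "convex R" "open R"
      and L: "closed L" and star: "\<And>w. w \<in> R - L \<Longrightarrow> closed_segment a w \<inter> L = {}"
      and a: "a \<notin> L"
      and hol: "f holomorphic_on R - L"
  shows "\<exists>G. \<forall>w\<in>R - L. (G has_field_derivative f w) (at w)"
proof (rule holomorphic_starlike_primitive[where k = "{}"])
  show o: "open (R - L)" by (intro open_Diff R L)
  show "starlike (R - L)" unfolding starlike_def
  proof (intro bexI[of _ a] ballI)
    fix w assume w: "w \<in> R - L"
    have "closed_segment a w \<subseteq> R" by (rule closed_segment_subset) (use P R w in auto)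
    thus "closed_segment a w \<subseteq> R - L" using star[OF w] by auto
  qed (use P a in auto)
  show "continuous_on (R - L) f" by (rule holomorphic_on_imp_continuous_on[OF hol])
  show "f field_differentiable at x" if "x \<in> R - L - {}" for x
    using holomorphic_on_imp_differentiable_at[OF hol o] that by auto
qed simp

lemma primitives_differ_by_constant:
  assumes V: "convex V" "open V"
    and G: "\<And>w. w \<in> V \<Longrightarrow> (G has_field_derivative f w) (at w)"
    and H: "\<And>w. w \<in> V \<Longrightarrow> (H has_field_derivative f w) (at w)"
    and uv: "u \<in> V" "v \<in> V"
  shows "G u - H u = G v - H v"
proof -
  have "\<exists>c. \<forall>w\<in>V. G w - H w = c"
    by (rule has_field_derivative_zero_constant[OF V(1)])
       (use DERIV_diff[OF G H] in \<open>auto intro: has_field_derivative_at_within\<close>)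
  thus ?thesis using uv by auto
qed

lemma has_field_derivative_shift:
  assumes "(G has_field_derivative f (w + 1)) (at (w + 1))" "f (w + 1) = f w"
  shows "((\<lambda>w. G (w + 1)) has_field_derivative f w) (at (w :: complex))"
proof -
  have "((\<lambda>w. G (w + 1)) has_field_derivative f (w + 1) * 1) (at w)"
    by (rule DERIV_chain2[where f = G and g = "\<lambda>w. w + 1", OF assms(1)]) (auto intro!: derivative_eq_intros)
  thus ?thesis using assms(2) by simp
qed

lemma closed_vertical_ray:
  "closed {w. Re w = x \<and> Im w \<le> y}" "closed {w. Re w = x \<and> y \<le> Im w}"
proof -
  have "{w. Re w = x \<and> Im w \<le> y} = {w. Re w = x} \<inter> {w. Im w \<le> y}"
       "{w. Re w = x \<and> y \<le> Im w} = {w. Re w = x} \<inter> {w. Im w \<ge> y}" by auto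
  thus "closed {w. Re w = x \<and> Im w \<le> y}" "closed {w. Re w = x \<and> y \<le> Im w}"
    by (simp_all add: closed_halfspace_Re_eq closed_halfspace_Im_le closed_halfspace_Im_ge closed_Int)
qed

lemma segment_misses_vertical_line:
  assumes "v \<in> closed_segment a w" "Re v = Re a" "Re w \<noteq> Re a"
  shows "v = a"
proof -
  obtain u where u: "0 \<le> u" "u \<le> 1" "v = (1 - u) *\<^sub>R a + u *\<^sub>R w"
    using assms(1) by (auto simp: closed_segment_def)
  have "u * (Re w - Re a) = 0" using assms(2) u(3) by (simp add: algebra_simps)
  hence "u = 0" using assms(3) by simp
  thus ?thesis using u by simp
qed

lemma segment_on_vertical_line:
  assumes "v \<in> closed_segment a w"
  shows "min (Im a) (Im w) \<le> Im v" "Im v \<le> max (Im a) (Im w)"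
proof -
  have "Im v \<in> closed_segment (Im a) (Im w)"
    using assms by (metis bounded_linear_Im closed_segment_linear_image bounded_linear.linear image_eqI)
  thus "min (Im a) (Im w) \<le> Im v" "Im v \<le> max (Im a) (Im w)"
    by (auto simp: closed_segment_eq_real_ivl split: if_splits)
qed

lemma contour_integral_substitution:
  assumes G: "\<And>w. w \<in> closed_segment a b \<Longrightarrow> (G has_field_derivative f (s w)) (at (s w))"
      and s: "\<And>w. w \<in> closed_segment a b \<Longrightarrow> (s has_field_derivative s' w) (at w)"
      and f: "\<And>w. w \<in> closed_segment a b \<Longrightarrow> f (s w) * s' w = f w"
  shows "(f has_contour_integral (G (s b) - G (s a))) (linepath a b)"
proof -
  have "(f has_contour_integral ((\<lambda>w. G (s w)) (pathfinish (linepath a b)) - (\<lambda>w. G (s w)) (pathstart (linepath a b)))) (linepath a b)"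
  proof (rule contour_integral_primitive[where S = "closed_segment a b"])
    fix w assume w: "w \<in> closed_segment a b"
    have "((\<lambda>w. G (s w)) has_field_derivative f (s w) * s' w) (at w)"
      by (rule DERIV_chain2[OF G[OF w] s[OF w]])
    thus "((\<lambda>w. G (s w)) has_field_derivative f w) (at w within closed_segment a b)"
      using f[OF w] by (simp add: has_field_derivative_at_within)
  qed auto
  thus ?thesis by simp
qed

text \<open>Both points are treated at once: \<open>\<zz>\<close> is the root of \<open>x\<^sup>2 = t * x - 1\<close> in the upper half-plane, with
  \<open>t = 0\<close> for \<open>\<i>\<close> and \<open>t = 1\<close> for \<open>rho\<close>. Its stabilizer has order \<open>2 + t\<close> and is generated by
  \<open>w \<mapsto> 1 / (t - w)\<close>.\<close>

locale elliptic_point =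
  fixes \<zz> :: complex and t :: int
  assumes t: "t = 0 \<or> t = 1" and zz: "\<zz> = Complex (t / 2) (sqrt (1 - t\<^sup>2 / 4))"
begin

lemma Re_zz: "Re \<zz> = t / 2" and Im_zz_sq: "(Im \<zz>)\<^sup>2 = 1 - t\<^sup>2 / 4"
  using t by (auto simp: zz)

lemma Im_zz_bounds: "4/5 < Im \<zz>" "Im \<zz> \<le> 1" "Im \<zz> > 0"
proof -
  have "sqrt ((4/5)\<^sup>2) < sqrt (1 - t\<^sup>2 / 4)"
    using t by (intro real_sqrt_less_mono) (auto simp: power2_eq_square)
  thus 1: "4/5 < Im \<zz>" by (simp add: zz)
  show "Im \<zz> \<le> 1" by (simp add: zz)
  show "Im \<zz> > 0" using 1 by simp
qed

text \<open>A primitive on a slit region still increases by the period \<open>\<kappa>\<close> of whichever strip the region covers completely, and by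
  continuation it does so along whole vertical lines.\<close>

lemma slit_period:
  assumes V: "V = {w. x < Re w \<and> Re w < x + 1} \<inter> strip A B"
      and G: "\<And>w. w \<in> V \<Longrightarrow> (G has_field_derivative f w) (at w)"
      and G1: "\<And>w. w \<in> V \<Longrightarrow> (G has_field_derivative f (w + 1)) (at (w + 1))"
      and per: "\<And>w. w \<in> V \<Longrightarrow> f (w + 1) = f w"
      and W: "\<And>w. w \<in> W \<Longrightarrow> (G has_field_derivative f w) (at w)" "convex W" "open W"
      and H: "has_period f \<kappa> A' B'" "W \<subseteq> strip A' B'"
      and u: "u \<in> V" "u \<in> W" "u + 1 \<in> W" and v: "v \<in> V"
  shows "G (v + 1) - G v = \<kappa>"
proof -
  obtain K where K: "\<And>w. w \<in> strip A' B' \<Longrightarrow> (K has_field_derivative f w) (at w)"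
     and P: "\<And>w. w \<in> strip A' B' \<Longrightarrow> K (w + 1) = K w + \<kappa>"
    using H(1) unfolding has_period_def by blast
  have "G (u + 1) - K (u + 1) = G u - K u"
    by (rule primitives_differ_by_constant[OF W(2,3) W(1) K]) (use H(2) u in auto)
  moreover have "K (u + 1) = K u + \<kappa>" using P u H(2) by blast
  ultimately have 1: "G (u + 1) - G u = \<kappa>" by (simp add: algebra_simps)
  have "G (v + 1) - G v = G (u + 1) - G u"
  proof (rule primitives_differ_by_constant[where V = V and f = f])
    have "V = {w. x < Re w} \<inter> {w. Re w < x + 1} \<inter> strip A B" unfolding V by auto
    thus "convex V" "open V"
      by (simp_all only: convex_Int convex_halfspace_Re_gt convex_halfspace_Re_lt convex_strip
          open_Int open_halfspace_Re_gt open_halfspace_Re_lt open_strip)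
    show "((\<lambda>w. G (w + 1)) has_field_derivative f w) (at w)" if "w \<in> V" for w
      by (rule has_field_derivative_shift[where f = f, OF G1[OF that] per[OF that]])
  qed (use G u v in auto)
  thus ?thesis using 1 by simp
qed

text \<open>A region two units wide about \<open>\<zz>\<close>. Its lower edge \<open>Im \<zz> / 2\<close> excludes every point of the orbit except translates
  of \<open>\<zz>\<close>, because all other points of the orbit have imaginary part \<open>Im \<zz> / N\<close> with an integer \<open>N \<ge> 2\<close>.\<close>

definition window :: "complex set" where
  "window = {w. Re w < t / 2 + 1} \<inter> {w. t / 2 - 1 < Re w} \<inter> strip (Im \<zz> / 2) 5"

lemma window_props: "open window" "convex window"
  unfolding window_def
  by (simp_all only: convex_Int convex_halfspace_Re_gt convex_halfspace_Re_lt convex_strip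
          open_Int open_halfspace_Re_gt open_halfspace_Re_lt open_strip)

lemma window_strip: "convex (window \<inter> strip A B)" "open (window \<inter> strip A B)"
  by (intro convex_Int open_Int window_props convex_strip open_strip)+

lemma window_poles:
  assumes "w \<in> window" "w = \<zz> + of_int n" shows "w = \<zz>"
proof -
  have "\<bar>real_of_int n\<bar> < 1" using assms by (auto simp: window_def Re_zz)
  hence "n = 0" by linarith
  thus ?thesis using assms by simp
qed

lemma holomorphic_on_window:
  assumes hol: "f holomorphic_on strip (Im \<zz> / 2) 5 - {\<zz> + of_int n | n. True}" and L: "\<zz> \<in> L"
  shows "f holomorphic_on window - L"
proof (rule holomorphic_on_subset[OF hol])
  show "window - L \<subseteq> strip (Im \<zz> / 2) 5 - {\<zz> + of_int n | n. True}"
  proof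
    fix w assume w: "w \<in> window - L"
    have "w \<noteq> \<zz> + of_int n" for n using window_poles[of w n] w L by auto
    thus "w \<in> strip (Im \<zz> / 2) 5 - {\<zz> + of_int n | n. True}" using w by (auto simp: window_def)
  qed
qed

text \<open>The differential \<open>f dw\<close> is invariant under the generator \<open>s\<close> of the stabilizer.
  For \<open>t = 0\<close>, \<open>s\<close> maps the segment joining the two lower corners of the standard fundamental domain to a path
  that passes above \<open>\<i>\<close> in the opposite direction. For \<open>t = 1\<close>, the images under \<open>s\<close> and its square of the segment from \<open>\<i>\<close> to \<open>\<i> + 1\<close>
  form a path that passes below \<open>rho\<close> in the opposite direction. A vertical slit from \<open>\<zz>\<close>, downwards in the first case and upwards in the second,
  leaves a starlike region in which all these integrals are differences of one primitive.\<close>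

lemma elliptic_period_relation:
  assumes hol: "f holomorphic_on strip (Im \<zz> / 2) 5 - {\<zz> + of_int n | n. True}"
      and per: "\<And>w. Im w > 0 \<Longrightarrow> f (w + 1) = f w"
      and ell: "\<And>w. Im w > 0 \<Longrightarrow> f (1 / (of_int t - w)) = (of_int t - w)\<^sup>2 * f w"
      and low: "has_period f \<kappa>1 (Im \<zz> / 2) (Im \<zz>)"
      and high: "has_period f \<kappa>2 (Im \<zz>) 5"
  shows "\<kappa>1 = - of_int (1 + t) * \<kappa>2"
proof -
  have per': "f (w + 1) = f w" if "w \<in> strip (Im \<zz> / 2) 5" for w
    using that Im_zz_bounds by (intro per) (auto simp: strip_def)
  have s_deriv: "((\<lambda>w. 1 / (of_int t - w)) has_field_derivative 1 / (of_int t - w)\<^sup>2) (at w)" if "Im w > 0" for w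
  proof -
    have "of_int t - w \<noteq> 0" using that by (auto simp: complex_eq_iff)
    thus ?thesis by (auto intro!: derivative_eq_intros simp: power2_eq_square)
  qed
  have s_inv: "f (1 / (of_int t - w)) * (1 / (of_int t - w)\<^sup>2) = f w" if "Im w > 0" for w
  proof -
    have "of_int t - w \<noteq> 0" using that by (auto simp: complex_eq_iff)
    thus ?thesis using ell[OF that] by simp
  qed
  from t show ?thesis
  proof
    assume t0: "t = 0"
    have zz0: "\<zz> = \<i>" by (simp add: zz t0 complex_eq_iff)
    have I1: "Im \<zz> = 1" by (simp add: zz0)
    have win: "window = {w. Re w < 1 \<and> -1 < Re w \<and> 1/2 < Im w \<and> Im w < 5}"
      unfolding window_def by (auto simp: t0 zz0 strip_def)
    define L where "L = {w. Re w = 0 \<and> Im w \<le> 1}"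
    define e where "e = Complex (-1/2) (sqrt 3 / 2)"
    have s3: "sqrt 3 > 8/5" "sqrt 3 < 2"
      by (rule real_less_rsqrt, simp add: power2_eq_square, rule real_less_lsqrt, simp_all)
    have "\<exists>G. \<forall>w\<in>window - L. (G has_field_derivative f w) (at w)"
    proof (rule slit_primitive[where a = "2 * \<i>"])
      show "closed L" unfolding L_def by (rule closed_vertical_ray)
      show "f holomorphic_on window - L" by (rule holomorphic_on_window[OF hol]) (simp add: L_def zz0)
      fix w assume w: "w \<in> window - L"
      show "closed_segment (2 * \<i>) w \<inter> L = {}"
      proof (rule ccontr)
        assume "closed_segment (2 * \<i>) w \<inter> L \<noteq> {}"
        then obtain v where v: "v \<in> closed_segment (2 * \<i>) w" "Re v = 0" "Im v \<le> 1" by (auto simp: L_def)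
        show False
        proof (cases "Re w = 0")
          case True
          hence "Im w > 1" using w by (auto simp: L_def)
          thus False using segment_on_vertical_line(1)[OF v(1)] v(3) by auto
        next
          case False
          thus False using segment_misses_vertical_line[OF v(1)] v by auto
        qed
      qed
    qed (use window_props in \<open>auto simp: win L_def\<close>)
    then obtain G where G: "\<And>w. w \<in> window - L \<Longrightarrow> (G has_field_derivative f w) (at w)" by blast
    have "G (e + 1) - G e = \<kappa>2"
    proof (rule slit_period[where V = "{w. -1 < Re w \<and> Re w < -1 + 1} \<inter> strip (Im \<zz> / 2) 5"
            and W = "window \<inter> strip (Im \<zz>) 5" and u = "Complex (-1/2) 2", OF refl _ _ _ _ _ _ high])
      show "e \<in> {w. -1 < Re w \<and> Re w < -1 + 1} \<inter> strip (Im \<zz> / 2) 5"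
        using s3 by (auto simp: e_def strip_def I1)
    qed ((rule window_strip)+ | (auto intro!: G per' simp: win I1 L_def strip_def; fail))+
    moreover have "\<kappa>1 = G (1 / (of_int t - (e + 1))) - G (1 / (of_int t - e))"
    proof (rule has_contour_integral_unique[OF has_period_contour_integral[OF low] contour_integral_substitution[where G = G and s = "\<lambda>w. 1 / (of_int t - w)" and s' = "\<lambda>w. 1 / (of_int t - w)\<^sup>2"]])
      show "e \<in> strip (Im \<zz> / 2) (Im \<zz>)" using s3 by (simp add: strip_def e_def I1)
      fix w assume "w \<in> closed_segment e (e + 1)"
      then obtain u where u: "0 \<le> u" "u \<le> 1" "w = (1 - u) *\<^sub>R e + u *\<^sub>R (e + 1)"
        by (auto simp: closed_segment_def)
      define x where "x = u - 1/2"
      have x: "\<bar>x\<bar> \<le> 1/2" using u by (auto simp: x_def abs_if)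
      have w: "w = Complex x (sqrt 3 / 2)"
        unfolding u(3) by (auto simp: e_def x_def complex_eq_iff algebra_simps)
      have w0: "Im w > 0" by (simp add: w)
      have x2: "x\<^sup>2 \<le> 1/4" using x power_mono[of "\<bar>x\<bar>" "1/2" 2] by (simp add: power2_eq_square)
      define D where "D = x\<^sup>2 + 3/4"
      have D: "3/4 \<le> D" "D \<le> 1" using x2 by (auto simp: D_def)
      have sw: "1 / (of_int t - w) = Complex (- x / D) (sqrt 3 / 2 / D)"
        using D by (simp add: t0 w complex_eq_iff Re_divide Im_divide D_def power_divide)
      have "- x / D < 1" "-1 < - x / D" using D x by (auto simp: divide_less_eq less_divide_eq abs_le_iff)
      moreover have "1/2 < sqrt 3 / 2 / D" "sqrt 3 / 2 / D < 5" using D s3 by (auto simp: field_simps)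
      moreover have "sqrt 3 / 2 / D > 1" if "x = 0" using that s3 by (simp add: D_def)
      ultimately have "1 / (of_int t - w) \<in> window - L"
        using D unfolding sw by (auto simp: win I1 L_def strip_def)
      thus "(G has_field_derivative f (1 / (of_int t - w))) (at (1 / (of_int t - w)))" by (rule G)
      show "((\<lambda>w. 1 / (of_int t - w)) has_field_derivative 1 / (of_int t - w)\<^sup>2) (at w)" by (rule s_deriv[OF w0])
      show "f (1 / (of_int t - w)) * (1 / (of_int t - w)\<^sup>2) = f w" by (rule s_inv[OF w0])
    qed
    moreover have "1 / (of_int t - (e + 1)) = e" "1 / (of_int t - e) = e + 1"
      by (auto simp: t0 e_def complex_eq_iff Re_divide Im_divide power_divide)
    ultimately have "\<kappa>1 + \<kappa>2 = 0" by (simp add: algebra_simps)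
    thus ?thesis by (simp add: t0 add_eq_0_iff2)
  next
    assume t1: "t = 1"
    define y where "y = Im \<zz>"
    have y: "4/5 < y" "y < 9/10"
    proof -
      show "4/5 < y" using Im_zz_bounds by (simp add: y_def)
      have "sqrt (3/4) < sqrt ((9/10)\<^sup>2)" by (intro real_sqrt_less_mono) (simp add: power2_eq_square)
      thus "y < 9/10" by (simp add: y_def zz t1)
    qed
    have zz1: "\<zz> = Complex (1/2) y" by (simp add: complex_eq_iff Re_zz t1 y_def)
    have win: "window = {w. Re w < 3/2 \<and> -1/2 < Re w \<and> y/2 < Im w \<and> Im w < 5}"
      unfolding window_def by (auto simp: t1 y_def strip_def)
    have Iy: "Im \<zz> = y" by (simp add: y_def)
    define L where "L = {w. Re w = 1/2 \<and> y \<le> Im w}"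
    have "\<exists>G. \<forall>w\<in>window - L. (G has_field_derivative f w) (at w)"
    proof (rule slit_primitive[where a = "Complex (1/2) (1/2)"])
      show "closed L" unfolding L_def by (rule closed_vertical_ray)
      show "f holomorphic_on window - L" by (rule holomorphic_on_window[OF hol]) (simp add: L_def zz1)
      fix w assume w: "w \<in> window - L"
      show "closed_segment (Complex (1/2) (1/2)) w \<inter> L = {}"
      proof (rule ccontr)
        assume "closed_segment (Complex (1/2) (1/2)) w \<inter> L \<noteq> {}"
        then obtain v where v: "v \<in> closed_segment (Complex (1/2) (1/2)) w" "Re v = 1/2" "y \<le> Im v" by (auto simp: L_def)
        show False
        proof (cases "Re w = 1/2")
          case True
          hence "Im w < y" using w by (auto simp: L_def)
          thus False using segment_on_vertical_line(2)[OF v(1)] v(3) y by auto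
        next
          case False
          thus False using segment_misses_vertical_line[OF v(1)] v y by auto
        qed
      qed
    qed (use window_props y in \<open>auto simp: win L_def\<close>)
    then obtain G where G: "\<And>w. w \<in> window - L \<Longrightarrow> (G has_field_derivative f w) (at w)" by blast
    have A: "G (\<i> + 1) - G \<i> = \<kappa>1"
    proof (rule slit_period[where V = "{w. -1/2 < Re w \<and> Re w < -1/2 + 1} \<inter> strip (Im \<zz> / 2) 5"
            and W = "window \<inter> strip (Im \<zz> / 2) (Im \<zz>)" and u = "Complex 0 (1/2)", OF refl _ _ _ _ _ _ low])
      show "\<i> \<in> {w. -1/2 < Re w \<and> Re w < -1/2 + 1} \<inter> strip (Im \<zz> / 2) 5"
        using y by (auto simp: strip_def Iy)
    qed ((rule window_strip)+ | (use y in \<open>auto intro!: G per' simp: win Iy L_def strip_def\<close>; fail))+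
    have ist: "\<i> \<in> strip (Im \<zz>) 5" using y by (simp add: strip_def Iy)
    have seg: "\<exists>x. 0 \<le> x \<and> x \<le> 1 \<and> w = Complex x 1" if ws: "w \<in> closed_segment \<i> (\<i> + 1)" for w
    proof -
      obtain u where u: "0 \<le> u" "u \<le> 1" "w = (1 - u) *\<^sub>R \<i> + u *\<^sub>R (\<i> + 1)"
        using ws by (auto simp: closed_segment_def)
      have "w = Complex u 1" unfolding u(3) by (auto simp: complex_eq_iff algebra_simps)
      thus ?thesis using u by blast
    qed
    have inwin: "Complex a b \<in> window - L"
      if "0 \<le> a" "a \<le> 1" "1/2 \<le> b" "b \<le> 1" "a = 1/2 \<Longrightarrow> b = 1/2" for a b
      using that y by (auto simp: win Iy L_def strip_def)
    have B: "\<kappa>2 = G (1 / (of_int t - (\<i> + 1))) - G (1 / (of_int t - \<i>))"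
    proof (rule has_contour_integral_unique[OF has_period_contour_integral[OF high ist] contour_integral_substitution[where G = G and s = "\<lambda>w. 1 / (of_int t - w)" and s' = "\<lambda>w. 1 / (of_int t - w)\<^sup>2"]])
      fix w assume "w \<in> closed_segment \<i> (\<i> + 1)"
      then obtain x where x: "0 \<le> x" "x \<le> 1" and w: "w = Complex x 1" using seg by blast
      have w0: "Im w > 0" by (simp add: w)
      define X where "X = 1 - x"
      have X: "0 \<le> X" "X \<le> 1" using x by (auto simp: X_def)
      define D where "D = X\<^sup>2 + 1"
      have D: "1 \<le> D" "D \<le> 2" using X power_le_one[of X 2] by (auto simp: D_def)
      have sw: "1 / (of_int t - w) = Complex (X / D) (1 / D)"
        using D by (simp add: t1 w complex_eq_iff Re_divide Im_divide D_def X_def)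
      have "X / D = 1/2 \<Longrightarrow> (X - 1)\<^sup>2 = 0" using D by (simp add: D_def field_simps power2_eq_square)
      hence "X / D = 1/2 \<Longrightarrow> D = 2" by (simp add: D_def)
      hence "1 / (of_int t - w) \<in> window - L" unfolding sw
        using D X by (intro inwin) (auto simp: field_simps)
      thus "(G has_field_derivative f (1 / (of_int t - w))) (at (1 / (of_int t - w)))" by (rule G)
      show "((\<lambda>w. 1 / (of_int t - w)) has_field_derivative 1 / (of_int t - w)\<^sup>2) (at w)" by (rule s_deriv[OF w0])
      show "f (1 / (of_int t - w)) * (1 / (of_int t - w)\<^sup>2) = f w" by (rule s_inv[OF w0])
    qed
    have C: "\<kappa>2 = G (1 - 1 / (\<i> + 1)) - G (1 - 1 / \<i>)"
    proof (rule has_contour_integral_unique[OF has_period_contour_integral[OF high ist] contour_integral_substitution[where G = G and s = "\<lambda>w. 1 - 1 / w" and s' = "\<lambda>w. 1 / w\<^sup>2"]])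
      fix w assume "w \<in> closed_segment \<i> (\<i> + 1)"
      then obtain x where x: "0 \<le> x" "x \<le> 1" and w: "w = Complex x 1" using seg by blast
      have w0: "Im w > 0" by (simp add: w)
      have wn: "w \<noteq> 0" "1 - w \<noteq> 0" using w0 by (auto simp: complex_eq_iff)
      define D where "D = x\<^sup>2 + 1"
      have D: "1 \<le> D" "D \<le> 2" using x power_le_one[of x 2] by (auto simp: D_def)
      have sw: "1 - 1 / w = Complex (1 - x / D) (1 / D)"
        using D by (simp add: w complex_eq_iff Re_divide Im_divide D_def)
      have "1 - x / D = 1/2 \<Longrightarrow> (x - 1)\<^sup>2 = 0" using D by (simp add: D_def field_simps power2_eq_square)
      hence "1 - x / D = 1/2 \<Longrightarrow> D = 2" by (simp add: D_def)
      moreover have "x / D \<le> 1" using D x by (simp add: field_simps)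
      moreover have "0 \<le> x / D" using D x by simp
      ultimately have "1 - 1 / w \<in> window - L" unfolding sw
        using D x by (intro inwin) (auto simp: field_simps)
      thus "(G has_field_derivative f (1 - 1 / w)) (at (1 - 1 / w))" by (rule G)
      show "((\<lambda>w. 1 - 1 / w) has_field_derivative 1 / w\<^sup>2) (at w)"
        using wn by (auto intro!: derivative_eq_intros simp: power2_eq_square)
      \<comment> \<open>The map is the square of the elliptic element, so the invariance is applied twice.\<close>
      define v where "v = 1 / (1 - w)"
      have v0: "Im v > 0" using w0 wn by (auto simp: v_def Im_divide sum_power2_gt_zero_iff complex_eq_iff)
      have ov: "1 - v = - w / (1 - w)" using wn by (simp add: v_def field_simps)
      have "1 - 1 / w = 1 / (1 - v)" using wn unfolding ov by (simp add: field_simps)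
      hence "f (1 - 1 / w) = (1 - v)\<^sup>2 * f v" using ell[OF v0] by (simp add: t1)
      also have "f v = (1 - w)\<^sup>2 * f w" using ell[OF w0] by (simp add: t1 v_def)
      finally show "f (1 - 1 / w) * (1 / w\<^sup>2) = f w"
        unfolding ov using wn by (simp add: power_divide)
    qed
    have pts: "1 / (of_int t - (\<i> + 1)) = \<i>" "1 / (of_int t - \<i>) = Complex (1/2) (1/2)"
       "1 - 1 / (\<i> + 1) = Complex (1/2) (1/2)" "1 - 1 / \<i> = \<i> + 1"
      by (auto simp: t1 complex_eq_iff Re_divide Im_divide)
    have "\<kappa>2 + \<kappa>2 = G \<i> - G (\<i> + 1)" using B C unfolding pts by (metis add_diff_cancel diff_add_cancel diff_add_eq add.commute)
    hence "\<kappa>1 + 2 * \<kappa>2 = 0" using A by (simp add: algebra_simps)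
    thus ?thesis by (simp add: t1 add_eq_0_iff2)
  qed
qed

end

section \<open>The residue formula\<close>

lemma has_period_norm_le:
  assumes per: "has_period f \<kappa> A B" and y: "A < y" "y < B" and e: "e \<ge> 0"
      and le: "\<And>w. Im w = y \<Longrightarrow> 0 \<le> Re w \<Longrightarrow> Re w \<le> 1 \<Longrightarrow> norm (f w) \<le> e"
  shows "norm \<kappa> \<le> e"
proof -
  have w: "Complex 0 y \<in> strip A B" using y by (simp add: strip_def)
  have "norm \<kappa> \<le> e * norm (Complex 0 y + 1 - Complex 0 y)"
  proof (rule has_contour_integral_bound_linepath[OF has_period_contour_integral[OF per w] e])
    fix v assume "v \<in> closed_segment (Complex 0 y) (Complex 0 y + 1)"
    then obtain u where u: "0 \<le> u" "u \<le> 1" "v = (1 - u) *\<^sub>R Complex 0 y + u *\<^sub>R (Complex 0 y + 1)"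
      by (auto simp: closed_segment_def)
    have "Im v = y" "Re v = u" unfolding u(3) by (auto simp: algebra_simps)
    thus "norm (f v) \<le> e" using le u by auto
  qed
  thus ?thesis by simp
qed

lemma has_period_mono:
  "has_period f \<kappa> A B \<Longrightarrow> A \<le> A' \<Longrightarrow> B' \<le> B \<Longrightarrow> has_period f \<kappa> A' B'"
  unfolding has_period_def by (fastforce simp: strip_def)

context elliptic_point begin

text \<open>The norm form of the ring of integers, that is, the norm of \<open>c * \<zz> + d\<close>.\<close>

definition znorm :: "int \<Rightarrow> int \<Rightarrow> int" where
  "znorm c d = c\<^sup>2 + t * c * d + d\<^sup>2"

lemma cnj_zz: "cnj \<zz> = of_int t - \<zz>"
  by (simp add: complex_eq_iff Re_zz)

lemma zz_cnj: "\<zz> * cnj \<zz> = 1"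
proof -
  have "(Re \<zz>)\<^sup>2 + (Im \<zz>)\<^sup>2 = 1" unfolding Re_zz Im_zz_sq by (simp add: power_divide)
  thus ?thesis by (simp add: complex_mult_cnj flip: of_real_power of_real_add)
qed

lemma zz_sq: "\<zz>\<^sup>2 = of_int t * \<zz> - 1"
  using zz_cnj unfolding cnj_zz by (simp add: power2_eq_square algebra_simps)

lemma norm_zz: "norm \<zz> = 1"
proof -
  have "complex_of_real ((norm \<zz>)\<^sup>2) = complex_of_real 1" using zz_cnj complex_norm_square[of \<zz>] by simp
  hence "(norm \<zz>)\<^sup>2 = 1" by (simp only: of_real_eq_iff)
  thus ?thesis using norm_ge_zero[of \<zz>] by (metis abs_norm_cancel abs_square_eq_1)
qed

lemma znorm_eq: "of_int (znorm c d) = (of_int c * \<zz> + of_int d) * cnj (of_int c * \<zz> + of_int d)"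
proof -
  have "(of_int c * \<zz> + of_int d) * cnj (of_int c * \<zz> + of_int d) =
        of_int c ^ 2 * (\<zz> * cnj \<zz>) + of_int c * of_int d * (\<zz> + cnj \<zz>) + of_int d ^ 2"
    by (simp add: power2_eq_square algebra_simps)
  also have "\<dots> = of_int (znorm c d)" unfolding zz_cnj by (simp add: cnj_zz znorm_def)
  finally show ?thesis ..
qed

lemma znorm_cmod: "real_of_int (znorm c d) = (cmod (of_int c * \<zz> + of_int d))\<^sup>2"
proof -
  have "complex_of_real (real_of_int (znorm c d)) = complex_of_real ((cmod (of_int c * \<zz> + of_int d))\<^sup>2)"
    using znorm_eq[of c d] complex_norm_square[of "of_int c * \<zz> + of_int d"] by simp
  thus ?thesis by (simp only: of_real_eq_iff)
qed

lemma znorm_pos: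
  assumes "(c, d) \<in> coprime_pairs"
  shows "znorm c d \<ge> 1"
proof -
  have "jfactor (c, d) \<zz> \<noteq> 0" by (rule jfactor_nonzero[OF assms Im_zz_bounds(3)])
  hence "real_of_int (znorm c d) > 0" unfolding znorm_cmod by (simp add: jfactor_def)
  thus ?thesis by simp
qed

text \<open>Every point of the orbit is an integer plus \<open>\<zz>\<close>, divided by a norm; its imaginary part is thus \<open>Im \<zz> / N\<close>.\<close>

lemma moebius_zz:
  assumes det: "a * d - b * c = 1"
  shows "(of_int a * \<zz> + of_int b) / (of_int c * \<zz> + of_int d) =
           (of_int (a * c + b * d + t * b * c) + \<zz>) / of_int (znorm c d)"
proof -
  have p: "(c, d) \<in> coprime_pairs" by (rule det_imp_coprime[OF det])
  have j: "of_int c * \<zz> + of_int d \<noteq> 0" using jfactor_nonzero[OF p Im_zz_bounds(3)] by (simp add: jfactor_def)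
  hence cj: "cnj (of_int c * \<zz> + of_int d) \<noteq> 0" by (metis complex_cnj_zero_iff)
  have "(of_int a * \<zz> + of_int b) * cnj (of_int c * \<zz> + of_int d) =
         of_int (a * c) * (\<zz> * cnj \<zz>) + of_int (b * d) + of_int (a * d) * \<zz> + of_int (b * c) * cnj \<zz>"
    by (simp add: algebra_simps)
  also have "\<dots> = of_int (a * c + b * d + t * b * c) + of_int (a * d - b * c) * \<zz>"
    unfolding zz_cnj unfolding cnj_zz by (simp add: algebra_simps)
  also have "\<dots> = of_int (a * c + b * d + t * b * c) + \<zz>" unfolding det by simp
  finally have n: "(of_int a * \<zz> + of_int b) * cnj (of_int c * \<zz> + of_int d) = \<dots>" .
  have "(of_int a * \<zz> + of_int b) / (of_int c * \<zz> + of_int d) =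
        ((of_int a * \<zz> + of_int b) * cnj (of_int c * \<zz> + of_int d)) / ((of_int c * \<zz> + of_int d) * cnj (of_int c * \<zz> + of_int d))"
    using cj by simp
  thus ?thesis unfolding n znorm_eq [symmetric] .
qed

end

text \<open>The parity of \<open>m\<close> is no restriction: for odd \<open>m\<close> the matrix \<open>-1\<close> forces \<open>F = 0\<close>.\<close>

locale meromorphic_form = elliptic_point +
  fixes F :: "complex \<Rightarrow> complex" and l m :: nat
  assumes nmero: "F nicely_meromorphic_on {w. Im w > 0}"
      and F_modular: "\<And>a b c d w. a * d - b * c = 1 \<Longrightarrow> Im w > 0 \<Longrightarrow>
            F ((of_int a * w + of_int b) / (of_int c * w + of_int d)) = (of_int c * w + of_int d) powi (2 - int m) * F w"
      and F_pole: "\<And>w. Im w > 0 \<Longrightarrow> is_pole F w \<Longrightarrow>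
            (\<exists>a b c d. a * d - b * c = 1 \<and> w = (of_int a * \<zz> + of_int b) / (of_int c * \<zz> + of_int d)) \<and> zorder F w \<ge> -2"
      and F_bounded: "\<exists>Y C. \<forall>w. Im w > Y \<longrightarrow> norm (F w) \<le> C"
      and m: "m \<ge> 2 * l + 4" and even_m: "even m"
begin

text \<open>Poles above half the height of \<open>\<zz>\<close> come from matrices whose bottom row has norm 1.\<close>

lemma F_poles_above:
  assumes w: "Im w > Im \<zz> / 2" and p: "is_pole F w"
  shows "\<exists>n. w = \<zz> + of_int n"
proof -
  have w0: "Im w > 0" using w Im_zz_bounds by simp
  obtain a b c d where det: "a * d - b * c = 1" and weq: "w = (of_int a * \<zz> + of_int b) / (of_int c * \<zz> + of_int d)"
    using F_pole[OF w0 p] by blast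
  have N1: "znorm c d \<ge> 1" by (rule znorm_pos[OF det_imp_coprime[OF det]])
  have "Im w = Im \<zz> / of_int (znorm c d)" unfolding weq moebius_zz[OF det] by simp
  hence "Im \<zz> / 2 < Im \<zz> / of_int (znorm c d)" using w by simp
  hence "real_of_int (znorm c d) < 2" using N1 Im_zz_bounds by (simp add: field_simps)
  hence "znorm c d = 1" using N1 by linarith
  hence "w = \<zz> + of_int (a * c + b * d + t * b * c)" unfolding weq moebius_zz[OF det] by simp
  thus ?thesis by blast
qed

lemma F_analytic: "Im w > 0 \<Longrightarrow> \<not> is_pole F w \<Longrightarrow> F analytic_on {w}"
  by (rule nicely_meromorphic_on_imp_analytic_at[OF nmero]) auto

lemma F_holomorphic:
  "F holomorphic_on {w. Im w > Im \<zz> / 2} - {\<zz> + of_int n | n. True}"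
proof -
  have "F analytic_on {w. Im w > Im \<zz> / 2} - {\<zz> + of_int n | n. True}"
    unfolding analytic_on_analytic_at[of _ "_ - _"]
  proof
    fix w assume w: "w \<in> {w. Im w > Im \<zz> / 2} - {\<zz> + of_int n | n. True}"
    hence "\<not> is_pole F w" using F_poles_above by blast
    thus "F analytic_on {w}" using w Im_zz_bounds by (intro F_analytic) auto
  qed
  thus ?thesis by (rule analytic_imp_holomorphic)
qed

lemma F_holomorphic_high: "F holomorphic_on {w. Im w > Im \<zz>}"
  by (rule holomorphic_on_subset[OF F_holomorphic]) (use Im_zz_bounds in auto)

lemma F_periodic: "Im w > 0 \<Longrightarrow> F (w + 1) = F w"
  using F_modular[of 1 1 1 0 w] by simp

text \<open>A meromorphic form of weight \<open>(2 - m) + m = 2\<close>.\<close>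

definition Phi :: "complex \<Rightarrow> complex \<Rightarrow> complex" where
  "Phi z w = F w * poincare (seed l z) m w"

lemma Phi_periodic: "Im w > 0 \<Longrightarrow> Phi z (w + 1) = Phi z w"
  using F_periodic[of w] poincare_modular[of "seed l z" 1 1 1 0 w m] seed_periodic
  by (simp add: Phi_def)

lemma Phi_elliptic:
  assumes w: "Im w > 0"
  shows "Phi z (1 / (of_int t - w)) = (of_int t - w)\<^sup>2 * Phi z w"
proof -
  define j where "j = of_int t - w"
  have j: "j \<noteq> 0" using w by (auto simp: complex_eq_iff j_def)
  have "F (1 / j) = j powi (2 - int m) * F w"
    using F_modular[of 0 t 1 "-1" w] w by (simp add: j_def)
  moreover have "poincare (seed l z) m (1 / j) = j ^ m * poincare (seed l z) m w"
    using poincare_modular[of "seed l z" 0 t 1 "-1" w m] seed_periodic w by (simp add: j_def)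
  moreover have "j powi (2 - int m) * j ^ m = j\<^sup>2"
  proof -
    have "j powi (2 - int m) * j ^ m = j powi (2 - int m) * j powi int m" by simp
    also have "\<dots> = j powi (2 - int m + int m)" using j by (subst power_int_add) auto
    also have "\<dots> = j\<^sup>2" by simp
    finally show ?thesis .
  qed
  ultimately show ?thesis unfolding Phi_def j_def [symmetric] by (metis mult.assoc mult.commute)
qed

lemma poincare_holomorphic:
  assumes z: "Im z \<ge> 6" and A: "A \<subseteq> {w. Im w > 1/4}" "\<And>w n. w \<in> A \<Longrightarrow> w \<noteq> z + of_int n"
  shows "poincare (seed l z) m holomorphic_on A"
proof -
  have "(\<lambda>w. poincare_tail l m z w + 2 * seed l z w) holomorphic_on A"
    using A z by (intro holomorphic_intros seed_holomorphic holomorphic_on_subset[OF poincare_tail_holomorphic[OF m]]) force+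
  thus ?thesis
    by (rule holomorphic_transform) (use A z poincare_split(1)[OF m even_m] in auto)
qed

lemma Phi_holomorphic:
  assumes z: "Im z \<ge> 6" and A: "A \<subseteq> {w. Im w > Im \<zz> / 2}"
      "\<And>w n. w \<in> A \<Longrightarrow> w \<noteq> z + of_int n" "\<And>w n. w \<in> A \<Longrightarrow> w \<noteq> \<zz> + of_int n"
  shows "Phi z holomorphic_on A"
proof -
  have h: "Im \<zz> / 2 > 1/4" using Im_zz_bounds by simp
  show ?thesis unfolding Phi_def [abs_def]
    by (intro holomorphic_intros poincare_holomorphic[OF z] holomorphic_on_subset[OF F_holomorphic])
       (use A h in \<open>force+\<close>)
qed

text \<open>At the cusp \<open>F\<close> is bounded while both parts of the Poincare series tend to 0.\<close>

lemma Phi_small: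
  assumes z: "Im z \<ge> 6" and e: "e > 0"
  shows "\<exists>y0. \<forall>w. Im w \<ge> y0 \<longrightarrow> 0 \<le> Re w \<longrightarrow> Re w \<le> 1 \<longrightarrow> norm (Phi z w) \<le> e"
proof -
  obtain Y C where FC: "\<And>w. Im w > Y \<Longrightarrow> norm (F w) \<le> C" using F_bounded by blast
  define C' where "C' = max C 0 + 1"
  have FC': "norm (F w) \<le> C'" if "Im w > Y" for w using FC[OF that] by (simp add: C'_def)
  have C': "C' > 0" by (simp add: C'_def)
  obtain T where T: "\<And>w. Im w > 1/4 \<Longrightarrow> \<bar>Re w\<bar> \<le> 2 \<Longrightarrow> norm (poincare_tail l m z w) \<le> T / Im w"
    using poincare_tail_bound[OF m, of z] z by force
  obtain E where E: "E \<ge> 0" "\<And>w. Im w \<ge> 1 \<Longrightarrow> norm (E2 w) \<le> E" using E2_bounded[of 1] by auto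
  define K where "K = max T 0 + 2 * E ^ l"
  have K: "K \<ge> 0" using E by (simp add: K_def)
  \<comment> \<open>Above \<open>z\<close> the kernel decays exponentially, in particular like the reciprocal height.\<close>
  have ker: "norm (cauchy_kernel z w) \<le> 1 / (Im w - Im z)" if w: "Im w > Im z" for w
  proof -
    define x where "x = Im w - Im z"
    have x: "x > 0" using w by (simp add: x_def)
    have "1 + x \<le> exp x" by (rule exp_ge_add_one_self)
    also have "exp x \<le> exp (2 * pi * x)" using pi_gt3 x by (simp add: mult_le_cancel_right1)
    finally have "1 + x \<le> norm (nome (z - w))" by (simp add: norm_nome x_def algebra_simps)
    hence "x \<le> norm (1 - nome (z - w))"
      using norm_triangle_ineq2[of "nome (z - w)" 1] by (simp add: norm_minus_commute)
    hence "1 / norm (1 - nome (z - w)) \<le> 1 / x"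
      using x by (intro divide_left_mono mult_pos_pos) auto
    thus ?thesis by (simp add: cauchy_kernel_def norm_divide x_def)
  qed
  \<comment> \<open>At this height \<open>C' * K\<close> divided by the height above \<open>z\<close> is at most \<open>e\<close>.\<close>
  define y0 where "y0 = max (Y + 1) (Im z + 1 + C' * K / e)"
  show ?thesis
  proof (intro exI[of _ y0] allI impI)
    fix w assume w: "Im w \<ge> y0" "0 \<le> Re w" "Re w \<le> 1"
    define x where "x = Im w - Im z"
    have CK: "C' * K / e \<ge> 0" using C' K e by simp
    have x: "x > 0" "C' * K / e \<le> x" "x \<le> Im w" "Im w > Y" "Im w > 1"
      using w z CK by (auto simp: x_def y0_def)
    have s: "norm (seed l z w) \<le> E ^ l * (1 / x)"
      unfolding seed_def norm_mult norm_power x_def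
      by (intro mult_mono power_mono ker E) (use x E z in \<open>auto simp: x_def\<close>)
    have t1: "norm (poincare_tail l m z w) \<le> max T 0 / x"
    proof -
      have "norm (poincare_tail l m z w) \<le> T / Im w" by (rule T) (use x w in auto)
      also have "\<dots> \<le> max T 0 / Im w" using x by (intro divide_right_mono) auto
      also have "\<dots> \<le> max T 0 / x" using x by (intro divide_left_mono mult_pos_pos) auto
      finally show ?thesis .
    qed
    have "poincare (seed l z) m w = poincare_tail l m z w + 2 * seed l z w"
      by (rule poincare_split(1)[OF m even_m]) (use z x in auto)
    hence "norm (poincare (seed l z) m w) \<le> norm (poincare_tail l m z w) + norm (2 * seed l z w)"
      by (metis norm_triangle_ineq)
    also have "\<dots> \<le> max T 0 / x + 2 * (E ^ l * (1 / x))" using t1 s by (simp add: norm_mult)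
    also have "\<dots> = K / x" by (simp add: K_def add_divide_distrib)
    finally have "norm (Phi z w) \<le> C' * (K / x)"
      unfolding Phi_def norm_mult using C' FC'[OF x(4)] by (intro mult_mono) auto
    also have "\<dots> \<le> e" using x(1,2) e by (simp add: field_simps)
    finally show "norm (Phi z w) \<le> e" .
  qed
qed

lemma residue_Phi_kernel:
  assumes z: "Im z \<ge> 6"
  shows "2 * of_real pi * \<i> * residue (Phi z) z = 2 * (E2 z ^ l * F z)"
proof -
  define U where "U = ball z 1"
  have U: "Im w > 5" if "w \<in> U" for w
  proof -
    have "\<bar>Im (z - w)\<bar> < 1" using that abs_Im_le_cmod[of "z - w"] by (simp add: U_def dist_norm)
    thus ?thesis using z by simp
  qed
  have Uz: "w \<noteq> z + of_int n" if "w \<in> U - {z}" for w n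
  proof
    assume e: "w = z + of_int n"
    hence "norm (of_int n :: complex) < 1" using that by (simp add: U_def dist_norm)
    hence "n = 0" by simp
    thus False using e that by simp
  qed
  have Fz: "F holomorphic_on U"
    by (rule holomorphic_on_subset[OF F_holomorphic_high]) (use U Im_zz_bounds in force)
  have Tz: "poincare_tail l m z holomorphic_on U"
    by (rule holomorphic_on_subset[OF poincare_tail_holomorphic[OF m]]) (use U z in force)+
  have E2_value: "E2 holomorphic_on U"
    by (rule holomorphic_on_subset[OF E2_holomorphic]) (use U in force)
  have zU: "z \<in> U" "open U" by (auto simp: U_def)
  have cont: "f \<midarrow>z\<rightarrow> f z" if "f holomorphic_on U" for f
    using holomorphic_on_imp_continuous_on[OF that] zU continuous_on_eq_continuous_at[of U f]
    by (auto simp: isCont_def)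
  define u where "u = (\<lambda>w. 1 - nome (z - w))"
  have "(u has_field_derivative 2 * of_real pi * \<i>) (at z)"
    unfolding u_def nome_def by (auto intro!: derivative_eq_intros)
  hence "(\<lambda>w. (u w - u z) / (w - z)) \<midarrow>z\<rightarrow> 2 * of_real pi * \<i>" by (simp add: has_field_derivative_iff)
  hence "(\<lambda>w. inverse ((u w - u z) / (w - z))) \<midarrow>z\<rightarrow> inverse (2 * of_real pi * \<i>)"
    by (rule tendsto_inverse) simp
  hence lim: "(\<lambda>w. cauchy_kernel z w * (w - z)) \<midarrow>z\<rightarrow> inverse (2 * of_real pi * \<i>)"
    by (simp add: u_def cauchy_kernel_def nome_def)
  have "residue (Phi z) z = 0 + 2 * (F z * E2 z ^ l * inverse (2 * of_real pi * \<i>))"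
  proof (rule residue_simple'[OF zU(2,1)])
    show "Phi z holomorphic_on U - {z}"
      by (rule Phi_holomorphic[OF z]) (use U Uz Im_zz_bounds in \<open>force+\<close>)
    have "(\<lambda>w. F w * poincare_tail l m z w * (w - z) + 2 * (F w * E2 w ^ l * (cauchy_kernel z w * (w - z))))
            \<midarrow>z\<rightarrow> F z * poincare_tail l m z z * (z - z) + 2 * (F z * E2 z ^ l * inverse (2 * of_real pi * \<i>))"
      by (intro tendsto_intros lim cont Fz Tz E2_value)
    moreover have "\<forall>\<^sub>F w in at z. F w * poincare_tail l m z w * (w - z) + 2 * (F w * E2 w ^ l * (cauchy_kernel z w * (w - z)))
                     = Phi z w * (w - z)"
      using eventually_at_in_open'[OF zU(2,1)]
    proof eventually_elim
      case (elim w)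
      have "poincare (seed l z) m w = poincare_tail l m z w + 2 * seed l z w"
        by (rule poincare_split(1)[OF m even_m]) (use z U[OF elim] in auto)
      thus ?case by (simp add: Phi_def seed_def algebra_simps)
    qed
    ultimately show "(\<lambda>w. Phi z w * (w - z)) \<midarrow>z\<rightarrow> 0 + 2 * (F z * E2 z ^ l * inverse (2 * of_real pi * \<i>))"
      by (auto intro: Lim_transform_eventually)
  qed
  thus ?thesis by (simp add: field_simps)
qed

text \<open>The three strips below \<open>\<zz>\<close>, between \<open>\<zz>\<close> and \<open>z\<close>, and above \<open>z\<close> have periods \<open>\<kappa>1\<close>, \<open>\<kappa>2\<close>
  and \<open>\<kappa>3\<close>. The last one is 0, the jump at \<open>z\<close> gives \<open>\<kappa>2 = 2 * E2 z ^ l * F z\<close>, and the elliptic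
  relation turns the jump at \<open>\<zz>\<close> into \<open>-(2 + t) * \<kappa>2\<close>.\<close>

theorem residue_formula:
  assumes z: "Im z \<ge> 6"
  shows "E2 z ^ l * F z = - (of_real pi * \<i> / of_int (2 + t)) * residue (Phi z) \<zz>"
proof -
  let ?y = "Im \<zz>"
  have y: "?y > 0" "?y \<le> 1" using Im_zz_bounds by auto
  have per: "Phi z (w + 1) = Phi z w" if "w \<in> strip A B" "A \<ge> 0" for w A B
    by (rule Phi_periodic) (use that in \<open>auto simp: strip_def\<close>)
  have hol1: "Phi z holomorphic_on strip (?y / 2) 5 - {\<zz> + of_int n | n. True}"
    by (rule Phi_holomorphic[OF z]) (use z in \<open>auto simp: strip_def\<close>)
  have hol2: "Phi z holomorphic_on strip ?y (Im z + 1) - {z + of_int n | n. True}"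
    by (rule Phi_holomorphic[OF z]) (use z y in \<open>auto simp: strip_def\<close>)
  have "Phi z holomorphic_on strip (?y / 2) ?y"
    by (rule holomorphic_on_subset[OF hol1]) (use y in \<open>auto simp: strip_def\<close>)
  hence "\<exists>\<kappa>. has_period (Phi z) \<kappa> (?y / 2) ?y"
    by (rule ex_has_period) (use y in \<open>auto intro: per\<close>)
  then obtain \<kappa>1 where k1: "has_period (Phi z) \<kappa>1 (?y / 2) ?y" by blast
  have "Phi z holomorphic_on strip ?y (Im z)"
    by (rule holomorphic_on_subset[OF hol2]) (use z in \<open>auto simp: strip_def\<close>)
  hence "\<exists>\<kappa>. has_period (Phi z) \<kappa> ?y (Im z)"
    by (rule ex_has_period) (use y in \<open>auto intro: per\<close>)
  then obtain \<kappa>2 where k2: "has_period (Phi z) \<kappa>2 ?y (Im z)" by blast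
  have high: "\<exists>\<kappa>. has_period (Phi z) \<kappa> (Im z) B" for B
  proof (rule ex_has_period)
    show "Phi z holomorphic_on strip (Im z) B"
      by (rule Phi_holomorphic[OF z]) (use z y in \<open>auto simp: strip_def\<close>)
    show "Phi z (w + 1) = Phi z w" if "w \<in> strip (Im z) B" for w
      by (rule per[OF that]) (use z in simp)
  qed
  obtain \<kappa>3 where k3: "has_period (Phi z) \<kappa>3 (Im z) (Im z + 1)" using high by blast
  have "\<kappa>3 = 0"
  proof (rule ccontr)
    assume n: "\<kappa>3 \<noteq> 0"
    hence e: "norm \<kappa>3 / 2 > 0" by simp
    obtain y0 where y0: "\<And>w. Im w \<ge> y0 \<Longrightarrow> 0 \<le> Re w \<Longrightarrow> Re w \<le> 1 \<Longrightarrow> norm (Phi z w) \<le> norm \<kappa>3 / 2"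
      using Phi_small[OF z e] by blast
    define Y where "Y = max y0 (Im z + 1)"
    obtain \<kappa>' where k': "has_period (Phi z) \<kappa>' (Im z) (Y + 1)" using high by blast
    have "norm \<kappa>' \<le> norm \<kappa>3 / 2"
      by (rule has_period_norm_le[OF k', of Y]) (use y0 in \<open>auto simp: Y_def\<close>)
    moreover have "\<kappa>' = \<kappa>3"
      by (rule has_period_unique[OF k' k3, of "Complex 0 (Im z + 1/2)"]) (auto simp: strip_def Y_def)
    ultimately show False using n by simp
  qed
  moreover have "\<kappa>2 - \<kappa>3 = 2 * of_real pi * \<i> * residue (Phi z) z"
    by (rule period_jump[OF _ _ hol2 _ k2 k3]) (use z y in \<open>auto intro: per\<close>)
  ultimately have e2: "\<kappa>2 = 2 * (E2 z ^ l * F z)" using residue_Phi_kernel[OF z] by simp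
  have k2': "has_period (Phi z) \<kappa>2 ?y 5" by (rule has_period_mono[OF k2]) (use z in auto)
  have j: "\<kappa>1 - \<kappa>2 = 2 * of_real pi * \<i> * residue (Phi z) \<zz>"
    by (rule period_jump[OF _ _ hol1 _ k1 k2']) (use y in \<open>auto intro: per\<close>)
  have "\<kappa>1 = - of_int (1 + t) * \<kappa>2"
    by (rule elliptic_period_relation[OF hol1 Phi_periodic Phi_elliptic k1 k2'])
  with j have "- of_int (2 + t) * \<kappa>2 = 2 * of_real pi * \<i> * residue (Phi z) \<zz>"
    by (simp add: algebra_simps)
  hence "- of_int (2 + t) * (E2 z ^ l * F z) = of_real pi * \<i> * residue (Phi z) \<zz>"
    unfolding e2 by simp
  moreover have "of_int (2 + t) \<noteq> (0 :: complex)" using t by auto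
  moreover have "B = - (P / A) * R" if "- A * B = P * R" "A \<noteq> 0" for A B P R :: complex
  proof -
    have "A * B = - (P * R)" using that(1) by (metis minus_minus mult_minus_left)
    hence "B = - (P * R) / A" using that(2) by (metis nonzero_mult_div_cancel_left)
    thus ?thesis by simp
  qed
  ultimately show ?thesis by blast
qed

text \<open>A pole of order at most 2 means that \<open>(w - \<zz>)\<^sup>2 * F w\<close> extends holomorphically; \<open>a0\<close> and \<open>b0\<close> are the value and
  the derivative of the extension.\<close>

lemma residue_F_times:
  "\<exists>a0 b0. \<forall>H U. open U \<longrightarrow> \<zz> \<in> U \<longrightarrow> H holomorphic_on U \<longrightarrow>
     residue (\<lambda>w. F w * H w) \<zz> = a0 * deriv H \<zz> + b0 * H \<zz>"
proof -
  have y: "Im \<zz> > 0" using Im_zz_bounds by simp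
  have "\<exists>r g. r > 0 \<and> g holomorphic_on ball \<zz> r \<and> (\<forall>w \<in> ball \<zz> r - {\<zz>}. F w = g w / (w - \<zz>)\<^sup>2)"
  proof (cases "is_pole F \<zz>")
    case True
    define S where "S = ball \<zz> (Im \<zz> / 2)"
    have "F holomorphic_on S - {\<zz>}"
    proof (rule holomorphic_on_subset[OF F_holomorphic], rule subsetI)
      fix w assume w: "w \<in> S - {\<zz>}"
      have d: "dist \<zz> w < Im \<zz> / 2" using w by (simp add: S_def)
      have "\<bar>Im (\<zz> - w)\<bar> < Im \<zz> / 2" using d abs_Im_le_cmod[of "\<zz> - w"] by (simp add: dist_norm)
      hence "Im (\<zz> - w) < Im \<zz> / 2" by (rule abs_less_iff[THEN iffD1, THEN conjunct1])
      hence "Im w > Im \<zz> / 2" by simp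
      moreover have "w \<noteq> \<zz> + of_int n" for n
      proof
        assume e: "w = \<zz> + of_int n"
        hence "norm (of_int n :: complex) < 1" using d Im_zz_bounds by (simp add: dist_norm)
        hence "n = 0" by simp
        thus False using e w by simp
      qed
      ultimately show "w \<in> {w. Im w > Im \<zz> / 2} - {\<zz> + of_int n | n. True}" by auto
    qed
    from zorder_exist_pole[OF this _ _ True] y obtain r where
      n0: "zorder F \<zz> < 0" and r: "r > 0" "zor_poly F \<zz> holomorphic_on cball \<zz> r"
        "\<And>w. w \<in> cball \<zz> r - {\<zz>} \<Longrightarrow> F w = zor_poly F \<zz> w / (w - \<zz>) ^ nat (- zorder F \<zz>)"
      by (auto simp: S_def)
    have n2: "zorder F \<zz> \<ge> -2" using F_pole[OF y True] by blast
    define k where "k = nat (- zorder F \<zz>)"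
    have k: "k \<le> 2" using n2 by (simp add: k_def)
    show ?thesis
    proof (intro exI[of _ r] exI[of _ "\<lambda>w. zor_poly F \<zz> w * (w - \<zz>) ^ (2 - k)"] conjI ballI)
      show "(\<lambda>w. zor_poly F \<zz> w * (w - \<zz>) ^ (2 - k)) holomorphic_on ball \<zz> r"
        by (intro holomorphic_intros holomorphic_on_subset[OF r(2)]) auto
      fix w assume w: "w \<in> ball \<zz> r - {\<zz>}"
      have "(w - \<zz>)\<^sup>2 = (w - \<zz>) ^ (2 - k) * (w - \<zz>) ^ k" using k by (simp flip: power_add)
      thus "F w = zor_poly F \<zz> w * (w - \<zz>) ^ (2 - k) / (w - \<zz>)\<^sup>2"
        using r(3)[of w] w by (simp add: k_def)
    qed (rule r(1))
  next
    case False
    then obtain r where r: "r > 0" "F holomorphic_on ball \<zz> r"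
      using F_analytic[OF y] analytic_at_ball by blast
    show ?thesis
      by (intro exI[of _ r] exI[of _ "\<lambda>w. F w * (w - \<zz>)\<^sup>2"])
         (use r in \<open>auto intro!: holomorphic_intros\<close>)
  qed
  then obtain g r where gr: "r > 0" "g holomorphic_on ball \<zz> r" "\<And>w. w \<in> ball \<zz> r - {\<zz>} \<Longrightarrow> F w = g w / (w - \<zz>)\<^sup>2"
    by blast
  show ?thesis
  proof (rule exI[of _ "g \<zz>"], rule exI[of _ "deriv g \<zz>"], intro allI impI)
    fix H U assume H: "open U" "\<zz> \<in> U" "H holomorphic_on U"
    \<comment> \<open>On \<open>V\<close> the quotient by the square has a holomorphic numerator, so the residue is a first derivative.\<close>
    define V where "V = U \<inter> ball \<zz> r"
    have V: "open V" "\<zz> \<in> V" using H gr(1) by (auto simp: V_def)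
    have hV: "H holomorphic_on V" "g holomorphic_on V"
      using H gr(2) by (auto simp: V_def elim: holomorphic_on_subset)
    have "residue (\<lambda>w. F w * H w) \<zz> = residue (\<lambda>w. (g w * H w) / (w - \<zz>) ^ Suc 1) \<zz>"
    proof (rule residue_cong)
      show "\<forall>\<^sub>F w in at \<zz>. F w * H w = (g w * H w) / (w - \<zz>) ^ Suc 1"
        using eventually_at_in_open[OF V]
        by eventually_elim (use gr(3) in \<open>auto simp: V_def numeral_2_eq_2\<close>)
    qed simp
    also have "\<dots> = (deriv ^^ 1) (\<lambda>w. g w * H w) \<zz> / fact 1"
      by (rule residue_holomorphic_over_power[OF V]) (intro holomorphic_intros hV)
    also have "\<dots> = deriv (\<lambda>w. g w * H w) \<zz>" by simp
    also have "\<dots> = g \<zz> * deriv H \<zz> + deriv g \<zz> * H \<zz>"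
      by (rule deriv_mult) (use hV V holomorphic_on_imp_differentiable_at in blast)+
    finally show "residue (\<lambda>w. F w * H w) \<zz> = g \<zz> * deriv H \<zz> + deriv g \<zz> * H \<zz>" .
  qed
qed

end

section \<open>Evaluation at the elliptic point\<close>

lemma has_field_derivative_seed:
  assumes u: "0 < Im u" "Im u < Im z"
  shows "(seed l z has_field_derivative
      (of_nat l * E2 u ^ (l - 1) * deriv E2 u * cauchy_kernel z u
        + E2 u ^ l * (- 2 * of_real pi * \<i> * (nome (z - u) / (1 - nome (z - u))\<^sup>2)))) (at u)"
proof -
  have n: "1 - nome (z - u) \<noteq> 0"
  proof
    assume "1 - nome (z - u) = 0"
    hence "z - u \<in> \<int>" using nome_eq_1_iff[of "z - u"] by simp
    thus False using u by (auto elim!: Ints_cases simp: complex_eq_iff)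
  qed
  have e: "(E2 has_field_derivative deriv E2 u) (at u)"
    by (rule holomorphic_derivI[OF E2_holomorphic open_halfspace_Im_gt]) (use u in auto)
  have k: "(cauchy_kernel z has_field_derivative
       (- 2 * of_real pi * \<i> * (nome (z - u) / (1 - nome (z - u))\<^sup>2))) (at u)"
    unfolding cauchy_kernel_def [abs_def] nome_def using n
    by (auto intro!: derivative_eq_intros simp: nome_def power2_eq_square)
  have "((\<lambda>u. E2 u ^ l) has_field_derivative of_nat l * (deriv E2 u * E2 u ^ (l - 1))) (at u)"
    using DERIV_power[OF e, of l] by (simp add: mult_ac)
  from DERIV_mult[OF this k] show ?thesis
    by (simp add: seed_def [abs_def] mult_ac add_ac)
qed

lemma has_field_derivative_poincare_term:
  assumes p: "p \<in> coprime_pairs" and w: "Im w > 0"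
      and \<phi>: "(\<phi> has_field_derivative \<phi>') (at (moebius_of p w))"
  shows "(poincare_term \<phi> m p has_field_derivative
      (\<phi>' / jfactor p w ^ (m + 2) - of_nat m * of_int (fst p) * \<phi> (moebius_of p w) / jfactor p w ^ (m + 1))) (at w)"
proof -
  define j where "j = jfactor p w"
  have j: "j \<noteq> 0" unfolding j_def by (rule jfactor_nonzero[OF p w])
  have 1: "((\<lambda>w. \<phi> (moebius_of p w)) has_field_derivative \<phi>' * (1 / j\<^sup>2)) (at w)"
    unfolding j_def by (rule DERIV_chain2[OF \<phi> has_field_derivative_moebius_of[OF p w]])
  have "(jfactor p has_field_derivative of_int (fst p)) (at w)"
    unfolding jfactor_def [abs_def] by (auto intro!: derivative_eq_intros)
  from DERIV_power[OF this, of m]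
  have 2: "((\<lambda>w. jfactor p w ^ m) has_field_derivative of_nat m * (of_int (fst p) * j ^ (m - 1))) (at w)"
    by (simp add: j_def mult_ac)
  have "((\<lambda>w. \<phi> (moebius_of p w) / jfactor p w ^ m) has_field_derivative
     (\<phi>' * (1 / j\<^sup>2) * j ^ m - \<phi> (moebius_of p w) * (of_nat m * (of_int (fst p) * j ^ (m - 1)))) / (j ^ m * j ^ m)) (at w)"
    using DERIV_divide[OF 1 2] j by (simp add: j_def)
  also have "(\<phi>' * (1 / j\<^sup>2) * j ^ m - \<phi> (moebius_of p w) * (of_nat m * (of_int (fst p) * j ^ (m - 1)))) / (j ^ m * j ^ m)
     = \<phi>' / j ^ (m + 2) - of_nat m * of_int (fst p) * \<phi> (moebius_of p w) / j ^ (m + 1)"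
    using j by (cases m) (auto simp: divide_simps power2_eq_square power_add, auto simp: algebra_simps)
  finally show ?thesis by (simp add: poincare_term_def [abs_def] j_def)
qed

context meromorphic_form begin

text \<open>Termwise differentiation of the whole Poincare series, including the two cuspidal terms.\<close>

lemma poincare_deriv:
  assumes z: "Im z \<ge> 6" and w: "1/4 < Im w" "Im w < 5"
  shows "((\<lambda>p. deriv (poincare_term (seed l z) m p) w) has_sum deriv (poincare (seed l z) m) w) coprime_pairs"
proof -
  have w0: "Im w > 0" using w by simp
  have U: "coprime_pairs = noncuspidal_pairs \<union> {(0, 1), (0, -1)}"
    by (auto simp: coprime_pairs_def noncuspidal_pairs_def)
  have n1: "seed l z (moebius_of (0, 1) v) = seed l z v" "seed l z (moebius_of (0, -1) v) = seed l z v" if "Im v > 0" for v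
    using moebius_of_eq[of 1 1 0 0 v] moebius_of_eq[of "-1" "-1" 0 0 v] that seed_periodic by force+
  have ev: "\<forall>\<^sub>F v in nhds w. v \<in> strip (1/4) 5"
    by (rule eventually_nhds_in_open[OF open_strip]) (use w in \<open>auto simp: strip_def\<close>)
  have d: "deriv (poincare_term (seed l z) m p) w = deriv (seed l z) w" if "p \<in> {(0, 1), (0, -1)}" for p
  proof (rule deriv_cong_ev)
    show "\<forall>\<^sub>F v in nhds w. poincare_term (seed l z) m p v = seed l z v"
      using ev by eventually_elim
        (use that even_m in \<open>auto simp: poincare_term_def jfactor_def n1 strip_def\<close>)
  qed simp
  have "deriv (poincare (seed l z) m) w = deriv (\<lambda>v. poincare_tail l m z v + 2 * seed l z v) w"
  proof (rule deriv_cong_ev)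
    show "\<forall>\<^sub>F v in nhds w. poincare (seed l z) m v = poincare_tail l m z v + 2 * seed l z v"
      using ev by eventually_elim (rule poincare_split(1)[OF m even_m], use z in \<open>auto simp: strip_def\<close>)
  qed simp
  also have "\<dots> = deriv (poincare_tail l m z) w + 2 * deriv (seed l z) w"
  proof (rule DERIV_imp_deriv, rule DERIV_add)
    show "(poincare_tail l m z has_field_derivative deriv (poincare_tail l m z) w) (at w)"
      by (rule holomorphic_derivI[OF poincare_tail_holomorphic[OF m] open_halfspace_Im_gt]) (use w z in auto)
    show "((\<lambda>v. 2 * seed l z v) has_field_derivative 2 * deriv (seed l z) w) (at w)"
      using DERIV_cmult[OF has_field_derivative_seed[of w z l], of 2] DERIV_imp_deriv[OF has_field_derivative_seed[of w z l]] w z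
      by simp
  qed
  finally have D: "deriv (poincare (seed l z) m) w = \<dots>" .
  show ?thesis unfolding U D
  proof (rule has_sum_Un_disjoint)
    show "((\<lambda>p. deriv (poincare_term (seed l z) m p) w) has_sum deriv (poincare_tail l m z) w) noncuspidal_pairs"
      by (rule poincare_tail_deriv[OF m]) (use w z in auto)
    show "((\<lambda>p. deriv (poincare_term (seed l z) m p) w) has_sum 2 * deriv (seed l z) w) {(0, 1), (0, -1)}"
      by (rule has_sum_finiteI) (use d in auto)
  qed (auto simp: noncuspidal_pairs_def)
qed

end

context elliptic_point begin

definition inv_diff :: complex where "inv_diff = 1 / (2 * \<i> * of_real (Im \<zz>))"

text \<open>The constant in the quasimodular transformation law of \<open>E2\<close>.\<close>

definition anomaly :: complex where "anomaly = 6 / (of_real pi * \<i>)"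

text \<open>The value \<open>3 / (pi * Im \<zz>)\<close> of \<open>E2\<close> at \<open>\<zz>\<close>.\<close>

definition E2_value :: complex where "E2_value = - anomaly * inv_diff"

lemma zz_diff: "\<zz> - cnj \<zz> = 2 * \<i> * of_real (Im \<zz>)"
  by (simp add: complex_eq_iff)

lemma inv_diff_mult: "inv_diff * (\<zz> - cnj \<zz>) = 1"
  unfolding zz_diff inv_diff_def using Im_zz_bounds(3) by simp

text \<open>The transformation law under the generator of the stabilizer is a linear equation for \<open>E2 \<zz>\<close>. The solution is the
  point where the nonholomorphic weight 2 completion of \<open>E2\<close> vanishes.\<close>

lemma E2_zz: "E2 \<zz> = E2_value"
proof -
  define s where "s = cnj \<zz>"
  have s: "of_int t - \<zz> = s" "\<zz> * s = 1" using cnj_zz zz_cnj by (auto simp: s_def)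
  have sn: "s \<noteq> 0" using s by auto
  have "E2 ((of_int 0 * \<zz> + of_int 1) / (of_int (-1) * \<zz> + of_int t)) =
           (of_int (-1) * \<zz> + of_int t)\<^sup>2 * E2 \<zz> + 6 / (of_real pi * \<i>) * of_int (-1) * (of_int (-1) * \<zz> + of_int t)"
    by (rule E2_quasimodular[OF _ Im_zz_bounds(3)]) simp
  also have "of_int (-1) * \<zz> + of_int t = s" using s by simp
  finally have "E2 ((of_int 0 * \<zz> + of_int 1) / s) = s\<^sup>2 * E2 \<zz> - anomaly * s" by (simp add: anomaly_def)
  moreover have "(of_int 0 * \<zz> + of_int 1) / s = \<zz>" using s(2) sn by (simp add: field_simps)
  ultimately have "E2 \<zz> = s\<^sup>2 * E2 \<zz> - anomaly * s" by simp
  hence "\<zz> * E2 \<zz> = \<zz> * (s\<^sup>2 * E2 \<zz> - anomaly * s)" by simp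
  also have "\<dots> = (\<zz> * s) * (s * E2 \<zz> - anomaly)" by (simp add: power2_eq_square algebra_simps)
  finally have "(\<zz> - s) * E2 \<zz> = - anomaly" unfolding s(2) by (simp add: algebra_simps)
  hence "(inv_diff * (\<zz> - s)) * E2 \<zz> = - anomaly * inv_diff" by (metis mult.assoc mult.commute)
  thus ?thesis unfolding s_def inv_diff_mult by (simp add: E2_value_def)
qed

definition jz :: "int \<times> int \<Rightarrow> complex" where "jz p = jfactor p \<zz>"

definition Nz :: "int \<times> int \<Rightarrow> complex" where "Nz p = jz p * cnj (jz p)"

lemma jz_nonzero: "p \<in> coprime_pairs \<Longrightarrow> jz p \<noteq> 0"
  unfolding jz_def by (rule jfactor_nonzero[OF _ Im_zz_bounds(3)])

text \<open>This expresses the entry \<open>c\<close>, the source of all nonmodular terms, through \<open>j\<close> and its conjugate.\<close>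

lemma fst_eq_jz: "of_int (fst p) = (jz p - cnj (jz p)) * inv_diff"
proof -
  have "jz p - cnj (jz p) = of_int (fst p) * (\<zz> - cnj \<zz>)"
    by (simp add: jz_def jfactor_def algebra_simps)
  thus ?thesis using inv_diff_mult by (simp add: mult.assoc mult.commute[of inv_diff])
qed

text \<open>The two quasimodular terms in \<open>j\<^sup>2\<close> cancel, and only the norm survives.\<close>

lemma E2_moebius_zz:
  assumes p: "p \<in> coprime_pairs"
  shows "E2 (moebius_of p \<zz>) = E2_value * Nz p"
proof -
  have "E2 (moebius_of p \<zz>) = (jz p)\<^sup>2 * E2_value + anomaly * ((jz p - cnj (jz p)) * inv_diff) * jz p"
    using E2_moebius_of[OF p Im_zz_bounds(3)] by (simp add: jz_def [symmetric] anomaly_def E2_zz fst_eq_jz)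
  also have "\<dots> = E2_value * Nz p" by (simp add: E2_value_def Nz_def power2_eq_square algebra_simps)
  finally show ?thesis .
qed

text \<open>The coefficient of \<open>j ^ 4\<close> in the transformation of \<open>E2'\<close>; up to a constant it is the weight 4 Eisenstein
  series at \<open>\<zz>\<close>.\<close>

definition E2_deriv_offset :: complex where "E2_deriv_offset = deriv E2 \<zz> - anomaly * inv_diff\<^sup>2"

text \<open>Differentiate the transformation law; the mixed terms \<open>j\<^sup>2 * N\<close> cancel.\<close>

lemma deriv_E2_moebius_zz:
  assumes p: "p \<in> coprime_pairs"
  shows "deriv E2 (moebius_of p \<zz>) = jz p ^ 4 * E2_deriv_offset + anomaly * inv_diff\<^sup>2 * (Nz p)\<^sup>2"
proof -
  have y: "Im \<zz> > 0" by (rule Im_zz_bounds(3))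
  have E: "(E2 has_field_derivative deriv E2 u) (at u)" if "Im u > 0" for u
    by (rule holomorphic_derivI[OF E2_holomorphic open_halfspace_Im_gt]) (use that in auto)
  have "((\<lambda>w. E2 (moebius_of p w)) has_field_derivative deriv E2 (moebius_of p \<zz>) * (1 / (jfactor p \<zz>)\<^sup>2)) (at \<zz>)"
    by (rule DERIV_chain2[OF E[OF Im_moebius_of_pos[OF p y]] has_field_derivative_moebius_of[OF p y]])
  hence 1: "((\<lambda>w. (jfactor p w)\<^sup>2 * E2 w + 6 / (of_real pi * \<i>) * of_int (fst p) * jfactor p w)
      has_field_derivative deriv E2 (moebius_of p \<zz>) * (1 / (jz p)\<^sup>2)) (at \<zz>)"
    unfolding jz_def
    by (rule has_field_derivative_transform_within_open[OF _ open_halfspace_Im_gt[of 0]])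
       (use y E2_moebius_of[OF p] in auto)
  have j: "(jfactor p has_field_derivative of_int (fst p)) (at \<zz>)"
    unfolding jfactor_def [abs_def] by (auto intro!: derivative_eq_intros)
  have 2: "((\<lambda>w. (jfactor p w)\<^sup>2 * E2 w + 6 / (of_real pi * \<i>) * of_int (fst p) * jfactor p w)
      has_field_derivative (2 * jz p * of_int (fst p) * E2 \<zz> + (jz p)\<^sup>2 * deriv E2 \<zz>
         + anomaly * of_int (fst p) * of_int (fst p))) (at \<zz>)"
    unfolding jz_def anomaly_def
    by (rule derivative_eq_intros j E[OF y] refl)+ (simp add: power2_eq_square algebra_simps)
  have "deriv E2 (moebius_of p \<zz>) * (1 / (jz p)\<^sup>2) =
     2 * jz p * of_int (fst p) * E2 \<zz> + (jz p)\<^sup>2 * deriv E2 \<zz> + anomaly * of_int (fst p) * of_int (fst p)"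
    by (rule DERIV_unique[OF 1 2])
  hence "deriv E2 (moebius_of p \<zz>) = (jz p)\<^sup>2 * (2 * jz p * of_int (fst p) * E2 \<zz> + (jz p)\<^sup>2 * deriv E2 \<zz> + anomaly * of_int (fst p) * of_int (fst p))"
    using jz_nonzero[OF p] by (simp add: field_simps)
  also have "\<dots> = jz p ^ 4 * E2_deriv_offset + anomaly * inv_diff\<^sup>2 * (Nz p)\<^sup>2"
    unfolding fst_eq_jz E2_zz E2_value_def E2_deriv_offset_def Nz_def
    by (simp add: power2_eq_square power4_eq_xxxx algebra_simps)
  finally show ?thesis .
qed

text \<open>The sum of \<open>n ^ r * e(n * (z - u))\<close> over \<open>n\<close>, for \<open>r = 0\<close> and \<open>r = 1\<close>. The case \<open>r = 1\<close>
  is the derivative of the kernel up to a constant and arises from poles of order 2.\<close>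

definition kern :: "nat \<Rightarrow> complex \<Rightarrow> complex \<Rightarrow> complex" where
  "kern r z u = (if r = 0 then cauchy_kernel z u else nome (z - u) / (1 - nome (z - u))\<^sup>2)"

text \<open>The four shapes of summands at \<open>\<zz>\<close> are instances of this one.\<close>

definition kterm :: "nat \<Rightarrow> nat \<Rightarrow> nat \<Rightarrow> complex \<Rightarrow> int \<times> int \<Rightarrow> complex" where
  "kterm r J K z p = Nz p ^ J / jz p ^ K * kern r z (moebius_of p \<zz>)"

lemma Im_moebius_zz:
  assumes p: "p \<in> coprime_pairs"
  shows "0 < Im (moebius_of p \<zz>)" "Im (moebius_of p \<zz>) \<le> Im \<zz>" "norm (jz p) \<ge> 1"
proof -
  have "1 \<le> real_of_int (znorm (fst p) (snd p))" using znorm_pos[of "fst p" "snd p"] p by simp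
  hence n: "1 \<le> (cmod (jz p))\<^sup>2" unfolding znorm_cmod by (simp add: jz_def jfactor_def)
  thus "norm (jz p) \<ge> 1" by (metis norm_ge_zero one_power2 power2_le_imp_le)
  show "0 < Im (moebius_of p \<zz>)" by (rule Im_moebius_of_pos[OF p Im_zz_bounds(3)])
  have "Im \<zz> * 1 \<le> Im \<zz> * (cmod (jz p))\<^sup>2" using n Im_zz_bounds(3) by (intro mult_left_mono) auto
  thus "Im (moebius_of p \<zz>) \<le> Im \<zz>" unfolding Im_moebius_of[OF p Im_zz_bounds(3)] jz_def [symmetric]
    using n Im_zz_bounds(3) by (simp add: divide_le_eq)
qed

text \<open>The derivative falls on \<open>E2 ^ l\<close>, on the kernel, or on the automorphy factor. In the last case \<open>c\<close> is
  replaced by the difference of \<open>j\<close> and its conjugate, so that all powers of \<open>j\<close> can be collected.\<close>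

lemma seed_terms_at_zz:
  assumes p: "p \<in> coprime_pairs" and z: "Im z > 1" and l: "l = Suc l'" and m: "m \<ge> 2"
  shows "poincare_term (seed l z) m p \<zz> = E2_value ^ l * kterm 0 l m z p"
    and "deriv (poincare_term (seed l z) m p) \<zz> =
       - of_nat m * inv_diff * E2_value ^ l * kterm 0 l m z p
       + (of_nat l * E2_value ^ l' * (anomaly * inv_diff\<^sup>2) + of_nat m * inv_diff * E2_value ^ l) * kterm 0 (l + 1) (m + 2) z p
       + (- 2 * of_real pi * \<i> * E2_value ^ l) * kterm 1 l (m + 2) z p
       + of_nat l * E2_value ^ l' * E2_deriv_offset * kterm 0 (l - 1) (m - 2) z p"
proof -
  define u where "u = moebius_of p \<zz>"
  define j where "j = jz p"
  define N where "N = Nz p"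
  define jb where "jb = cnj j"
  define k where "k = cauchy_kernel z u"
  define X where "X = nome (z - u) / (1 - nome (z - u))\<^sup>2"
  have j: "j \<noteq> 0" unfolding j_def by (rule jz_nonzero[OF p])
  have N: "N = j * jb" by (simp add: N_def Nz_def j_def jb_def)
  show "poincare_term (seed l z) m p \<zz> = E2_value ^ l * kterm 0 l m z p"
    by (simp add: poincare_term_def seed_def E2_moebius_zz[OF p] kterm_def kern_def jz_def power_mult_distrib)
  have u: "0 < Im u" "Im u < Im z" using Im_moebius_zz[OF p] Im_zz_bounds z by (auto simp: u_def)
  have "deriv (poincare_term (seed l z) m p) \<zz> =
     (of_nat l * E2 u ^ (l - 1) * deriv E2 u * k + E2 u ^ l * (- 2 * of_real pi * \<i> * X)) / jfactor p \<zz> ^ (m + 2)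
       - of_nat m * of_int (fst p) * seed l z u / jfactor p \<zz> ^ (m + 1)"
    unfolding u_def k_def X_def
    by (rule DERIV_imp_deriv[OF has_field_derivative_poincare_term[OF p Im_zz_bounds(3) has_field_derivative_seed]])
       (use u in \<open>auto simp: u_def\<close>)
  also have "seed l z u = E2 u ^ l * k" by (simp add: seed_def k_def)
  also have "E2 u = E2_value * N" unfolding u_def N_def by (rule E2_moebius_zz[OF p])
  also have "deriv E2 u = j ^ 4 * E2_deriv_offset + anomaly * inv_diff\<^sup>2 * N\<^sup>2" unfolding u_def N_def j_def by (rule deriv_E2_moebius_zz[OF p])
  also have "of_int (fst p) = (j - jb) * inv_diff" unfolding j_def jb_def by (rule fst_eq_jz)
  also have "jfactor p \<zz> = j" by (simp add: j_def jz_def)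
  finally have D: "deriv (poincare_term (seed l z) m p) \<zz> =
     (of_nat l * (E2_value * N) ^ (l - 1) * (j ^ 4 * E2_deriv_offset + anomaly * inv_diff\<^sup>2 * N\<^sup>2) * k + (E2_value * N) ^ l * (- 2 * of_real pi * \<i> * X)) / j ^ (m + 2)
       - of_nat m * ((j - jb) * inv_diff) * ((E2_value * N) ^ l * k) / j ^ (m + 1)" .
  \<comment> \<open>All powers of \<open>j\<close> are written as multiples of the lowest one, which turns the claim into a polynomial identity.\<close>
  define Q where "Q = 1 / j ^ (m + 2)"
  have m2: "1 / j ^ (m - 2) = j ^ 4 * Q"
  proof -
    have "j ^ (m + 2) = j ^ (m - 2) * j ^ 4" using m by (simp flip: power_add)
    thus ?thesis using j by (simp add: Q_def)
  qed
  have j1: "1 / j ^ m = j\<^sup>2 * Q" "1 / j ^ (m + 1) = j * Q"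
    using j by (simp_all add: power2_eq_square Q_def)
  have "kterm 0 J K z p = N ^ J * k * (1 / j ^ K)" "kterm 1 J K z p = N ^ J * X * (1 / j ^ K)" for J K
    by (simp_all add: kterm_def kern_def N_def k_def X_def u_def j_def)
  hence t0: "kterm 0 l m z p = N ^ l * k * (j\<^sup>2 * Q)" "kterm 0 (l + 1) (m + 2) z p = N ^ (l + 1) * k * Q"
      "kterm 1 l (m + 2) z p = N ^ l * X * Q" "kterm 0 (l - 1) (m - 2) z p = N ^ (l - 1) * k * (j ^ 4 * Q)"
    unfolding j1 [symmetric] m2 [symmetric] unfolding Q_def by blast+
  have jN: "(j - jb) * j = j\<^sup>2 - N" by (simp add: N power2_eq_square algebra_simps)
  have D': "deriv (poincare_term (seed l z) m p) \<zz> =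
     (of_nat l * (E2_value * N) ^ l' * (j ^ 4 * E2_deriv_offset + anomaly * inv_diff\<^sup>2 * N\<^sup>2) * k + (E2_value * N) ^ l * (- 2 * of_real pi * \<i> * X)) * Q
       - of_nat m * inv_diff * ((E2_value * N) ^ l * k) * ((j\<^sup>2 - N) * Q)"
  proof -
    have "of_nat m * ((j - jb) * inv_diff) * ((E2_value * N) ^ l * k) / j ^ (m + 1) =
          of_nat m * inv_diff * ((E2_value * N) ^ l * k) * ((j - jb) * (1 / j ^ (m + 1)))" by simp
    also have "(j - jb) * (1 / j ^ (m + 1)) = (j\<^sup>2 - N) * Q" unfolding j1(2) jN [symmetric] by simp
    finally show ?thesis unfolding D by (simp add: l Q_def)
  qed
  show "deriv (poincare_term (seed l z) m p) \<zz> =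
       - of_nat m * inv_diff * E2_value ^ l * kterm 0 l m z p
       + (of_nat l * E2_value ^ l' * (anomaly * inv_diff\<^sup>2) + of_nat m * inv_diff * E2_value ^ l) * kterm 0 (l + 1) (m + 2) z p
       + (- 2 * of_real pi * \<i> * E2_value ^ l) * kterm 1 l (m + 2) z p
       + of_nat l * E2_value ^ l' * E2_deriv_offset * kterm 0 (l - 1) (m - 2) z p"
    unfolding D' t0
    by (simp add: l power_mult_distrib power2_eq_square algebra_simps)
qed

text \<open>The coefficient of \<open>n ^ r * q ^ n\<close> in \<open>kterm\<close>.\<close>

definition pcoef :: "nat \<Rightarrow> nat \<Rightarrow> nat \<Rightarrow> int \<times> int \<Rightarrow> complex" where
  "pcoef J K n p = Nz p ^ J / jz p ^ K * nome (- of_nat n * moebius_of p \<zz>)"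

definition majorant :: "int \<times> int \<Rightarrow> real" where
  "majorant = (\<lambda>(c, d). lattice_const \<zz> ^ 3 * (1 / (\<bar>real_of_int c\<bar> + \<bar>real_of_int d\<bar>) ^ 3))"

lemma majorant_summable: "majorant summable_on coprime_pairs"
proof -
  have "(\<lambda>p. lattice_const \<zz> ^ 3 * (case p of (c::int, d::int) \<Rightarrow> 1 / (\<bar>real_of_int c\<bar> + \<bar>real_of_int d\<bar>) ^ 3)) summable_on coprime_pairs"
    by (intro summable_on_cmult_right summable_on_subset_banach[OF summable_on_lattice])
       (auto simp: coprime_pairs_def)
  thus ?thesis by (simp add: majorant_def case_prod_unfold)
qed

lemma majorant_nonneg: "majorant p \<ge> 0"
  using lattice_const_ge_1[OF Im_zz_bounds(3)] by (auto simp: majorant_def case_prod_unfold)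

text \<open>Points of the orbit lie no higher than \<open>\<zz>\<close>, so the exponential factor is largest at \<open>\<zz>\<close>; the remaining
  factor has order at most \<open>-3\<close> because \<open>\<bar>jz p\<bar> \<ge> 1\<close>.\<close>

lemma norm_pcoef_le:
  assumes p: "p \<in> coprime_pairs" and K: "K \<ge> 2 * J + 4"
  shows "norm (pcoef J K n p) \<le> exp (2 * pi * Im \<zz>) ^ n * majorant p"
proof -
  define a where "a = norm (jz p)"
  have a: "a \<ge> 1" unfolding a_def by (rule Im_moebius_zz(3)[OF p])
  define e where "e = K - (2 * J + 3)"
  have Ke: "K = 2 * J + (3 + e)" using K by (simp add: e_def)
  have c0: "\<bar>real_of_int (fst p)\<bar> + \<bar>real_of_int (snd p)\<bar> > 0"
  proof -
    have "fst p \<noteq> 0 \<or> snd p \<noteq> 0" using p by (auto simp: coprime_pairs_def)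
    thus ?thesis by (auto simp: add_nonneg_pos add_pos_nonneg)
  qed
  have "\<bar>real_of_int (fst p)\<bar> + \<bar>real_of_int (snd p)\<bar> \<le> lattice_const \<zz> * a"
    using lattice_lower_bound[OF Im_zz_bounds(3), of "of_int (fst p)" "of_int (snd p)"] by (simp add: a_def jz_def jfactor_def)
  hence "1 / a \<le> lattice_const \<zz> / (\<bar>real_of_int (fst p)\<bar> + \<bar>real_of_int (snd p)\<bar>)"
    using a c0 by (simp add: field_simps)
  hence "(1 / a) ^ 3 \<le> majorant p"
    using power_mono[of "1 / a" "lattice_const \<zz> / (\<bar>real_of_int (fst p)\<bar> + \<bar>real_of_int (snd p)\<bar>)" 3] a
    by (simp add: majorant_def case_prod_unfold power_divide)
  moreover have "norm (Nz p ^ J / jz p ^ K) \<le> (1 / a) ^ 3"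
  proof -
    have "norm (Nz p ^ J / jz p ^ K) = a ^ (2 * J) / a ^ K"
      by (simp add: Nz_def norm_divide norm_power norm_mult a_def power_mult power2_eq_square)
    also have "\<dots> = (1 / a) ^ 3 * (1 / a) ^ e"
      using a unfolding Ke power_add power_divide by simp
    also have "\<dots> \<le> (1 / a) ^ 3 * 1" by (intro mult_left_mono power_le_one) (use a in auto)
    finally show ?thesis by simp
  qed
  ultimately have 1: "norm (Nz p ^ J / jz p ^ K) \<le> majorant p" by simp
  have "norm (nome (- of_nat n * moebius_of p \<zz>)) = exp (2 * pi * (real n * Im (moebius_of p \<zz>)))"
    by (simp add: norm_nome)
  also have "\<dots> \<le> exp (2 * pi * (real n * Im \<zz>))"
    using Im_moebius_zz(2)[OF p] by (simp add: mult_left_mono)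
  also have "\<dots> = exp (2 * pi * Im \<zz>) ^ n" by (simp add: exp_of_nat_mult [symmetric] mult_ac)
  finally have 2: "norm (nome (- of_nat n * moebius_of p \<zz>)) \<le> exp (2 * pi * Im \<zz>) ^ n" .
  have "norm (pcoef J K n p) = norm (nome (- of_nat n * moebius_of p \<zz>)) * norm (Nz p ^ J / jz p ^ K)"
    unfolding pcoef_def norm_mult by (rule mult.commute)
  also have "\<dots> \<le> exp (2 * pi * Im \<zz>) ^ n * majorant p"
    by (rule mult_mono[OF 2 1]) auto
  finally show ?thesis .
qed

lemma pcoef_summable: "K \<ge> 2 * J + 4 \<Longrightarrow> pcoef J K n abs_summable_on coprime_pairs"
  by (rule summable_on_comparison_test[OF summable_on_cmult_right[OF majorant_summable]]) (auto intro: norm_pcoef_le)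

definition fcoef :: "nat \<Rightarrow> nat \<Rightarrow> nat \<Rightarrow> complex" where
  "fcoef J K n = (\<Sum>\<^sub>\<infinity>p\<in>coprime_pairs. pcoef J K n p)"

lemma fcoef_le:
  assumes K: "K \<ge> 2 * J + 4"
  shows "norm (fcoef J K n) \<le> exp (2 * pi * Im \<zz>) ^ n * infsum majorant coprime_pairs"
proof -
  have "norm (fcoef J K n) \<le> (\<Sum>\<^sub>\<infinity>p\<in>coprime_pairs. exp (2 * pi * Im \<zz>) ^ n * majorant p)"
    unfolding fcoef_def
    by (rule norm_infsum_le[OF has_sum_infsum[OF abs_summable_summable[OF pcoef_summable[OF K]]] has_sum_infsum norm_pcoef_le[OF _ K]])
       (intro summable_on_cmult_right majorant_summable)
  thus ?thesis unfolding infsum_cmult_right' .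
qed

lemma summable_Suc_mult_power: "0 \<le> R \<Longrightarrow> R < 1 \<Longrightarrow> summable (\<lambda>n. real (Suc n) * R ^ n)"
  using geometric_deriv_sums[of R] by (simp add: sums_iff)

lemma power_le_Suc: "r \<le> 1 \<Longrightarrow> real n ^ r \<le> real (Suc n)"
  by (cases r) auto

lemma fseries_summable:
  assumes K: "K \<ge> 2 * J + 4" and r: "r \<le> 1" and q: "norm q < exp (- 2 * pi * Im \<zz>)"
  shows "summable (\<lambda>n. norm (of_nat n ^ r * fcoef J K n * q ^ n))"
proof (rule summable_comparison_test')
  define R where "R = exp (2 * pi * Im \<zz>) * norm q"
  have "R < exp (2 * pi * Im \<zz>) * exp (- 2 * pi * Im \<zz>)" unfolding R_def using q by simp
  hence R: "0 \<le> R" "R < 1" by (auto simp: R_def simp flip: exp_add)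
  show "summable (\<lambda>n. infsum majorant coprime_pairs * (real (Suc n) * R ^ n))"
    by (intro summable_mult summable_Suc_mult_power R)
  fix n :: nat
  have "norm (of_nat n ^ r * fcoef J K n * q ^ n) \<le> real (Suc n) * (exp (2 * pi * Im \<zz>) ^ n * infsum majorant coprime_pairs) * norm q ^ n"
    unfolding norm_mult norm_power norm_of_nat
    by (intro mult_mono fcoef_le K power_le_Suc r)
       (auto intro!: mult_nonneg_nonneg infsum_nonneg majorant_nonneg)
  thus "norm (norm (of_nat n ^ r * fcoef J K n * q ^ n)) \<le> infsum majorant coprime_pairs * (real (Suc n) * R ^ n)"
    by (simp add: R_def power_mult_distrib mult_ac)
qed

text \<open>Up to the number of units this is \<open>F_series\<close> when \<open>2 * \<omega>\<close> divides \<open>K\<close>, and 0 otherwise.\<close>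

definition fseries :: "nat \<Rightarrow> nat \<Rightarrow> nat \<Rightarrow> complex \<Rightarrow> complex" where
  "fseries r J K q = (\<Sum>n. of_nat n ^ r * fcoef J K n * q ^ n)"

lemma fseries_holomorphic:
  assumes K: "K \<ge> 2 * J + 4" and r: "r \<le> 1"
  shows "(\<lambda>z. fseries r J K (nome z)) holomorphic_on {z. Im z > Im \<zz>}"
proof -
  have "fseries r J K holomorphic_on ball 0 (exp (- 2 * pi * Im \<zz>))"
  proof (rule power_series_holomorphic)
    fix w :: complex assume "w \<in> ball 0 (exp (- 2 * pi * Im \<zz>))"
    hence "norm w < exp (- 2 * pi * Im \<zz>)" by simp
    from summable_norm_cancel[OF fseries_summable[OF K r this]]
    show "(\<lambda>n. of_nat n ^ r * fcoef J K n * (w - 0) ^ n) sums fseries r J K w"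
      unfolding fseries_def by (simp add: summable_sums)
  qed
  hence "(fseries r J K \<circ> nome) holomorphic_on {z. Im z > Im \<zz>}"
    by (rule holomorphic_on_compose_gen[rotated])
       (auto intro!: holomorphic_intros simp: norm_nome)
  thus ?thesis by (simp add: o_def)
qed

lemma kern_has_sum:
  assumes r: "r \<le> 1" and u: "Im u < Im z"
  shows "((\<lambda>n. of_nat n ^ r * nome (z - u) ^ n) has_sum kern r z u) UNIV"
proof -
  define x where "x = nome (z - u)"
  have x: "norm x < 1" unfolding x_def by (rule norm_nome_less_1) (use u in simp)
  consider "r = 0" | "r = 1" using r by linarith
  thus ?thesis
  proof cases
    case 1
    have "((\<lambda>n. x ^ n) has_sum (1 / (1 - x))) UNIV"
      by (rule norm_summable_imp_has_sum) (use x in \<open>auto simp: norm_power intro!: summable_geometric geometric_sums\<close>)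
    thus ?thesis using 1 by (simp add: kern_def cauchy_kernel_def x_def)
  next
    case 2
    have l: "((\<lambda>n. of_nat (Suc n) * x ^ Suc n) has_sum (x / (1 - x)\<^sup>2)) UNIV" by (rule lambert_has_sum[OF x])
    hence "((\<lambda>n. of_nat n * x ^ n) has_sum (x / (1 - x)\<^sup>2)) (range Suc)"
      by (subst has_sum_reindex) (auto simp: o_def)
    also have "?this \<longleftrightarrow> ((\<lambda>n. of_nat n * x ^ n) has_sum (x / (1 - x)\<^sup>2)) UNIV"
    proof (rule has_sum_cong_neutral)
      fix n :: nat assume "n \<in> UNIV - range Suc"
      hence "n = 0" by (cases n) auto
      thus "of_nat n * x ^ n = 0" by simp
    qed auto
    finally have "((\<lambda>n. of_nat n * x ^ n) has_sum (x / (1 - x)\<^sup>2)) UNIV" .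
    thus ?thesis using 2 by (simp add: kern_def x_def)
  qed
qed

text \<open>The double series over pairs and exponents converges absolutely, which allows the order of summation to be exchanged.\<close>

lemma kterm_sum:
  assumes K: "K \<ge> 2 * J + 4" and r: "r \<le> 1" and z: "Im z > Im \<zz>"
  shows "(kterm r J K z has_sum fseries r J K (nome z)) coprime_pairs"
proof -
  define f where "f = (\<lambda>(n::nat, p). of_nat n ^ r * nome z ^ n * pcoef J K n p)"
  define R where "R = exp (2 * pi * Im \<zz>) * norm (nome z)"
  have R: "0 \<le> R" "R < 1" using z by (auto simp: R_def norm_nome simp flip: exp_add)
  have "(\<lambda>(n, p). real (Suc n) * R ^ n * majorant p) summable_on UNIV \<times> coprime_pairs"
  proof (rule summable_on_SigmaI)
    show "((\<lambda>p. case (n, p) of (n, p) \<Rightarrow> real (Suc n) * R ^ n * majorant p) has_sum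
        real (Suc n) * R ^ n * infsum majorant coprime_pairs) coprime_pairs" for n
      unfolding prod.case by (intro has_sum_cmult_right has_sum_infsum majorant_summable)
    show "(\<lambda>n. real (Suc n) * R ^ n * infsum majorant coprime_pairs) summable_on UNIV"
      by (intro summable_on_cmult_left summable_nonneg_imp_summable_on summable_Suc_mult_power R) (use R in auto)
  qed (use R majorant_nonneg in auto)
  hence "(\<lambda>x. norm (f x)) summable_on UNIV \<times> coprime_pairs"
  proof (rule summable_on_comparison_test)
    fix x :: "nat \<times> int \<times> int" assume x: "x \<in> UNIV \<times> coprime_pairs"
    obtain n p where np: "x = (n, p)" "p \<in> coprime_pairs" using x by auto
    have "norm (f x) \<le> real (Suc n) * norm (nome z) ^ n * (exp (2 * pi * Im \<zz>) ^ n * majorant p)"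
      unfolding np f_def prod.case norm_mult norm_power norm_of_nat
      by (intro mult_mono norm_pcoef_le np K power_le_Suc r) (auto intro!: majorant_nonneg)
    thus "norm (f x) \<le> (case x of (n, p) \<Rightarrow> real (Suc n) * R ^ n * majorant p)"
      unfolding np prod.case by (simp add: R_def power_mult_distrib mult_ac)
  qed simp
  hence sf: "f summable_on UNIV \<times> coprime_pairs" by (rule abs_summable_summable)
  define T where "T = infsum f (UNIV \<times> coprime_pairs)"
  have T: "(f has_sum T) (UNIV \<times> coprime_pairs)" unfolding T_def by (rule has_sum_infsum[OF sf])
  have "((\<lambda>n. of_nat n ^ r * nome z ^ n * fcoef J K n) has_sum T) UNIV"
  proof (rule has_sum_SigmaD[OF T])
    show "((\<lambda>p. f (n, p)) has_sum of_nat n ^ r * nome z ^ n * fcoef J K n) coprime_pairs" for n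
      unfolding f_def prod.case fcoef_def
      by (intro has_sum_cmult_right has_sum_infsum abs_summable_summable[OF pcoef_summable[OF K]])
  qed
  hence "(\<lambda>n. of_nat n ^ r * nome z ^ n * fcoef J K n) sums T" by (rule has_sum_imp_sums)
  hence TF: "fseries r J K (nome z) = T" unfolding fseries_def by (simp add: sums_iff mult_ac)
  have "((\<lambda>(p, n). f (n, p)) has_sum T) (coprime_pairs \<times> UNIV)" using T by (subst (asm) has_sum_swap)
  thus ?thesis unfolding TF
  proof (rule has_sum_SigmaD)
    fix p assume p: "p \<in> coprime_pairs"
    define u where "u = moebius_of p \<zz>"
    have u: "Im u < Im z" using Im_moebius_zz(2)[OF p] z by (simp add: u_def)
    have "((\<lambda>n. Nz p ^ J / jz p ^ K * (of_nat n ^ r * nome (z - u) ^ n)) has_sum kterm r J K z p) UNIV"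
      unfolding kterm_def u_def [symmetric] by (intro has_sum_cmult_right kern_has_sum r u)
    moreover have "Nz p ^ J / jz p ^ K * (of_nat n ^ r * nome (z - u) ^ n) = f (n, p)" for n
    proof -
      have "nome (z - u) ^ n = nome z ^ n * nome (- of_nat n * u)"
        by (simp add: nome_def exp_of_nat_mult [symmetric] exp_add [symmetric] algebra_simps)
      thus ?thesis by (simp add: f_def pcoef_def u_def)
    qed
    ultimately show "((\<lambda>n. case (p, n) of (p, n) \<Rightarrow> f (n, p)) has_sum kterm r J K z p) UNIV" by simp
  qed
qed

end

section \<open>The expansion and its symmetries\<close>

context meromorphic_form begin

text \<open>Compare the two evaluations of the residue at \<open>\<zz>\<close>. The constants depend on \<open>F\<close> only through its principal
  part there.\<close>

lemma quasimodular_expansion_high: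
  assumes l: "l \<ge> 1"
  shows "\<exists>B1 B2 B3 B4. \<forall>z. Im z \<ge> 6 \<longrightarrow> E2 z ^ l * F z =
      B1 * fseries 0 l m (nome z) + B2 * fseries 0 (l + 1) (m + 2) (nome z)
      + B3 * fseries 1 l (m + 2) (nome z) + B4 * fseries 0 (l - 1) (m - 2) (nome z)"
proof -
  obtain l' where l': "l = Suc l'" using l by (cases l) auto
  obtain a0 b0 where ab: "\<And>H U. open U \<Longrightarrow> \<zz> \<in> U \<Longrightarrow> H holomorphic_on U \<Longrightarrow>
     residue (\<lambda>w. F w * H w) \<zz> = a0 * deriv H \<zz> + b0 * H \<zz>"
    using residue_F_times by blast
  define X where "X = - (of_real pi * \<i> / of_int (2 + t))"
  define c1 where "c1 = - of_nat m * inv_diff * E2_value ^ l"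
  define c2 where "c2 = of_nat l * E2_value ^ l' * (anomaly * inv_diff\<^sup>2) + of_nat m * inv_diff * E2_value ^ l"
  define c3 where "c3 = - 2 * of_real pi * \<i> * E2_value ^ l"
  define c4 where "c4 = of_nat l * E2_value ^ l' * E2_deriv_offset"
  show ?thesis
  proof (intro exI allI impI)
    fix z :: complex assume z: "Im z \<ge> 6"
    have zz1: "Im z > Im \<zz>" "Im z > 1" using z Im_zz_bounds by auto
    have s1: "(kterm 0 l m z has_sum fseries 0 l m (nome z)) coprime_pairs"
      by (rule kterm_sum) (use m zz1 in auto)
    have s2: "(kterm 0 (l + 1) (m + 2) z has_sum fseries 0 (l + 1) (m + 2) (nome z)) coprime_pairs"
      by (rule kterm_sum) (use m zz1 in auto)
    have s3: "(kterm 1 l (m + 2) z has_sum fseries 1 l (m + 2) (nome z)) coprime_pairs"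
      by (rule kterm_sum) (use m zz1 in auto)
    have s4: "(kterm 0 (l - 1) (m - 2) z has_sum fseries 0 (l - 1) (m - 2) (nome z)) coprime_pairs"
      by (rule kterm_sum) (use m l zz1 in auto)
    define H where "H = poincare (seed l z) m"
    have m2: "m \<ge> 2" using m by simp
    have "((\<lambda>p. poincare_term (seed l z) m p \<zz>) has_sum H \<zz>) coprime_pairs"
      unfolding H_def poincare_def
      by (rule has_sum_infsum[OF poincare_split(2)[OF m even_m]]) (use z Im_zz_bounds in auto)
    moreover have "((\<lambda>p. poincare_term (seed l z) m p \<zz>) has_sum E2_value ^ l * fseries 0 l m (nome z)) coprime_pairs"
      using has_sum_cmult_right[OF s1, of "E2_value ^ l"]
      by (rule has_sum_cong[THEN iffD2, rotated]) (rule seed_terms_at_zz(1)[OF _ zz1(2) l' m2])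
    ultimately have H: "H \<zz> = E2_value ^ l * fseries 0 l m (nome z)" by (rule has_sum_unique)
    have "((\<lambda>p. deriv (poincare_term (seed l z) m p) \<zz>) has_sum deriv H \<zz>) coprime_pairs"
      unfolding H_def by (rule poincare_deriv[OF z]) (use Im_zz_bounds in auto)
    moreover have "((\<lambda>p. deriv (poincare_term (seed l z) m p) \<zz>) has_sum
        (c1 * fseries 0 l m (nome z) + c2 * fseries 0 (l + 1) (m + 2) (nome z)
         + c3 * fseries 1 l (m + 2) (nome z) + c4 * fseries 0 (l - 1) (m - 2) (nome z))) coprime_pairs"
      using has_sum_add[OF has_sum_add[OF has_sum_add[OF has_sum_cmult_right[OF s1, of c1]
          has_sum_cmult_right[OF s2, of c2]] has_sum_cmult_right[OF s3, of c3]] has_sum_cmult_right[OF s4, of c4]]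
      by (rule has_sum_cong[THEN iffD2, rotated])
         (unfold c1_def c2_def c3_def c4_def, rule seed_terms_at_zz(2)[OF _ zz1(2) l' m2])
    ultimately have H': "deriv H \<zz> = c1 * fseries 0 l m (nome z) + c2 * fseries 0 (l + 1) (m + 2) (nome z)
         + c3 * fseries 1 l (m + 2) (nome z) + c4 * fseries 0 (l - 1) (m - 2) (nome z)"
      by (rule has_sum_unique)
    have "residue (Phi z) \<zz> = a0 * deriv H \<zz> + b0 * H \<zz>"
      unfolding Phi_def [abs_def] H_def
    proof (rule ab[OF open_strip[of "1/4" 5]])
      show "poincare (seed l z) m holomorphic_on strip (1/4) 5"
        by (rule poincare_holomorphic[OF z]) (use z in \<open>auto simp: strip_def\<close>)
    qed (use Im_zz_bounds in \<open>auto simp: strip_def\<close>)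
    hence "E2 z ^ l * F z = X * (a0 * deriv H \<zz> + b0 * H \<zz>)"
      using residue_formula[OF z] by (simp add: X_def)
    thus "E2 z ^ l * F z =
      (X * (a0 * c1 + b0 * E2_value ^ l)) * fseries 0 l m (nome z) + (X * a0 * c2) * fseries 0 (l + 1) (m + 2) (nome z)
      + (X * a0 * c3) * fseries 1 l (m + 2) (nome z) + (X * a0 * c4) * fseries 0 (l - 1) (m - 2) (nome z)"
      unfolding H H' by (simp only: ring_distribs mult_ac add_ac)
  qed
qed

text \<open>Both sides are holomorphic above \<open>\<zz>\<close>, so the identity extends from \<open>Im z \<ge> 6\<close>.\<close>

theorem quasimodular_expansion:
  assumes l: "l \<ge> 1"
  shows "\<exists>B1 B2 B3 B4. \<forall>z. Im z > Im \<zz> \<longrightarrow> E2 z ^ l * F z =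
      B1 * fseries 0 l m (nome z) + B2 * fseries 0 (l + 1) (m + 2) (nome z)
      + B3 * fseries 1 l (m + 2) (nome z) + B4 * fseries 0 (l - 1) (m - 2) (nome z)"
proof -
  obtain B1 B2 B3 B4 where B: "\<And>z. Im z \<ge> 6 \<Longrightarrow> E2 z ^ l * F z =
      B1 * fseries 0 l m (nome z) + B2 * fseries 0 (l + 1) (m + 2) (nome z)
      + B3 * fseries 1 l (m + 2) (nome z) + B4 * fseries 0 (l - 1) (m - 2) (nome z)"
    using quasimodular_expansion_high[OF l] by blast
  have y: "Im \<zz> > 0" "Im \<zz> < 6" using Im_zz_bounds by auto
  show ?thesis
  proof (intro exI allI impI)
    fix z :: complex assume z: "Im z > Im \<zz>"
    show "E2 z ^ l * F z = B1 * fseries 0 l m (nome z) + B2 * fseries 0 (l + 1) (m + 2) (nome z)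
      + B3 * fseries 1 l (m + 2) (nome z) + B4 * fseries 0 (l - 1) (m - 2) (nome z)"
    proof (rule analytic_continuation_open[where s = "{z. Im z > 6}" and s' = "{z. Im z > Im \<zz>}"
          and f = "\<lambda>z. E2 z ^ l * F z" and z = z])
      have "7 * \<i> \<in> {z. Im z > 6}" by simp
      thus "{z. Im z > 6} \<noteq> {}" by blast
      show "connected {z. Im z > Im \<zz>}" by (rule convex_connected[OF convex_halfspace_Im_gt])
      show "(\<lambda>z. E2 z ^ l * F z) holomorphic_on {z. Im z > Im \<zz>}"
        by (intro holomorphic_intros F_holomorphic_high holomorphic_on_subset[OF E2_holomorphic]) (use y in auto)
      show "(\<lambda>z. B1 * fseries 0 l m (nome z) + B2 * fseries 0 (l + 1) (m + 2) (nome z)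
          + B3 * fseries 1 l (m + 2) (nome z) + B4 * fseries 0 (l - 1) (m - 2) (nome z)) holomorphic_on {z. Im z > Im \<zz>}"
        by (intro holomorphic_on_add holomorphic_on_mult holomorphic_on_const fseries_holomorphic) (use m l in auto)
    qed (use y z B in \<open>auto simp: open_halfspace_Im_gt\<close>)
  qed
qed

end

context elliptic_point begin

text \<open>The generator of the stabilizer acting on bottom rows, which multiplies \<open>c * \<zz> + d\<close> by the unit \<open>cnj \<zz>\<close>.\<close>

definition rot :: "int \<times> int \<Rightarrow> int \<times> int" where
  "rot = act_right 0 1 (-1) t"

lemma rot_coprime: "p \<in> coprime_pairs \<Longrightarrow> rot p \<in> coprime_pairs"
  unfolding rot_def by (rule act_right_coprime) auto

lemma rot_fix: "(of_int 0 * \<zz> + of_int 1) / (of_int (-1) * \<zz> + of_int t) = \<zz>"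
proof -
  have "of_int (-1) * \<zz> + of_int t = cnj \<zz>" using cnj_zz by simp
  moreover have "cnj \<zz> \<noteq> 0" using zz_cnj by auto
  ultimately show ?thesis using zz_cnj by (simp add: field_simps)
qed

lemma jz_rot: "jz (rot p) = jz p * cnj \<zz>"
proof -
  have "jz (rot p) = - of_int (snd p) * \<zz> + of_int (fst p) + of_int t * of_int (snd p)"
    by (simp add: rot_def act_right_def jz_def jfactor_def)
  also have "\<dots> = of_int (fst p) * (\<zz> * cnj \<zz>) + of_int (snd p) * cnj \<zz>"
    unfolding zz_cnj unfolding cnj_zz by (simp add: algebra_simps)
  finally show ?thesis by (simp add: jz_def jfactor_def algebra_simps)
qed

lemma nome_multiple_periodic: "nome (- of_nat n * (u + of_int k)) = nome (- of_nat n * u)"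
  using nome_periodic[of "- of_nat n * u" "- int n * k"] by (simp add: algebra_simps)

lemma pcoef_rot:
  assumes p: "p \<in> coprime_pairs"
  shows "pcoef J K n (rot p) = pcoef J K n p / cnj \<zz> ^ K"
proof -
  have N: "Nz (rot p) = Nz p"
    using zz_cnj by (simp add: Nz_def jz_rot mult_ac)
  have "nome (- of_nat n * moebius_of p \<zz>) = nome (- of_nat n * moebius_of (rot p) \<zz>)"
    using poincare_term_act(2)[of "\<lambda>u. nome (- of_nat n * u)" 0 t 1 "-1" p \<zz>, OF nome_multiple_periodic _ p Im_zz_bounds(3)]
    unfolding rot_fix rot_def by simp
  thus ?thesis by (simp add: pcoef_def N jz_rot power_mult_distrib)
qed

lemma fcoef_rot: "fcoef J K n = fcoef J K n / cnj \<zz> ^ K"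
proof -
  have "fcoef J K n = (\<Sum>\<^sub>\<infinity>p\<in>coprime_pairs. pcoef J K n (rot p))"
    unfolding fcoef_def rot_def by (subst infsum_coprime_act) auto
  also have "\<dots> = (\<Sum>\<^sub>\<infinity>p\<in>coprime_pairs. pcoef J K n p * (1 / cnj \<zz> ^ K))"
    by (rule infsum_cong) (simp add: pcoef_rot)
  also have "\<dots> = fcoef J K n / cnj \<zz> ^ K" unfolding infsum_cmult_left' fcoef_def by simp
  finally show ?thesis .
qed

lemma cnj_zz_powers:
  "t = 0 \<Longrightarrow> cnj \<zz> ^ 2 = -1" "t = 1 \<Longrightarrow> cnj \<zz> ^ 2 = - \<zz>" "t = 1 \<Longrightarrow> cnj \<zz> ^ 3 = -1"
proof -
  have 2: "cnj \<zz> ^ 2 = of_int t * cnj \<zz> - 1"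
    using arg_cong[OF zz_sq, of cnj] by simp
  show "t = 0 \<Longrightarrow> cnj \<zz> ^ 2 = -1" using 2 by simp
  show 3: "t = 1 \<Longrightarrow> cnj \<zz> ^ 2 = - \<zz>" using 2 by (simp add: cnj_zz)
  show "t = 1 \<Longrightarrow> cnj \<zz> ^ 3 = -1" using 3 zz_cnj by (simp add: power3_eq_cube power2_eq_square mult.commute)
qed

lemma cnj_zz_root: "cnj \<zz> ^ nat (2 * (2 + t)) = 1"
proof -
  consider "t = 0" | "t = 1" using t by auto
  thus ?thesis
  proof cases
    case 1
    have "cnj \<zz> ^ 4 = (cnj \<zz> ^ 2) ^ 2" by (simp flip: power_mult)
    thus ?thesis using 1 cnj_zz_powers by simp
  next
    case 2
    have "cnj \<zz> ^ 6 = (cnj \<zz> ^ 3) ^ 2" by (simp flip: power_mult)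
    thus ?thesis using 2 cnj_zz_powers by simp
  qed
qed

lemma cnj_zz_power_inj:
  assumes "i < nat (2 * (2 + t))" "cnj \<zz> ^ i = 1"
  shows "i = 0"
proof (rule ccontr)
  assume i0: "i \<noteq> 0"
  have y: "Im \<zz> > 0" by (rule Im_zz_bounds(3))
  have z1: "cnj \<zz> \<noteq> 1" "\<zz> \<noteq> 1" "cnj \<zz> \<noteq> -1" "\<zz> \<noteq> -1" using y by (auto simp: complex_eq_iff)
  have P3: "x ^ 3 = x ^ 2 * x" "x ^ 4 = x ^ 3 * x" "x ^ 5 = x ^ 3 * x ^ 2" for x :: complex
    by (simp_all add: power2_eq_square power3_eq_cube power4_eq_xxxx numeral_eq_Suc)
  consider "t = 0" "i = 1 \<or> i = 2 \<or> i = 3" | "t = 1" "i = 1 \<or> i = 2 \<or> i = 3 \<or> i = 4 \<or> i = 5"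
    using t assms(1) i0 by fastforce
  thus False
  proof cases
    case 1
    thus False using assms(2) z1 cnj_zz_powers(1)[OF 1(1)] P3(1)[of "cnj \<zz>"]
      by (auto simp: minus_equation_iff)
  next
    case 2
    thus False using assms(2) z1 cnj_zz_powers(2,3)[OF 2(1)] P3(2,3)[of "cnj \<zz>"]
      by (auto simp: minus_equation_iff)
  qed
qed

text \<open>The unit \<open>cnj \<zz>\<close> is a primitive root of unity of order \<open>2 * (2 + t)\<close>.\<close>

lemma cnj_zz_power_eq_1_iff: "cnj \<zz> ^ K = 1 \<longleftrightarrow> nat (2 * (2 + t)) dvd K"
proof -
  define M where "M = nat (2 * (2 + t))"
  have M: "M > 0" using t by (auto simp: M_def)
  have "K = M * (K div M) + K mod M" by simp
  hence "cnj \<zz> ^ K = (cnj \<zz> ^ M) ^ (K div M) * cnj \<zz> ^ (K mod M)"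
    by (metis power_add power_mult)
  moreover have "cnj \<zz> ^ M = 1" unfolding M_def by (rule cnj_zz_root)
  ultimately have "cnj \<zz> ^ K = cnj \<zz> ^ (K mod M)" by simp
  moreover have "cnj \<zz> ^ (K mod M) = 1 \<longleftrightarrow> K mod M = 0"
    using cnj_zz_power_inj[of "K mod M"] M by (auto simp: M_def)
  ultimately show ?thesis unfolding M_def [symmetric] by (simp add: dvd_eq_mod_eq_0)
qed

text \<open>Permuting the pairs by \<open>rot\<close> multiplies the sum by a nontrivial root of unity.\<close>

lemma fcoef_eq_0:
  assumes "\<not> nat (2 * (2 + t)) dvd K"
  shows "fcoef J K n = 0"
proof -
  define x where "x = cnj \<zz> ^ K"
  have "cnj \<zz> \<noteq> 0" using zz_cnj by auto
  hence x: "x \<noteq> 1" "x \<noteq> 0" using assms cnj_zz_power_eq_1_iff[of K] unfolding x_def by (blast, simp)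
  have "fcoef J K n = fcoef J K n / x" unfolding x_def by (rule fcoef_rot)
  hence "fcoef J K n * x = fcoef J K n" using x by (simp add: field_simps)
  hence "fcoef J K n * (x - 1) = 0" by (simp add: algebra_simps)
  thus ?thesis using x by simp
qed

lemma fseries_eq_0:
  assumes "\<not> nat (2 * (2 + t)) dvd K"
  shows "fseries r J K q = 0"
  unfolding fseries_def by (simp add: fcoef_eq_0[OF assms])

text \<open>Complex conjugation of \<open>c * \<zz> + d\<close>, expressed on pairs.\<close>

definition refl_pair :: "int \<times> int \<Rightarrow> int \<times> int" where
  "refl_pair p = (- fst p, snd p + t * fst p)"

lemma refl_pair_refl: "refl_pair (refl_pair p) = p"
  by (simp add: refl_pair_def)

lemma jz_refl: "jz (refl_pair p) = cnj (jz p)"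
  by (simp add: jz_def jfactor_def refl_pair_def cnj_zz algebra_simps)

lemma refl_pair_props:
  assumes p: "p \<in> coprime_pairs"
  shows "refl_pair p \<in> coprime_pairs" "pcoef J K n (refl_pair p) = cnj (pcoef J K n p)"
proof -
  define a b c d where "a = fst (completion p)" and "b = snd (completion p)" and "c = fst p" and "d = snd p"
  have det: "a * d - b * c = 1" using completion_det[OF p] by (simp add: a_def b_def c_def d_def)
  have det': "a * (d + t * c) - (- b - a * t) * (- c) = 1" using det by (simp add: algebra_simps)
  have r: "refl_pair p = (- c, d + t * c)" by (simp add: refl_pair_def c_def d_def)
  show "refl_pair p \<in> coprime_pairs" unfolding r by (rule det_imp_coprime[OF det'])
  have jr: "of_int (- c) * \<zz> + of_int (d + t * c) = cnj (jz p)"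
    using jz_refl[of p] by (simp add: r jz_def jfactor_def)
  have m: "moebius_of p \<zz> = (of_int a * \<zz> + of_int b) / jz p"
    by (simp add: moebius_of_def a_def b_def jz_def jfactor_def)
  have "(of_int a * \<zz> + of_int (- b - a * t)) / cnj (jz p) = - cnj (moebius_of p \<zz>)"
  proof -
    have "of_int a * \<zz> + of_int (- b - a * t) = - cnj (of_int a * \<zz> + of_int b)"
      by (simp add: cnj_zz algebra_simps)
    hence "(of_int a * \<zz> + of_int (- b - a * t)) / cnj (jz p) = - cnj (of_int a * \<zz> + of_int b) / cnj (jz p)"
      by (rule arg_cong)
    thus ?thesis unfolding m complex_cnj_divide by (simp only: minus_divide_left)
  qed
  then obtain k where k: "moebius_of (refl_pair p) \<zz> = - cnj (moebius_of p \<zz>) + of_int k"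
    using moebius_of_eq[OF det' Im_zz_bounds(3)] unfolding r jr by auto
  have "nome (- of_nat n * moebius_of (refl_pair p) \<zz>) = nome (- of_nat n * (- cnj (moebius_of p \<zz>)))"
    unfolding k by (rule nome_multiple_periodic)
  also have "\<dots> = cnj (nome (- of_nat n * moebius_of p \<zz>))"
    by (simp add: nome_def exp_cnj)
  finally show "pcoef J K n (refl_pair p) = cnj (pcoef J K n p)"
    by (simp add: pcoef_def jz_refl Nz_def mult.commute)
qed

lemma fcoef_real: "cnj (fcoef J K n) = fcoef J K n"
proof -
  have "cnj (fcoef J K n) = (\<Sum>\<^sub>\<infinity>p\<in>coprime_pairs. cnj (pcoef J K n p))"
    unfolding fcoef_def by (rule infsum_cnj [symmetric])
  also have "\<dots> = fcoef J K n" unfolding fcoef_def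
    by (rule infsum_reindex_bij_witness[of _ refl_pair refl_pair])
       (auto simp: refl_pair_refl refl_pair_props)
  finally show ?thesis .
qed

end

section \<open>Ideals of the ring of integers\<close>

context elliptic_point begin

abbreviation RR :: "complex ring" where "RR \<equiv> int_ring \<zz>"

text \<open>The element of the ring with coordinates \<open>c, d\<close> in the basis \<open>\<zz>, 1\<close>, in the order of bottom rows.\<close>

definition lat :: "int \<Rightarrow> int \<Rightarrow> complex" where
  "lat c d = of_int c * \<zz> + of_int d"

lemma carrier_RR: "carrier RR = {lat c d | c d. True}"
proof -
  have "of_int a + of_int b * \<zz> = lat b a" for a b by (simp add: lat_def)
  thus ?thesis by (auto simp: int_ring_def)
qed

lemma lat_carrier [simp, intro!]: "lat c d \<in> carrier RR"
  unfolding carrier_RR by blast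

lemma carrier_RR_E:
  assumes "x \<in> carrier RR" obtains c d where "x = lat c d"
  using assms unfolding carrier_RR by blast

lemma RR_simps: "mult RR = (*)" "one RR = 1" "zero RR = 0" "add RR = (+)"
  by (simp_all add: int_ring_def)

lemma lat_add: "lat a b + lat c d = lat (a + c) (b + d)"
  by (simp add: lat_def algebra_simps)

lemma lat_uminus: "- lat a b = lat (- a) (- b)"
  by (simp add: lat_def)

lemma lat_mult: "lat a b * lat c d = lat (a * d + b * c + t * a * c) (b * d - a * c)"
proof -
  have "lat a b * lat c d = of_int a * of_int c * \<zz>\<^sup>2 + (of_int a * of_int d + of_int b * of_int c) * \<zz> + of_int b * of_int d"
    by (simp add: lat_def power2_eq_square algebra_simps)
  thus ?thesis unfolding zz_sq by (simp add: lat_def algebra_simps)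
qed

lemma lat_inj: "lat a b = lat c d \<longleftrightarrow> a = c \<and> b = d"
proof
  assume e: "lat a b = lat c d"
  from arg_cong[OF e, of Im] have "a = c" using Im_zz_bounds(3) by (simp add: lat_def)
  with e show "a = c \<and> b = d" by (simp add: lat_def)
qed auto

lemma lat_eq_0_iff: "lat a b = 0 \<longleftrightarrow> a = 0 \<and> b = 0"
  using lat_inj[of a b 0 0] by (simp add: lat_def)

lemma norm_lat: "(cmod (lat c d))\<^sup>2 = of_int (znorm c d)"
  by (simp add: znorm_cmod lat_def)

lemma cring_RR: "cring RR"
proof (rule cringI)
  show "abelian_group RR"
  proof (rule abelian_groupI)
    show "x \<oplus>\<^bsub>RR\<^esub> y \<in> carrier RR" if "x \<in> carrier RR" "y \<in> carrier RR" for x y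
      using that by (auto simp: RR_simps lat_add elim!: carrier_RR_E)
    have "0 = lat 0 0" by (simp add: lat_def)
    thus "\<zero>\<^bsub>RR\<^esub> \<in> carrier RR" unfolding carrier_RR RR_simps by blast
    fix x assume "x \<in> carrier RR"
    then obtain a b where x: "x = lat a b" unfolding carrier_RR by blast
    have "- x \<in> carrier RR" unfolding carrier_RR x lat_uminus by blast
    moreover have "- x \<oplus>\<^bsub>RR\<^esub> x = \<zero>\<^bsub>RR\<^esub>" by (simp add: RR_simps)
    ultimately show "\<exists>y\<in>carrier RR. y \<oplus>\<^bsub>RR\<^esub> x = \<zero>\<^bsub>RR\<^esub>" by blast
  qed (simp_all add: RR_simps)
  show "comm_monoid RR"
  proof (rule comm_monoidI)
    show "\<one>\<^bsub>RR\<^esub> \<in> carrier RR" using lat_carrier[of 0 1] by (simp add: RR_simps lat_def)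
    show "x \<otimes>\<^bsub>RR\<^esub> y \<in> carrier RR" if "x \<in> carrier RR" "y \<in> carrier RR" for x y
      using that by (auto simp: RR_simps lat_mult elim!: carrier_RR_E)
  qed (simp_all add: RR_simps)
qed (simp add: RR_simps algebra_simps)

lemma ring_RR: "ring RR"
  using cring_RR by (rule cring.axioms(1))

definition pid :: "complex \<Rightarrow> complex set" where "pid x = PIdl\<^bsub>RR\<^esub> x"

lemma pid_eq: "pid x = {y * x | y. y \<in> carrier RR}"
  by (simp add: pid_def cgenideal_def RR_simps)

lemma ideal_pid: "x \<in> carrier RR \<Longrightarrow> ideal (pid x) RR"
  unfolding pid_def by (rule cring.cgenideal_ideal[OF cring_RR])

lemma one_carrier: "1 \<in> carrier RR"
  using cring.cring_simprules(6)[OF cring_RR] by (simp add: RR_simps)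

lemma self_in_pid: "x \<in> pid x"
  using one_carrier by (auto simp: pid_eq intro: exI[of _ 1])

lemma ideal_RR_props:
  assumes "ideal I RR"
  shows "I \<subseteq> carrier RR" "0 \<in> I" "x \<in> I \<Longrightarrow> y \<in> I \<Longrightarrow> x + y \<in> I" "x \<in> I \<Longrightarrow> y \<in> I \<Longrightarrow> x - y \<in> I"
    "x \<in> I \<Longrightarrow> r \<in> carrier RR \<Longrightarrow> r * x \<in> I"
proof -
  have as: "additive_subgroup I RR" by (rule ideal.axioms(1)[OF assms])
  show sub: "I \<subseteq> carrier RR" by (rule additive_subgroup.a_subset[OF as])
  show "0 \<in> I" using additive_subgroup.zero_closed[OF as] by (simp add: RR_simps)
  show pl: "x + y \<in> I" if "x \<in> I" "y \<in> I" for x y using additive_subgroup.a_closed[OF as that] by (simp add: RR_simps)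
  show mul: "r * x \<in> I" if "x \<in> I" "r \<in> carrier RR" for x r using ideal.I_l_closed[OF assms that] by (simp add: RR_simps)
  have m1: "-1 \<in> carrier RR" using lat_carrier[of 0 "-1"] by (simp add: lat_def)
  show "x - y \<in> I" if "x \<in> I" "y \<in> I" for x y
    using pl[OF that(1) mul[OF that(2) m1]] by simp
qed

text \<open>Rounding both coordinates leaves a remainder of norm at most 3/4. This is the Euclidean property.\<close>

lemma nearest_lattice_point:
  "\<exists>r\<in>carrier RR. cmod (w - r) < 1"
proof -
  define x where "x = Im w / Im \<zz>"
  define y where "y = Re w - x * Re \<zz>"
  have w: "w = of_real x * \<zz> + of_real y"
    using Im_zz_bounds(3) by (simp add: complex_eq_iff x_def y_def)
  define u v where "u = x - of_int (round x)" and "v = y - of_int (round y)"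
  have uv: "\<bar>u\<bar> \<le> 1/2" "\<bar>v\<bar> \<le> 1/2"
    using of_int_round_abs_le[of x] of_int_round_abs_le[of y] by (auto simp: u_def v_def abs_minus_commute)
  have sq: "u\<^sup>2 \<le> 1/4" "v\<^sup>2 \<le> 1/4"
    using power_mono[OF uv(1), of 2] power_mono[OF uv(2), of 2] by (auto simp: power2_eq_square)
  have "u * v \<le> \<bar>u\<bar> * \<bar>v\<bar>" by (metis abs_ge_self abs_mult)
  also have "\<dots> \<le> 1/2 * (1/2)" by (intro mult_mono uv) auto
  finally have p: "u * v \<le> 1/4" by simp
  have e: "w - lat (round x) (round y) = of_real u * \<zz> + of_real v"
    by (simp add: w lat_def u_def v_def algebra_simps)
  have "(cmod (of_real u * \<zz> + of_real v))\<^sup>2 = u\<^sup>2 * ((Re \<zz>)\<^sup>2 + (Im \<zz>)\<^sup>2) + 2 * Re \<zz> * (u * v) + v\<^sup>2"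
    unfolding cmod_power2 by (simp add: power2_eq_square algebra_simps)
  also have "(Re \<zz>)\<^sup>2 + (Im \<zz>)\<^sup>2 = 1" unfolding Re_zz Im_zz_sq by (simp add: power_divide)
  also have "2 * Re \<zz> * (u * v) \<le> 1/4" using t p by (auto simp: Re_zz)
  finally have "(cmod (of_real u * \<zz> + of_real v))\<^sup>2 < 1" using sq by simp
  hence "cmod (of_real u * \<zz> + of_real v) < 1" by (simp add: power2_less_imp_less[of _ 1])
  thus ?thesis unfolding e [symmetric] by (intro bexI[of _ "lat (round x) (round y)"]) simp_all
qed

text \<open>A nonzero element of least norm generates the ideal, by Euclidean division.\<close>

lemma ideal_principal:
  assumes I: "ideal I RR" and n0: "I \<noteq> {0}"
  shows "\<exists>c d. lat c d \<noteq> 0 \<and> I = pid (lat c d)"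
proof -
  note IP = ideal_RR_props[OF I]
  have "\<exists>x. x \<in> I \<and> x \<noteq> 0" using n0 IP(2) by blast
  then obtain x where x: "x \<in> I \<and> x \<noteq> 0"
    and xmin: "\<And>y. y \<in> I \<and> y \<noteq> 0 \<Longrightarrow> nat \<lfloor>(cmod x)\<^sup>2\<rfloor> \<le> nat \<lfloor>(cmod y)\<^sup>2\<rfloor>"
    using ex_has_least_nat[of "\<lambda>x. x \<in> I \<and> x \<noteq> 0" _ "\<lambda>x. nat \<lfloor>(cmod x)\<^sup>2\<rfloor>"] by blast
  have min: "cmod x \<le> cmod y" if "y \<in> I" "y \<noteq> 0" for y
  proof -
    obtain a b where xa: "x = lat a b" using x IP(1) by (meson carrier_RR_E subsetD)
    obtain c d where yc: "y = lat c d" using \<open>y \<in> I\<close> IP(1) by (meson carrier_RR_E subsetD)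
    note xy = xa yc
    have "nat (znorm a b) \<le> nat (znorm c d)" using xmin[of y] that by (simp add: xy norm_lat)
    moreover have "0 \<le> real_of_int (znorm c d)" unfolding norm_lat [symmetric] by simp
    ultimately have "znorm a b \<le> znorm c d" by linarith
    hence "(cmod x)\<^sup>2 \<le> (cmod y)\<^sup>2" by (simp add: xy norm_lat)
    thus ?thesis by simp
  qed
  have "I = pid x"
  proof
    show "pid x \<subseteq> I" using IP(5) x by (auto simp: pid_eq)
    show "I \<subseteq> pid x"
    proof
      fix y assume y: "y \<in> I"
      obtain r where r: "r \<in> carrier RR" "cmod (y / x - r) < 1" using nearest_lattice_point by blast
      have "y - r * x \<in> I" by (rule IP(4)[OF y IP(5)[OF conjunct1[OF x] r(1)]])
      moreover have "cmod (y - r * x) < cmod x"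
      proof -
        have "y - r * x = (y / x - r) * x" using x by (simp add: field_simps)
        hence "cmod (y - r * x) = cmod (y / x - r) * cmod x" by (simp add: norm_mult)
        also have "\<dots> < 1 * cmod x" by (intro mult_strict_right_mono r) (use x in auto)
        finally show ?thesis by simp
      qed
      ultimately have "y - r * x = 0" using min[of "y - r * x"] by (meson not_le)
      thus "y \<in> pid x" using r by (auto simp: pid_eq)
    qed
  qed
  moreover obtain c d where "x = lat c d" using x IP(1) by (meson carrier_RR_E subsetD)
  ultimately show ?thesis using x by blast
qed

lemma lat_in_pid_int: "lat c d \<in> pid (of_int g) \<longleftrightarrow> g dvd c \<and> g dvd d"
proof
  assume "lat c d \<in> pid (of_int g)"
  then obtain a b where "lat c d = lat a b * of_int g" by (auto simp: pid_eq elim!: carrier_RR_E)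
  hence "lat c d = lat (a * g) (b * g)" by (simp add: lat_def algebra_simps)
  thus "g dvd c \<and> g dvd d" by (simp add: lat_inj)
next
  assume "g dvd c \<and> g dvd d"
  then obtain a b where "c = a * g" "d = b * g" by (metis dvd_def mult.commute)
  hence "lat c d = lat a b * of_int g" by (simp add: lat_def algebra_simps)
  thus "lat c d \<in> pid (of_int g)" unfolding pid_eq using lat_carrier by blast
qed

lemma ideal_prod_pid:
  assumes "x \<in> carrier RR" "y \<in> carrier RR"
  shows "ideal_prod RR (pid x) (pid y) = pid (x * y)"
proof
  have xy: "x * y \<in> carrier RR"
    using cring.cring_simprules(5)[OF cring_RR assms] by (simp add: RR_simps)
  note P = ideal_RR_props[OF ideal_pid[OF xy]]
  show "ideal_prod RR (pid x) (pid y) \<subseteq> pid (x * y)"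
  proof
    fix s assume "s \<in> ideal_prod RR (pid x) (pid y)"
    thus "s \<in> pid (x * y)"
    proof (induction s rule: ideal_prod.induct)
      case (prod i j)
      then obtain u v where uv: "i = u * x" "j = v * y" "u \<in> carrier RR" "v \<in> carrier RR" by (auto simp: pid_eq)
      have "u * v \<in> carrier RR" using cring.cring_simprules(5)[OF cring_RR uv(3,4)] by (simp add: RR_simps)
      moreover have "i \<otimes>\<^bsub>RR\<^esub> j = (u * v) * (x * y)" by (simp add: uv RR_simps)
      ultimately show ?case by (auto simp: pid_eq)
    next
      case (sum s1 s2)
      thus ?case using P(3) by (simp add: RR_simps)
    qed
  qed
  show "pid (x * y) \<subseteq> ideal_prod RR (pid x) (pid y)"
  proof
    fix s assume "s \<in> pid (x * y)"
    then obtain u where u: "u \<in> carrier RR" "s = u * (x * y)" by (auto simp: pid_eq)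
    have "s = (u * x) \<otimes>\<^bsub>RR\<^esub> y" by (simp add: u RR_simps)
    moreover have "u * x \<in> pid x" using u by (auto simp: pid_eq)
    ultimately show "s \<in> ideal_prod RR (pid x) (pid y)"
      using ideal_prod.prod[OF _ self_in_pid[of y], of "u * x" "pid x" RR] by simp
  qed
qed

lemma of_int_carrier: "of_int g \<in> carrier RR"
  using lat_carrier[of 0 g] by (simp add: lat_def)

lemma primitive_ideals_eq: "primitive_ideals \<zz> = (\<lambda>(c, d). pid (lat c d)) ` coprime_pairs"
proof
  show "primitive_ideals \<zz> \<subseteq> (\<lambda>(c, d). pid (lat c d)) ` coprime_pairs"
  proof
    fix I assume I: "I \<in> primitive_ideals \<zz>"
    hence id: "ideal I RR" and n0: "I \<noteq> {0}"
      and prim: "\<And>g::int. \<bar>g\<bar> > 1 \<Longrightarrow> \<not> (pid (of_int g)) divides\<^bsub>ideals_set RR\<^esub> I"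
      by (auto simp: primitive_ideals_def pid_def)
    obtain c d where cd: "lat c d \<noteq> 0" "I = pid (lat c d)" using ideal_principal[OF id n0] by blast
    define g where "g = gcd c d"
    have g0: "g > 0" using cd(1) unfolding g_def lat_eq_0_iff by (simp add: gcd_pos_int)
    obtain a b where ab: "c = g * a" "d = g * b" unfolding g_def by (meson gcd_dvd1 gcd_dvd2 dvdE)
    have "lat c d = of_int g * lat a b" by (simp add: ab lat_def algebra_simps)
    hence "I = ideal_prod RR (pid (of_int g)) (pid (lat a b))"
      using ideal_prod_pid[OF of_int_carrier, of "lat a b" g] cd by simp
    moreover have "ideal (pid (lat a b)) RR" by (rule ideal_pid) simp
    ultimately have "(pid (of_int g)) divides\<^bsub>ideals_set RR\<^esub> I"
      unfolding factor_def by (auto simp: ideals_set_def)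
    hence "\<not> \<bar>g\<bar> > 1" using prim by blast
    hence "g = 1" using g0 by simp
    hence "(c, d) \<in> coprime_pairs" by (simp add: coprime_pairs_def g_def coprime_iff_gcd_eq_1)
    thus "I \<in> (\<lambda>(c, d). pid (lat c d)) ` coprime_pairs" using cd by (auto intro!: image_eqI[of _ _ "(c, d)"])
  qed
  show "(\<lambda>(c, d). pid (lat c d)) ` coprime_pairs \<subseteq> primitive_ideals \<zz>"
  proof
    fix I assume "I \<in> (\<lambda>(c, d). pid (lat c d)) ` coprime_pairs"
    then obtain c d where cd: "I = pid (lat c d)" "(c, d) \<in> coprime_pairs" by auto
    have id: "ideal I RR" unfolding cd by (rule ideal_pid) simp
    have self: "lat c d \<in> I" unfolding cd by (rule self_in_pid)
    have "lat c d \<noteq> 0" using cd(2) by (auto simp: lat_eq_0_iff coprime_pairs_def)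
    hence n0: "I \<noteq> {0}" using self by auto
    have "\<not> (pid (of_int g)) divides\<^bsub>ideals_set RR\<^esub> I" if g: "\<bar>g\<bar> > 1" for g :: int
    proof
      assume "(pid (of_int g)) divides\<^bsub>ideals_set RR\<^esub> I"
      then obtain J where J: "ideal J RR" "I = ideal_prod RR (pid (of_int g)) J"
        unfolding factor_def by (auto simp: ideals_set_def)
      have "I \<subseteq> pid (of_int g)"
        using ring.ideal_prod_inter[OF ring_RR ideal_pid[OF of_int_carrier] J(1)] J(2) by blast
      hence "g dvd c \<and> g dvd d" using self lat_in_pid_int by blast
      hence "is_unit g" using cd(2) coprime_common_divisor[of c d g] by (simp add: coprime_pairs_def)
      thus False using g by (auto simp: zdvd1_eq)
    qed
    thus "I \<in> primitive_ideals \<zz>" using id n0 by (simp add: primitive_ideals_def pid_def)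
  qed
qed

text \<open>Complete \<open>(c, d)\<close> to a unimodular matrix with top row \<open>(a, b)\<close>. Then \<open>lat a b\<close> and \<open>lat c d\<close> form a basis of the
  ring, and \<open>u * lat a b\<close> lies in the ideal iff the norm divides \<open>u\<close>. Hence the multiples of \<open>lat a b\<close> represent the residue classes.\<close>

lemma ideal_norm_pid:
  assumes p: "(c, d) \<in> coprime_pairs"
  shows "ideal_norm \<zz> (pid (lat c d)) = nat (znorm c d)"
proof -
  define a b where "a = fst (completion (c, d))" and "b = snd (completion (c, d))"
  have det: "a * d - b * c = 1" using completion_det[OF p] by (simp add: a_def b_def)
  define I where "I = pid (lat c d)"
  define N where "N = znorm c d"
  have N: "N \<ge> 1" unfolding N_def by (rule znorm_pos[OF p])
  have al: "lat c d \<noteq> 0" using p by (auto simp: lat_eq_0_iff coprime_pairs_def)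
  have id: "ideal I RR" unfolding I_def by (rule ideal_pid) simp
  note IP = ideal_RR_props[OF id]
  define X where "X = a * c + b * d + t * b * c"
  have ba: "lat a b * of_int N = (of_int X + \<zz>) * lat c d"
    using moebius_zz[OF det] al N by (simp add: lat_def X_def N_def field_simps)
  have mem: "of_int u * lat a b \<in> I \<longleftrightarrow> N dvd u" for u
  proof
    assume "of_int u * lat a b \<in> I"
    then obtain r s where rs: "of_int u * lat a b = lat s r * lat c d" unfolding I_def by (auto simp: pid_eq elim!: carrier_RR_E)
    have "of_int u * (of_int X + \<zz>) * lat c d = of_int u * (lat a b * of_int N)"
      unfolding ba by (rule mult.assoc)
    also have "\<dots> = of_int N * (of_int u * lat a b)" by (simp only: mult_ac)
    also have "\<dots> = of_int N * lat s r * lat c d" unfolding rs by simp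
    finally have "of_int u * (of_int X + \<zz>) = of_int N * lat s r" using al by simp
    hence "lat u (u * X) = lat (N * s) (N * r)" by (simp add: lat_def algebra_simps)
    thus "N dvd u" by (simp add: lat_inj)
  next
    assume "N dvd u"
    then obtain s where "u = N * s" by (auto elim: dvdE)
    hence "of_int u * lat a b = of_int s * (lat a b * of_int N)" by simp
    also have "\<dots> = lat s (s * X) * lat c d" unfolding ba by (simp add: lat_def algebra_simps)
    finally show "of_int u * lat a b \<in> I" unfolding I_def pid_eq using lat_carrier by blast
  qed
  have coset_eq: "I +>\<^bsub>RR\<^esub> x = I +>\<^bsub>RR\<^esub> y \<longleftrightarrow> x - y \<in> I" if "x \<in> carrier RR" "y \<in> carrier RR" for x y
  proof -
    have cos: "I +>\<^bsub>RR\<^esub> x = (\<lambda>h. h + x) ` I" for x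
      by (auto simp: a_r_coset_def' RR_simps)
    show ?thesis unfolding cos
    proof
      assume e: "(\<lambda>h. h + x) ` I = (\<lambda>h. h + y) ` I"
      have "0 + x \<in> (\<lambda>h. h + x) ` I" using IP(2) by blast
      then obtain h where "h \<in> I" "x = h + y" unfolding e by auto
      thus "x - y \<in> I" by simp
    next
      assume xy: "x - y \<in> I"
      show "(\<lambda>h. h + x) ` I = (\<lambda>h. h + y) ` I"
      proof safe
        fix h assume h: "h \<in> I"
        show "h + x \<in> (\<lambda>h. h + y) ` I" by (rule image_eqI[of _ _ "h + (x - y)"]) (use IP(3)[OF h xy] in auto)
        show "h + y \<in> (\<lambda>h. h + x) ` I" by (rule image_eqI[of _ _ "h - (x - y)"]) (use IP(4)[OF h xy] in auto)
      qed
    qed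
  qed
  have ucar: "of_int u * lat a b \<in> carrier RR" for u
  proof -
    have "of_int u * lat a b = lat (u * a) (u * b)" by (simp add: lat_def algebra_simps)
    thus ?thesis by simp
  qed
  have rcos: "carrier (RR Quot I) = {I +>\<^bsub>RR\<^esub> x | x. x \<in> carrier RR}"
    by (auto simp: FactRing_def A_RCOSETS_def' )
  have "bij_betw (\<lambda>u. I +>\<^bsub>RR\<^esub> (of_int u * lat a b)) {0..<N} (carrier (RR Quot I))"
  proof (rule bij_betwI')
    fix u v assume uv: "u \<in> {0..<N}" "v \<in> {0..<N}"
    have "I +>\<^bsub>RR\<^esub> (of_int u * lat a b) = I +>\<^bsub>RR\<^esub> (of_int v * lat a b) \<longleftrightarrow> of_int (u - v) * lat a b \<in> I"
      using coset_eq[OF ucar ucar, of u v] by (simp add: left_diff_distrib)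
    also have "\<dots> \<longleftrightarrow> u = v"
    proof
      assume "of_int (u - v) * lat a b \<in> I"
      hence "N dvd u - v" using mem by blast
      thus "u = v" using uv zdvd_imp_le[of N "\<bar>u - v\<bar>"] by (cases "u = v") auto
    qed (use IP(2) in simp)
    finally show "(I +>\<^bsub>RR\<^esub> (of_int u * lat a b) = I +>\<^bsub>RR\<^esub> (of_int v * lat a b)) = (u = v)" .
  next
    show "I +>\<^bsub>RR\<^esub> (of_int u * lat a b) \<in> carrier (RR Quot I)" for u
      unfolding rcos using ucar by blast
  next
    fix C assume "C \<in> carrier (RR Quot I)"
    then obtain x y where C: "C = I +>\<^bsub>RR\<^esub> lat x y" by (auto simp: rcos elim!: carrier_RR_E)
    \<comment> \<open>Coordinates in the basis \<open>lat a b, lat c d\<close>, found by inverting the unimodular matrix.\<close>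
    define u v where "u = x * d - y * c" and "v = a * y - b * x"
    have "lat x y = of_int u * lat a b + of_int v * lat c d"
    proof -
      have 1: "u * a + v * c = x" "u * b + v * d = y"
        using arg_cong[OF det, of "\<lambda>k. x * k"] arg_cong[OF det, of "\<lambda>k. y * k"]
        by (simp_all add: u_def v_def algebra_simps)
      have "of_int u * lat a b + of_int v * lat c d = lat (u * a + v * c) (u * b + v * d)"
        by (simp add: lat_def algebra_simps)
      thus ?thesis by (simp add: 1)
    qed
    moreover have "of_int v * lat c d \<in> I" unfolding I_def using of_int_carrier by (auto simp: pid_eq)
    moreover have "of_int (u - u mod N) * lat a b \<in> I" using mem[of "u - u mod N"] by (simp add: mod_eq_dvd_iff [symmetric])
    ultimately have "lat x y - of_int (u mod N) * lat a b \<in> I"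
      using IP(3)[of "of_int v * lat c d" "of_int (u - u mod N) * lat a b"] by (simp add: algebra_simps)
    hence "C = I +>\<^bsub>RR\<^esub> (of_int (u mod N) * lat a b)"
      unfolding C using coset_eq[OF _ ucar] by simp
    thus "\<exists>u\<in>{0..<N}. C = I +>\<^bsub>RR\<^esub> (of_int u * lat a b)"
      using N by (intro bexI[of _ "u mod N"]) auto
  qed
  hence "card (carrier (RR Quot I)) = card {0..<N}" by (rule bij_betw_same_card [symmetric])
  thus ?thesis by (simp add: ideal_norm_def I_def N_def)
qed

text \<open>The units of the ring. Completing the square bounds both coordinates by 1.\<close>

lemma znorm_eq_1:
  assumes "znorm e f = 1"
  shows "(t = 0 \<and> (e, f) \<in> {(0, 1), (-1, 0), (0, -1), (1, 0)}) \<or>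
         (t = 1 \<and> (e, f) \<in> {(0, 1), (-1, 1), (-1, 0), (0, -1), (1, -1), (1, 0)})"
proof -
  have sm: "x = -1 \<or> x = 0 \<or> x = 1" if "x\<^sup>2 < 4" for x :: int
  proof -
    have "\<bar>x\<bar> < 2" using that power2_less_imp_less[of "\<bar>x\<bar>" 2] by simp
    thus ?thesis by linarith
  qed
  from t show ?thesis
  proof
    assume t0: "t = 0"
    have n: "e\<^sup>2 + f\<^sup>2 = 1" using assms unfolding znorm_def by (simp add: t0)
    have "e\<^sup>2 < 4" "f\<^sup>2 < 4" using n zero_le_power2[of e] zero_le_power2[of f] by linarith+
    thus ?thesis using t0 n sm[of e] sm[of f] by auto
  next
    assume t1: "t = 1"
    have n: "e\<^sup>2 + e * f + f\<^sup>2 = 1" using assms unfolding znorm_def by (simp add: t1)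
    have "(2 * e + f)\<^sup>2 + 3 * f\<^sup>2 = 4 * (e\<^sup>2 + e * f + f\<^sup>2)" "(2 * f + e)\<^sup>2 + 3 * e\<^sup>2 = 4 * (e\<^sup>2 + e * f + f\<^sup>2)"
      by (simp_all add: power2_eq_square algebra_simps)
    hence "(2 * e + f)\<^sup>2 + 3 * f\<^sup>2 = 4" "(2 * f + e)\<^sup>2 + 3 * e\<^sup>2 = 4" unfolding n by simp_all
    hence "3 * f\<^sup>2 \<le> 4" "3 * e\<^sup>2 \<le> 4"
      using zero_le_power2[of "2 * e + f"] zero_le_power2[of "2 * f + e"] by linarith+
    hence "e\<^sup>2 < 4" "f\<^sup>2 < 4" by linarith+
    thus ?thesis using t1 n sm[of e] sm[of f] by auto
  qed
qed

definition mat2 :: "int \<Rightarrow> int \<Rightarrow> int \<Rightarrow> int \<Rightarrow> int ^ 2 ^ 2" where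
  "mat2 a b c d = (\<chi> i j. if i = 1 then (if j = 1 then a else b) else (if j = 1 then c else d))"

lemma mat2_simps [simp]:
  "mat2 a b c d $ 1 $ 1 = a" "mat2 a b c d $ 1 $ 2 = b" "mat2 a b c d $ 2 $ 1 = c" "mat2 a b c d $ 2 $ 2 = d"
  by (simp_all add: mat2_def)

lemma mat2_eta: "A = mat2 (A $ 1 $ 1) (A $ 1 $ 2) (A $ 2 $ 1) (A $ 2 $ 2)"
  by (simp add: vec_eq_iff forall_2)

lemma mat2_eq_iff: "mat2 a b c d = mat2 a' b' c' d' \<longleftrightarrow> a = a' \<and> b = b' \<and> c = c' \<and> d = d'"
  by (auto simp: vec_eq_iff forall_2)

lemma mat2_uminus: "- mat2 a b c d = mat2 (- a) (- b) (- c) (- d)"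
  by (simp add: vec_eq_iff forall_2)

lemma det_mat2: "det (mat2 a b c d) = a * d - b * c"
  by (simp add: det_2)

text \<open>A matrix fixing \<open>\<zz>\<close> preserves its imaginary part, so its bottom row is a unit; the top row is then \<open>\<zz>\<close> times
  the bottom row.\<close>

lemma stabilizer_eq:
  "{A \<in> SL2Z. mobius_action A \<zz> = \<zz>} = (\<lambda>(c, d). mat2 (c * t + d) (- c) c d) ` {(c, d). znorm c d = 1}"
proof safe
  fix A assume A: "A \<in> SL2Z" "mobius_action A \<zz> = \<zz>"
  define a b c d where "a = A $ 1 $ 1" and "b = A $ 1 $ 2" and "c = A $ 2 $ 1" and "d = A $ 2 $ 2"
  have Aeq: "A = mat2 a b c d" unfolding a_def b_def c_def d_def by (rule mat2_eta)
  have det: "a * d - b * c = 1" using A(1) by (simp add: SL2Z_def Aeq det_mat2)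
  have fx: "(of_int a * \<zz> + of_int b) / (of_int c * \<zz> + of_int d) = \<zz>"
    using A(2) by (simp add: mobius_action_def automorphy_factor_def Aeq)
  have N: "znorm c d \<ge> 1" by (rule znorm_pos[OF det_imp_coprime[OF det]])
  have "Im \<zz> / of_int (znorm c d) = Im \<zz>"
    using arg_cong[OF fx, of Im] unfolding moebius_zz[OF det] by simp
  hence n1: "znorm c d = 1" using Im_zz_bounds(3) N by (simp add: field_simps)
  have j: "of_int c * \<zz> + of_int d \<noteq> 0"
    using jfactor_nonzero[OF det_imp_coprime[OF det] Im_zz_bounds(3)] by (simp add: jfactor_def)
  have "lat a b = \<zz> * lat c d" using fx j by (simp add: lat_def field_simps)
  also have "\<zz> * lat c d = lat 1 0 * lat c d" by (simp add: lat_def)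
  finally have "lat a b = lat 1 0 * lat c d" .
  hence "a = d + t * c" "b = - c" unfolding lat_mult lat_inj by auto
  hence "A = (case (c, d) of (c, d) \<Rightarrow> mat2 (c * t + d) (- c) c d)" by (simp add: Aeq mult.commute add.commute)
  thus "A \<in> (\<lambda>(c, d). mat2 (c * t + d) (- c) c d) ` {(c, d). znorm c d = 1}" using n1 by blast
next
  fix c d assume n: "znorm c d = 1"
  have det: "(c * t + d) * d - (- c) * c = 1" using n by (simp add: znorm_def power2_eq_square algebra_simps)
  thus "mat2 (c * t + d) (- c) c d \<in> SL2Z" by (simp add: SL2Z_def det_mat2)
  have j: "lat c d \<noteq> 0"
    using jfactor_nonzero[OF det_imp_coprime[OF det] Im_zz_bounds(3)] by (simp add: jfactor_def lat_def)
  have "lat (c * t + d) (- c) = lat 1 0 * lat c d" unfolding lat_mult by (simp add: algebra_simps)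
  hence "lat (c * t + d) (- c) / lat c d = lat 1 0" using j by simp
  thus "mobius_action (mat2 (c * t + d) (- c) c d) \<zz> = \<zz>"
    by (simp add: mobius_action_def automorphy_factor_def lat_def)
qed

text \<open>There are \<open>2 * (2 + t)\<close> units, in pairs of opposite sign.\<close>

lemma stab_order_eq: "stab_order \<zz> = nat (2 + t)"
proof -
  define M where "M = (\<lambda>(c, d). mat2 (c * t + d) (- c) c d)"
  define f where "f = (\<lambda>x. {M x, - M x})"
  have Mm: "M (- c, - d) = - M (c, d)" for c d by (simp add: M_def mat2_uminus mat2_eq_iff)
  have fm: "f (- c, - d) = f (c, d)" for c d unfolding f_def Mm by auto
  have feq: "f (c, d) = f (c', d') \<longleftrightarrow> (c = c' \<and> d = d') \<or> (c = - c' \<and> d = - d')" for c d c' d'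
    unfolding f_def M_def prod.case mat2_uminus doubleton_eq_iff mat2_eq_iff by auto
  have "PSL2_stabilizer \<zz> = f ` {(c, d). znorm c d = 1}"
    unfolding PSL2_stabilizer_def stabilizer_eq by (auto simp: f_def M_def image_image)
  also have "card \<dots> = nat (2 + t)"
  proof -
    consider "t = 0" | "t = 1" using t by auto
    thus ?thesis
    proof cases
      case 1
      have "{(c, d). znorm c d = 1} = {(0, 1), (-1, 0), (0, -1), (1, 0)}"
        (is "?L = ?R")
      proof
        show "?L \<subseteq> ?R"
        proof
          fix x assume "x \<in> ?L"
          then obtain c d where cd: "x = (c, d)" "znorm c d = 1" by blast
          from znorm_eq_1[OF cd(2)] 1 show "x \<in> ?R" unfolding cd(1) by (elim disjE conjE) simp_all
        qed
        show "?R \<subseteq> ?L" unfolding znorm_def using 1 by simp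
      qed
      hence "f ` {(c, d). znorm c d = 1} = {f (0, 1), f (1, 0)}"
        using fm[of 1 0] fm[of 0 1] by auto
      thus ?thesis using 1 by (simp add: feq)
    next
      case 2
      have "{(c, d). znorm c d = 1} = {(0, 1), (-1, 1), (-1, 0), (0, -1), (1, -1), (1, 0)}"
        (is "?L = ?R")
      proof
        show "?L \<subseteq> ?R"
        proof
          fix x assume "x \<in> ?L"
          then obtain c d where cd: "x = (c, d)" "znorm c d = 1" by blast
          from znorm_eq_1[OF cd(2)] 2 show "x \<in> ?R" unfolding cd(1) by (elim disjE conjE) simp_all
        qed
        show "?R \<subseteq> ?L" unfolding znorm_def using 2 by simp
      qed
      hence "f ` {(c, d). znorm c d = 1} = {f (0, 1), f (1, 0), f (1, -1)}"
        using fm[of 1 0] fm[of 0 1] fm[of 1 "-1"] by auto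
      thus ?thesis using 2 by (simp add: feq)
    qed
  qed
  finally show ?thesis by (simp add: stab_order_def)
qed

end

section \<open>From coprime pairs to primitive ideals\<close>

context elliptic_point begin

definition ideal_of :: "int \<times> int \<Rightarrow> complex set" where
  "ideal_of p = pid (jz p)"

lemma jz_lat: "jz p = lat (fst p) (snd p)"
  by (simp add: jz_def jfactor_def lat_def)

lemma primitive_ideals_image: "primitive_ideals \<zz> = ideal_of ` coprime_pairs"
  unfolding primitive_ideals_eq
  by (rule image_cong) (auto simp: ideal_of_def jz_lat)

text \<open>The number \<open>2 * \<omega>\<close> of units.\<close>

definition unit_count :: nat where "unit_count = nat (2 * (2 + t))"

lemma unit_count_pos: "unit_count > 0"
  using t by (auto simp: unit_count_def)

lemma jz_rot_power: "jz ((rot ^^ i) p) = jz p * cnj \<zz> ^ i"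
  by (induction i) (simp_all add: jz_rot mult_ac)

lemma rot_power_coprime: "p \<in> coprime_pairs \<Longrightarrow> (rot ^^ i) p \<in> coprime_pairs"
  by (induction i) (simp_all add: rot_coprime)

lemma pcoef_rot_power:
  assumes "p \<in> coprime_pairs" "unit_count dvd K"
  shows "pcoef J K n ((rot ^^ i) p) = pcoef J K n p"
proof -
  have "cnj \<zz> ^ K = 1" using assms(2) cnj_zz_power_eq_1_iff by (simp add: unit_count_def)
  thus ?thesis using assms(1)
    by (induction i) (simp_all add: pcoef_rot rot_power_coprime)
qed

lemma unit_is_power:
  assumes "znorm e f = 1"
  shows "\<exists>i<unit_count. lat e f = cnj \<zz> ^ i"
proof -
  consider "t = 0" "(e, f) \<in> {(0, 1), (-1, 0), (0, -1), (1, 0)}" |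
    "t = 1" "(e, f) \<in> {(0, 1), (-1, 1), (-1, 0), (0, -1), (1, -1), (1, 0)}"
    using znorm_eq_1[OF assms] by blast
  thus ?thesis
  proof cases
    case 1
    have c: "cnj \<zz> ^ 0 = lat 0 1" "cnj \<zz> ^ 1 = lat (-1) 0" "cnj \<zz> ^ 2 = lat 0 (-1)" "cnj \<zz> ^ 3 = lat 1 0"
      using cnj_zz_powers(1)[OF 1(1)] cnj_zz 1(1) by (simp_all add: lat_def power3_eq_cube power2_eq_square)
    have "0 < unit_count" "1 < unit_count" "2 < unit_count" "3 < unit_count"
      unfolding unit_count_def using 1(1) by simp_all
    thus ?thesis using 1(2) c by (elim insertE emptyE) (auto simp only: prod.inject)
  next
    case 2
    have c2: "cnj \<zz> ^ 2 = - \<zz>" and c3: "cnj \<zz> ^ 3 = -1" using cnj_zz_powers(2,3)[OF 2(1)] by auto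
    have c4: "cnj \<zz> ^ 4 = cnj \<zz> ^ 3 * cnj \<zz>" and c5: "cnj \<zz> ^ 5 = cnj \<zz> ^ 3 * cnj \<zz> ^ 2"
      by (simp_all flip: power_add power_Suc2)
    have c: "cnj \<zz> ^ 0 = lat 0 1" "cnj \<zz> ^ 1 = lat (-1) 1" "cnj \<zz> ^ 2 = lat (-1) 0" "cnj \<zz> ^ 3 = lat 0 (-1)"
       "cnj \<zz> ^ 4 = lat 1 (-1)" "cnj \<zz> ^ 5 = lat 1 0"
      using cnj_zz 2(1) unfolding c4 c5 c3 c2 by (simp_all add: lat_def)
    have "0 < unit_count" "1 < unit_count" "2 < unit_count" "3 < unit_count" "4 < unit_count" "5 < unit_count"
      unfolding unit_count_def using 2(1) by simp_all
    thus ?thesis using 2(2) c by (elim insertE emptyE) (auto simp only: prod.inject)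
  qed
qed

lemma carrier_mult: "x \<in> carrier RR \<Longrightarrow> y \<in> carrier RR \<Longrightarrow> x * y \<in> carrier RR"
  using cring.cring_simprules(5)[OF cring_RR, of x y] by (simp add: RR_simps)

lemma ideal_of_rot: "ideal_of (rot p) = ideal_of p"
proof -
  have c: "cnj \<zz> \<in> carrier RR" "\<zz> \<in> carrier RR"
    using lat_carrier[of "-1" t] lat_carrier[of 1 0] by (simp_all add: lat_def cnj_zz)
  have "jz (rot p) = cnj \<zz> * jz p" by (simp add: jz_rot mult.commute)
  moreover have "jz p = \<zz> * jz (rot p)" using zz_cnj by (simp add: jz_rot mult_ac)
  ultimately have 1: "y * jz (rot p) = (y * cnj \<zz>) * jz p" "y * jz p = (y * \<zz>) * jz (rot p)" for y
    by (simp_all add: mult.assoc)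
  show ?thesis unfolding ideal_of_def pid_eq
    using 1 carrier_mult[OF _ c(1)] carrier_mult[OF _ c(2)] by blast
qed

lemma ideal_of_rot_power: "ideal_of ((rot ^^ i) p) = ideal_of p"
  by (induction i) (simp_all add: ideal_of_rot)

text \<open>Two generators of the same ideal differ by a unit, and every unit is a power of \<open>cnj \<zz>\<close>.\<close>

lemma ideal_of_eq_imp:
  assumes p: "p \<in> coprime_pairs" "p' \<in> coprime_pairs" and e: "ideal_of p' = ideal_of p"
  shows "\<exists>i<unit_count. p' = (rot ^^ i) p"
proof -
  have in1: "jz p' \<in> pid (jz p)" and in2: "jz p \<in> pid (jz p')"
    using e self_in_pid[of "jz p"] self_in_pid[of "jz p'"] unfolding ideal_of_def by auto
  obtain x where x: "x \<in> carrier RR" "jz p' = x * jz p" using in1 unfolding pid_eq by blast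
  obtain y where y: "y \<in> carrier RR" "jz p = y * jz p'" using in2 unfolding pid_eq by blast
  note xy = x(1) y(1) x(2) y(2)
  obtain a b c d where ab: "x = lat a b" and cd: "y = lat c d" using xy(1,2) by (meson carrier_RR_E)
  have "y * jz p' = (y * x) * jz p" unfolding xy(3) by (rule mult.assoc [symmetric])
  hence "jz p = (y * x) * jz p" unfolding xy(4) [symmetric] .
  hence yx: "y * x = 1" using jz_nonzero[OF p(1)] by simp
  have "(cmod (y * x))\<^sup>2 = of_int (znorm c d) * of_int (znorm a b)"
    by (simp add: norm_mult power_mult_distrib ab cd norm_lat)
  hence "real_of_int (znorm c d * znorm a b) = 1" unfolding yx by simp
  hence "znorm c d * znorm a b = 1" by linarith
  moreover have "znorm a b \<ge> 0"
  proof -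
    have "0 \<le> real_of_int (znorm a b)" unfolding norm_lat [symmetric] by simp
    thus ?thesis by simp
  qed
  ultimately have "znorm a b = 1" by (auto simp: zmult_eq_1_iff)
  then obtain i where i: "i < unit_count" "x = cnj \<zz> ^ i" using unit_is_power ab by blast
  have "jz p' = jz ((rot ^^ i) p)" unfolding jz_rot_power xy(3) i(2) by (rule mult.commute)
  hence "p' = (rot ^^ i) p" unfolding jz_lat lat_inj by (simp add: prod_eq_iff)
  thus ?thesis using i by blast
qed

lemma fibre_eq:
  assumes p: "p \<in> coprime_pairs"
  shows "{p' \<in> coprime_pairs. ideal_of p' = ideal_of p} = (\<lambda>i. (rot ^^ i) p) ` {..<unit_count}"
proof
  show "{p' \<in> coprime_pairs. ideal_of p' = ideal_of p} \<subseteq> (\<lambda>i. (rot ^^ i) p) ` {..<unit_count}"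
  proof
    fix p' assume "p' \<in> {p' \<in> coprime_pairs. ideal_of p' = ideal_of p}"
    then obtain i where "i < unit_count" "p' = (rot ^^ i) p" using ideal_of_eq_imp[OF p] by blast
    thus "p' \<in> (\<lambda>i. (rot ^^ i) p) ` {..<unit_count}" by blast
  qed
  show "(\<lambda>i. (rot ^^ i) p) ` {..<unit_count} \<subseteq> {p' \<in> coprime_pairs. ideal_of p' = ideal_of p}"
    using rot_power_coprime[OF p] ideal_of_rot_power[of _ p] by blast
qed

text \<open>Units act freely on generators.\<close>

lemma card_fibre:
  assumes p: "p \<in> coprime_pairs"
  shows "card {p' \<in> coprime_pairs. ideal_of p' = ideal_of p} = unit_count"
proof -
  have c0: "cnj \<zz> \<noteq> 0" using zz_cnj by auto
  have "i = k" if "i \<le> k" "k < unit_count" "(rot ^^ i) p = (rot ^^ k) p" for i k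
  proof -
    have "jz p * cnj \<zz> ^ i = jz p * cnj \<zz> ^ k" using that(3) by (metis jz_rot_power)
    hence "cnj \<zz> ^ i = cnj \<zz> ^ (i + (k - i))" using jz_nonzero[OF p] that(1) by simp
    hence "cnj \<zz> ^ (k - i) = 1" using c0 unfolding power_add by simp
    hence "k - i = 0" using cnj_zz_power_inj[of "k - i"] that(2) by (simp add: unit_count_def)
    thus ?thesis using that(1) by simp
  qed
  hence "inj_on (\<lambda>i. (rot ^^ i) p) {..<unit_count}"
    unfolding inj_on_def by (metis lessThan_iff nat_le_linear)
  thus ?thesis unfolding fibre_eq[OF p] by (simp add: card_image)
qed

text \<open>Polar coordinates of \<open>j\<close> and of \<open>e(-n * \<gamma> \<zz>)\<close>: the phases give the argument of \<open>C_coeff\<close> and the moduli give the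
  remaining factors of \<open>F_term\<close>.\<close>

lemma pcoef_polar:
  assumes det: "a * d - b * c = 1"
  shows "pcoef J K n (c, d) =
     of_real (exp (2 * pi * real n / real_of_int (znorm c d) * Im \<zz>) / real_of_int (znorm c d) powr (real K / 2 - real J)) *
     unit_exp (- (real n / real_of_int (znorm c d)) *
               (of_int (a * c) * (cmod \<zz>)\<^sup>2 + of_int (b * d) + Re \<zz> * of_int (a * d + b * c))
             - real K / (2 * pi) * Arg (of_int c * \<zz> + of_int d))"
proof -
  define N where "N = real_of_int (znorm c d)"
  define X where "X = real_of_int (a * c + b * d + t * b * c)"
  define j where "j = of_int c * \<zz> + of_int d"
  define A where "A = X + Re \<zz>"
  have p: "(c, d) \<in> coprime_pairs" by (rule det_imp_coprime[OF det])
  have N: "N \<ge> 1" using znorm_pos[OF p] by (simp add: N_def)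
  have jj: "jz (c, d) = j" by (simp add: jz_def jfactor_def j_def)
  have j0: "j \<noteq> 0" using jz_nonzero[OF p] by (simp add: jj)
  have Nz: "Nz (c, d) = of_real N"
    using znorm_eq[of c d] by (simp add: Nz_def jj j_def N_def)
  have nj: "cmod j = sqrt N" unfolding N_def znorm_cmod by (simp add: j_def)
  have AX: "of_int (a * c) * (cmod \<zz>)\<^sup>2 + of_int (b * d) + Re \<zz> * of_int (a * d + b * c) = A"
  proof -
    have "a * d + b * c = 1 + 2 * b * c" using det by simp
    hence e: "real_of_int (a * d + b * c) = 1 + 2 * real_of_int b * real_of_int c" by (simp only: of_int_add of_int_mult of_int_1 of_int_numeral)
    show ?thesis unfolding e by (simp add: A_def X_def norm_zz Re_zz algebra_simps)
  qed
  \<comment> \<open>The translation by \<open>k\<close> comes from the choice of the top row and disappears in the exponential.\<close>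
  obtain k where "moebius_of (c, d) \<zz> = (of_int a * \<zz> + of_int b) / (of_int c * \<zz> + of_int d) + of_int k"
    using moebius_of_eq[OF det Im_zz_bounds(3)] by blast
  hence m: "moebius_of (c, d) \<zz> = (of_real X + \<zz>) / of_real N + of_int k"
    unfolding moebius_zz[OF det] by (simp add: X_def N_def)
  have "of_real X + \<zz> = of_real A + \<i> * of_real (Im \<zz>)" by (simp add: A_def complex_eq_iff)
  hence "nome (- of_nat n * moebius_of (c, d) \<zz>) = nome (- of_nat n * ((of_real A + \<i> * of_real (Im \<zz>)) / of_real N))"
    unfolding m nome_multiple_periodic by simp
  also have "\<dots> = exp (of_real (2 * pi * real n / N * Im \<zz>)) * unit_exp (- (real n / N) * A)"
    unfolding nome_def unit_exp_def using N by (simp add: exp_add [symmetric] field_simps)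
  finally have no: "nome (- of_nat n * moebius_of (c, d) \<zz>) = of_real (exp (2 * pi * real n / N * Im \<zz>)) * unit_exp (- (real n / N) * A)"
    by (simp only: exp_of_real)
  have jK: "j ^ K = of_real (N powr (real K / 2)) * exp (\<i> * of_real (real K * Arg j))"
  proof -
    have "j = of_real (sqrt N) * exp (\<i> * of_real (Arg j))"
      using Arg_eq[OF j0] nj by simp
    hence "j ^ K = of_real (sqrt N) ^ K * exp (\<i> * of_real (Arg j)) ^ K"
      by (metis power_mult_distrib)
    also have "exp (\<i> * of_real (Arg j)) ^ K = exp (\<i> * of_real (real K * Arg j))"
      by (simp add: exp_of_nat_mult [symmetric] mult_ac)
    also have "complex_of_real (sqrt N) ^ K = of_real (sqrt N ^ K)" by simp
    also have "sqrt N ^ K = N powr (real K / 2)"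
      using N by (simp add: powr_half_sqrt [symmetric] powr_realpow [symmetric] powr_powr)
    finally show ?thesis .
  qed
  have NK: "N ^ J / N powr (real K / 2) = 1 / N powr (real K / 2 - real J)"
    using N by (simp add: powr_diff powr_realpow)
  have "Nz (c, d) ^ J / jz (c, d) ^ K = of_real (N ^ J / N powr (real K / 2)) / exp (\<i> * of_real (real K * Arg j))"
    unfolding Nz jj jK by simp
  also have "\<dots> = of_real (1 / N powr (real K / 2 - real J)) * exp (- (\<i> * of_real (real K * Arg j)))"
    unfolding NK exp_minus by (rule divide_inverse)
  finally have c: "Nz (c, d) ^ J / jz (c, d) ^ K = \<dots>" .
  have u: "unit_exp (- (real n / N) * A - real K / (2 * pi) * Arg j) =
     unit_exp (- (real n / N) * A) * exp (- (\<i> * of_real (real K * Arg j)))"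
    unfolding unit_exp_def exp_add [symmetric] by (rule arg_cong[of _ _ exp]) (simp add: field_simps)
  show ?thesis unfolding pcoef_def c no AX N_def [symmetric] j_def [symmetric] u by simp
qed

text \<open>The quadruple selected in \<open>C_coeff\<close> need not be the given pair, but its bottom row differs from it by a
  unit, to which \<open>pcoef\<close> is insensitive.\<close>

lemma F_term_ideal_of:
  assumes p: "p \<in> coprime_pairs" and K: "unit_count dvd K"
  shows "F_term \<zz> K J r q n (ideal_of p) = of_real (real n ^ r * Re (pcoef J K n p)) * q ^ n"
proof -
  define Q where "Q = (SOME x. generating_quadruple \<zz> (ideal_of p) x)"
  obtain a b c d where Q: "Q = (a, b, c, d)" by (cases Q) auto
  have "generating_quadruple \<zz> (ideal_of p) (fst (completion p), snd (completion p), fst p, snd p)"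
    unfolding generating_quadruple_def ideal_of_def pid_def jz_lat lat_def prod.case
    using completion_det[OF p] by simp
  hence "generating_quadruple \<zz> (ideal_of p) Q" unfolding Q_def by (rule someI)
  hence det: "a * d - b * c = 1" and id: "ideal_of p = ideal_of (c, d)"
    by (auto simp: Q generating_quadruple_def ideal_of_def pid_def jz_lat lat_def)
  have cd: "(c, d) \<in> coprime_pairs" by (rule det_imp_coprime[OF det])
  obtain i where i: "(c, d) = (rot ^^ i) p" using ideal_of_eq_imp[OF p cd id [symmetric]] by blast
  have pc: "pcoef J K n (c, d) = pcoef J K n p" unfolding i by (rule pcoef_rot_power[OF p K])
  define N where "N = real_of_int (znorm c d)"
  have N: "real (ideal_norm \<zz> (ideal_of p)) = N"
    unfolding id unfolding ideal_of_def jz_lat using ideal_norm_pid[OF cd] znorm_pos[OF cd] by (simp add: N_def)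
  define U where "U = unit_exp (- (real n / N) *
               (of_int (a * c) * (cmod \<zz>)\<^sup>2 + of_int (b * d) + Re \<zz> * of_int (a * d + b * c))
             - real K / (2 * pi) * Arg (of_int c * \<zz> + of_int d))"
  have C: "C_coeff \<zz> K (ideal_of p) n = Re U"
    unfolding C_coeff_def Q_def [symmetric] Q by (simp add: N U_def)
  have "pcoef J K n p = of_real (exp (2 * pi * real n / N * Im \<zz>) / N powr (real K / 2 - real J)) * U"
    unfolding pc [symmetric] pcoef_polar[OF det] U_def N_def ..
  hence "Re (pcoef J K n p) = exp (2 * pi * real n / N * Im \<zz>) / N powr (real K / 2 - real J) * Re U"
    by simp
  hence e: "Re U / N powr (real K / 2 - real J) * real n ^ r * exp (2 * pi * real n / N * Im \<zz>) = real n ^ r * Re (pcoef J K n p)"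
    by simp
  show ?thesis unfolding F_term_def C N e ..
qed

lemma F_term_factor:
  assumes "I \<in> primitive_ideals \<zz>" "unit_count dvd K"
  shows "F_term \<zz> K J r q n I = (of_nat n ^ r * q ^ n) * F_term \<zz> K J 0 1 n I"
  using assms unfolding primitive_ideals_image by (auto simp: F_term_ideal_of)

text \<open>Each primitive ideal has \<open>unit_count\<close> generators, and the sum over pairs is real by conjugation.\<close>

lemma F_term_has_sum:
  assumes K: "unit_count dvd K" "K \<ge> 2 * J + 4"
  shows "(F_term \<zz> K J r q n has_sum (of_nat n ^ r * fcoef J K n * q ^ n / of_nat unit_count)) (primitive_ideals \<zz>)"
proof -
  define g where "g = (\<lambda>p. complex_of_real (Re (pcoef J K n p)))"
  have "(pcoef J K n has_sum fcoef J K n) coprime_pairs"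
    unfolding fcoef_def by (rule has_sum_infsum[OF abs_summable_summable[OF pcoef_summable[OF K(2)]]])
  hence "(g has_sum of_real (Re (fcoef J K n))) coprime_pairs"
    unfolding g_def by (intro has_sum_of_real has_sum_Re)
  also have "complex_of_real (Re (fcoef J K n)) = fcoef J K n"
    using fcoef_real[of J K n] by (auto simp: complex_eq_iff)
  finally have g: "(g has_sum fcoef J K n) coprime_pairs" .
  define fib where "fib = (\<lambda>I. {p \<in> coprime_pairs. ideal_of p = I})"
  have img: "(\<lambda>p. (ideal_of p, p)) ` coprime_pairs = Sigma (primitive_ideals \<zz>) fib"
    unfolding primitive_ideals_image fib_def by blast
  have "inj_on (\<lambda>p. (ideal_of p, p)) coprime_pairs" by (rule inj_onI) simp
  hence S: "((\<lambda>(I, p). g p) has_sum fcoef J K n) (Sigma (primitive_ideals \<zz>) fib)"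
    unfolding img [symmetric] using g by (subst has_sum_reindex) (simp_all add: o_def)
  have "((\<lambda>I. of_nat unit_count * F_term \<zz> K J 0 1 n I) has_sum fcoef J K n) (primitive_ideals \<zz>)"
  proof (rule has_sum_SigmaD[OF S])
    fix I assume "I \<in> primitive_ideals \<zz>"
    then obtain p where p: "p \<in> coprime_pairs" "I = ideal_of p" unfolding primitive_ideals_image by blast
    have gc: "g p' = F_term \<zz> K J 0 1 n I" if "p' \<in> fib I" for p'
      using that F_term_ideal_of[of p' K J 0 1 n] K(1) by (auto simp: fib_def g_def)
    have card: "card (fib I) = unit_count" unfolding fib_def p(2) by (rule card_fibre[OF p(1)])
    hence fin: "finite (fib I)" using unit_count_pos card_gt_0_iff by metis
    show "((\<lambda>p. case (I, p) of (I, p) \<Rightarrow> g p) has_sum of_nat unit_count * F_term \<zz> K J 0 1 n I) (fib I)"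
      by (rule has_sum_finiteI[OF fin]) (simp add: gc card)
  qed
  from has_sum_cmult_right[OF this, of "of_nat n ^ r * q ^ n / of_nat unit_count"]
  have "((\<lambda>I. (of_nat n ^ r * q ^ n) * F_term \<zz> K J 0 1 n I) has_sum (of_nat n ^ r * fcoef J K n * q ^ n / of_nat unit_count)) (primitive_ideals \<zz>)"
    using unit_count_pos by (simp add: mult_ac)
  thus ?thesis
    by (rule has_sum_cong[THEN iffD2, rotated]) (rule F_term_factor[OF _ K(1)])
qed

lemma F_series_eq:
  assumes K: "unit_count dvd K" "K \<ge> 2 * J + 4" and r: "r \<le> 1" and z: "Im z > Im \<zz>"
  shows "F_converges \<zz> K J r (nome z)"
    and "F_series \<zz> K J r (nome z) = fseries r J K (nome z) / of_nat unit_count"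
proof -
  let ?q = "nome z"
  have q: "norm ?q < exp (- 2 * pi * Im \<zz>)" using z by (simp add: norm_nome)
  have i: "(\<Sum>\<^sub>\<infinity>I\<in>primitive_ideals \<zz>. F_term \<zz> K J r ?q n I) = of_nat n ^ r * fcoef J K n * ?q ^ n / of_nat unit_count" for n
    by (rule infsumI[OF F_term_has_sum[OF K]])
  have s: "(\<lambda>n. of_nat n ^ r * fcoef J K n * ?q ^ n) sums fseries r J K ?q"
    unfolding fseries_def by (rule summable_sums[OF summable_norm_cancel[OF fseries_summable[OF K(2) r q]]])
  from sums_divide[OF this, of "of_nat unit_count"]
  have s': "(\<lambda>n. \<Sum>\<^sub>\<infinity>I\<in>primitive_ideals \<zz>. F_term \<zz> K J r ?q n I) sums (fseries r J K ?q / of_nat unit_count)"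
    unfolding i .
  show "F_converges \<zz> K J r ?q" unfolding F_converges_def
    using s' has_sum_imp_summable[OF F_term_has_sum[OF K]] by (auto simp: sums_iff)
  show "F_series \<zz> K J r ?q = fseries r J K ?q / of_nat unit_count"
    using s' by (simp add: F_series_def sums_iff)
qed

text \<open>A predicate, so that its closure under sums and scalar multiples can be stated once.\<close>

definition F_span :: "(complex \<Rightarrow> complex) \<Rightarrow> bool" where
  "F_span g \<longleftrightarrow> (\<exists>(S :: (nat \<times> nat \<times> nat) set) (\<beta> :: nat \<Rightarrow> nat \<Rightarrow> nat \<Rightarrow> complex).
           finite S \<and> (\<forall>(k, j, r)\<in>S. k \<ge> 1) \<and>
           (\<forall>z. Im z > Im \<zz> \<longrightarrow>
              (\<forall>(k, j, r)\<in>S. F_converges \<zz> (2 * k * stab_order \<zz>) j r (nome z)) \<and>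
              g z = (\<Sum>(k, j, r)\<in>S. \<beta> k j r * F_series \<zz> (2 * k * stab_order \<zz>) j r (nome z))))"

lemma F_span_cong: "F_span g \<Longrightarrow> (\<And>z. Im z > Im \<zz> \<Longrightarrow> f z = g z) \<Longrightarrow> F_span f"
  unfolding F_span_def by (elim exE, rule exI, rule exI) auto

lemma F_span_0: "F_span (\<lambda>_. 0)"
  unfolding F_span_def by (rule exI[of _ "{}"], rule exI[of _ "\<lambda>_ _ _. 0"]) auto

lemma F_span_add:
  assumes "F_span f" "F_span g"
  shows "F_span (\<lambda>z. f z + g z)"
proof -
  obtain S \<beta> where S: "finite S" "\<forall>(k, j, r)\<in>S. k \<ge> 1"
    "\<forall>z. Im z > Im \<zz> \<longrightarrow> (\<forall>(k, j, r)\<in>S. F_converges \<zz> (2 * k * stab_order \<zz>) j r (nome z)) \<and>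
       f z = (\<Sum>(k, j, r)\<in>S. \<beta> k j r * F_series \<zz> (2 * k * stab_order \<zz>) j r (nome z))"
    using assms(1) unfolding F_span_def by (elim exE conjE) (rule that; assumption)
  obtain T \<gamma> where T: "finite T" "\<forall>(k, j, r)\<in>T. k \<ge> 1"
    "\<forall>z. Im z > Im \<zz> \<longrightarrow> (\<forall>(k, j, r)\<in>T. F_converges \<zz> (2 * k * stab_order \<zz>) j r (nome z)) \<and>
       g z = (\<Sum>(k, j, r)\<in>T. \<gamma> k j r * F_series \<zz> (2 * k * stab_order \<zz>) j r (nome z))"
    using assms(2) unfolding F_span_def by (elim exE conjE) (rule that; assumption)
  define \<delta> where "\<delta> = (\<lambda>k j r. (if (k, j, r) \<in> S then \<beta> k j r else 0) + (if (k, j, r) \<in> T then \<gamma> k j r else 0))"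
  have "f z + g z = (\<Sum>(k, j, r)\<in>S \<union> T. \<delta> k j r * F_series \<zz> (2 * k * stab_order \<zz>) j r (nome z))"
    if z: "Im z > Im \<zz>" for z
  proof -
    let ?F = "\<lambda>k j r. F_series \<zz> (2 * k * stab_order \<zz>) j r (nome z)"
    have "f z = (\<Sum>(k, j, r)\<in>S \<union> T. (if (k, j, r) \<in> S then \<beta> k j r else 0) * ?F k j r)"
      unfolding S(3)[rule_format, OF z, THEN conjunct2] by (rule sum.mono_neutral_cong_left) (use S T in auto)
    moreover have "g z = (\<Sum>(k, j, r)\<in>S \<union> T. (if (k, j, r) \<in> T then \<gamma> k j r else 0) * ?F k j r)"
      unfolding T(3)[rule_format, OF z, THEN conjunct2] by (rule sum.mono_neutral_cong_left) (use S T in auto)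
    ultimately show ?thesis
      by (simp add: \<delta>_def distrib_right sum.distrib case_prod_unfold)
  qed
  moreover have "\<forall>(k, j, r)\<in>S \<union> T. k \<ge> 1" using S(2) T(2) by blast
  moreover have "\<forall>(k, j, r)\<in>S \<union> T. F_converges \<zz> (2 * k * stab_order \<zz>) j r (nome z)" if "Im z > Im \<zz>" for z
    using S(3) T(3) that by blast
  ultimately show ?thesis unfolding F_span_def using S(1) T(1)
    by (intro exI[of _ "S \<union> T"] exI[of _ \<delta>] conjI allI impI) simp_all
qed

lemma unit_count_stab: "unit_count = 2 * stab_order \<zz>"
  unfolding unit_count_def stab_order_eq using t by auto

text \<open>If the weight is not divisible by \<open>2 * \<omega>\<close> then the series vanishes, and the empty combination represents it.\<close>

lemma F_span_fseries:
  assumes K: "K \<ge> 2 * J + 4" and r: "r \<le> 1"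
  shows "F_span (\<lambda>z. B * fseries r J K (nome z))"
proof (cases "unit_count dvd K")
  case False
  hence "fseries r J K q = 0" for q by (intro fseries_eq_0) (simp add: unit_count_def)
  thus ?thesis using F_span_0 by simp
next
  case True
  then obtain k where k: "K = unit_count * k" by (auto elim: dvdE)
  have K2: "K = 2 * k * stab_order \<zz>" by (simp add: k unit_count_stab mult_ac)
  have k1: "k \<ge> 1" using k K by (cases k) auto
  show ?thesis unfolding F_span_def
  proof (intro exI[of _ "{(k, J, r)}"] exI[of _ "\<lambda>_ _ _. B * of_nat unit_count"] conjI allI impI)
    fix z assume z: "Im z > Im \<zz>"
    show "\<forall>(k, j, r)\<in>{(k, J, r)}. F_converges \<zz> (2 * k * stab_order \<zz>) j r (nome z)"
      using F_series_eq(1)[OF True K r z] by (simp add: K2)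
    show "B * fseries r J K (nome z) =
       (\<Sum>(k, j, r)\<in>{(k, J, r)}. B * of_nat unit_count * F_series \<zz> (2 * k * stab_order \<zz>) j r (nome z))"
      using F_series_eq(2)[OF True K r z] unit_count_pos by (simp add: K2)
  qed (use k1 in auto)
qed

end

context meromorphic_form begin

lemma F_span_form:
  assumes l: "l \<ge> 1"
  shows "F_span (\<lambda>z. E2 z ^ l * F z)"
proof -
  obtain B1 B2 B3 B4 where B: "\<And>z. Im z > Im \<zz> \<Longrightarrow> E2 z ^ l * F z =
      B1 * fseries 0 l m (nome z) + B2 * fseries 0 (l + 1) (m + 2) (nome z)
      + B3 * fseries 1 l (m + 2) (nome z) + B4 * fseries 0 (l - 1) (m - 2) (nome z)"
    using quasimodular_expansion[OF l] by blast
  have "F_span (\<lambda>z. B1 * fseries 0 l m (nome z) + B2 * fseries 0 (l + 1) (m + 2) (nome z)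
      + B3 * fseries 1 l (m + 2) (nome z) + B4 * fseries 0 (l - 1) (m - 2) (nome z))"
    by (intro F_span_add F_span_fseries) (use m l in auto)
  thus ?thesis by (rule F_span_cong) (rule B)
qed

end

lemma elliptic_point_cases:
  assumes "\<zz> \<in> {\<i>, rho}"
  obtains t where "elliptic_point \<zz> t"
proof -
  have "elliptic_point \<i> 0"
    by unfold_locales (auto simp: complex_eq_iff)
  moreover have "elliptic_point rho 1"
  proof
    have "rho = cis (pi / 3)" by (simp add: rho_def cis_conv_exp mult_ac)
    moreover have "sqrt (3 / 4) = sqrt 3 / 2" by (simp add: real_sqrt_divide)
    ultimately show "rho = Complex (real_of_int 1 / 2) (sqrt (1 - real_of_int (1\<^sup>2) / 4))"
      by (simp add: complex_eq_iff cos_60 sin_60)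
  qed simp
  ultimately show thesis using assms that by blast
qed

text \<open>A power series converges absolutely, and hence boundedly, on a smaller disc.\<close>

lemma bounded_at_cusp:
  assumes "Y > 0" "\<And>z. Im z > Y \<Longrightarrow> (\<lambda>n. a n * nome z ^ n) sums F z"
  shows "\<exists>Y C. \<forall>w. Im w > Y \<longrightarrow> norm (F w) \<le> C"
proof -
  define x where "x = nome (\<i> * of_real (Y + 1))"
  have sx: "summable (\<lambda>n. a n * x ^ n)"
    using assms(2)[of "\<i> * of_real (Y + 1)"] by (simp add: x_def sums_iff)
  define y where "y = complex_of_real (exp (- 2 * pi * (Y + 2)))"
  have "norm y < norm x" by (simp add: y_def x_def norm_nome)
  from powser_insidea[OF sx this] have sy: "summable (\<lambda>n. norm (a n * y ^ n))" .
  have "norm (F w) \<le> (\<Sum>n. norm (a n * y ^ n))" if w: "Im w > Y + 2" for w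
  proof -
    have le: "norm (a n * nome w ^ n) \<le> norm (a n * y ^ n)" for n
      unfolding norm_mult norm_power
      by (intro mult_left_mono power_mono) (use w in \<open>auto simp: norm_nome y_def\<close>)
    have sw: "summable (\<lambda>n. norm (a n * nome w ^ n))"
      by (rule summable_comparison_test'[OF sy]) (use le in auto)
    have "F w = (\<Sum>n. a n * nome w ^ n)" using assms(2)[of w] w by (simp add: sums_iff)
    also have "norm \<dots> \<le> (\<Sum>n. norm (a n * nome w ^ n))" by (rule summable_norm[OF sw])
    also have "\<dots> \<le> (\<Sum>n. norm (a n * y ^ n))" by (rule suminf_le[OF le sw sy])
    finally show ?thesis .
  qed
  thus ?thesis by blast
qed

theorem theorem1p3:
  fixes \<zz> :: complex and l \<nu> :: nat and m :: int and F :: "complex \<Rightarrow> complex"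
  assumes "\<zz> \<in> {\<i>, rho}"
    and "l \<ge> 1"
    and "m \<ge> 4 + 2 * int l"
    and "1 \<le> \<nu>" and "\<nu> \<le> 2"
    and "F \<in> mero_forms (2 - m) \<zz> \<nu>"
  shows "\<exists>(S :: (nat \<times> nat \<times> nat) set) (\<beta> :: nat \<Rightarrow> nat \<Rightarrow> nat \<Rightarrow> complex).
           finite S \<and> (\<forall>(k, j, r)\<in>S. k \<ge> 1) \<and>
           (\<forall>z. Im z > Im \<zz> \<longrightarrow>
              (\<forall>(k, j, r)\<in>S. F_converges \<zz> (2 * k * stab_order \<zz>) j r (nome z)) \<and>
              E2 z ^ l * F z =
                (\<Sum>(k, j, r)\<in>S. \<beta> k j r * F_series \<zz> (2 * k * stab_order \<zz>) j r (nome z)))"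
proof -
  obtain t where "elliptic_point \<zz> t" using elliptic_point_cases[OF assms(1)] by blast
  then interpret elliptic_point \<zz> t .
  have nm: "F nicely_meromorphic_on {w. Im w > 0}"
    and mod: "\<And>A w. A \<in> SL2Z \<Longrightarrow> Im w > 0 \<Longrightarrow> F (mobius_action A w) = automorphy_factor A w powi (2 - m) * F w"
    and pol: "\<And>w. Im w > 0 \<Longrightarrow> is_pole F w \<Longrightarrow> (\<exists>A\<in>SL2Z. w = mobius_action A \<zz>) \<and> zorder F w \<ge> - int \<nu>"
    and cusp: "\<exists>a :: nat \<Rightarrow> complex. \<exists>Y > 0. \<forall>z. Im z > Y \<longrightarrow> (\<lambda>n. a n * nome z ^ n) sums F z"
    using assms(6) by (auto simp: mero_forms_def upper_half_plane_def)
  have mod': "F ((of_int a * w + of_int b) / (of_int c * w + of_int d)) = (of_int c * w + of_int d) powi (2 - m) * F w"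
    if "a * d - b * c = 1" "Im w > 0" for a b c d w
    using mod[of "mat2 a b c d" w] that
    by (simp add: SL2Z_def det_mat2 mobius_action_def automorphy_factor_def)
  have "F_span (\<lambda>z. E2 z ^ l * F z)"
  proof (cases "even m")
    case False
    have "F z = 0" if "Im z > Im \<zz>" for z
    proof -
      have "Im z > 0" using that Im_zz_bounds by simp
      hence "F z = (-1) powi (2 - m) * F z" using mod'[of "-1" "-1" 0 0 z] by simp
      moreover have "(-1 :: complex) powi (2 - m) = -1" using False by (simp add: power_int_minus_left)
      ultimately show ?thesis by simp
    qed
    thus ?thesis by (intro F_span_cong[OF F_span_0]) simp
  next
    case True
    define m' where "m' = nat m"
    have m': "m = int m'" using assms(3) by (simp add: m'_def)
    interpret meromorphic_form \<zz> t F l m'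
    proof
      show "F nicely_meromorphic_on {w. Im w > 0}" by (rule nm)
      show "F ((of_int a * w + of_int b) / (of_int c * w + of_int d)) = (of_int c * w + of_int d) powi (2 - int m') * F w"
        if "a * d - b * c = 1" "Im w > 0" for a b c d w
        using mod'[OF that] by (simp add: m')
      show "(\<exists>a b c d. a * d - b * c = 1 \<and> w = (of_int a * \<zz> + of_int b) / (of_int c * \<zz> + of_int d)) \<and> zorder F w \<ge> -2"
        if w: "Im w > 0" "is_pole F w" for w
      proof -
        obtain A where A: "A \<in> SL2Z" "w = mobius_action A \<zz>" and z: "zorder F w \<ge> - int \<nu>"
          using pol[OF w] by blast
        have "(A $ 1 $ 1) * (A $ 2 $ 2) - (A $ 1 $ 2) * (A $ 2 $ 1) = 1"
          using A(1) by (simp add: SL2Z_def det_2)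
        moreover have "w = (of_int (A $ 1 $ 1) * \<zz> + of_int (A $ 1 $ 2)) / (of_int (A $ 2 $ 1) * \<zz> + of_int (A $ 2 $ 2))"
          using A(2) by (simp add: mobius_action_def automorphy_factor_def)
        moreover have "zorder F w \<ge> -2" using z assms(5) by simp
        ultimately show ?thesis by blast
      qed
      show "\<exists>Y C. \<forall>w. Im w > Y \<longrightarrow> norm (F w) \<le> C"
        using cusp bounded_at_cusp by blast
      show "m' \<ge> 2 * l + 4" using assms(3) by (simp add: m')
      show "even m'" using True by (simp add: m')
    qed
    show ?thesis by (rule F_span_form[OF assms(2)])
  qed
  thus ?thesis unfolding F_span_def .
qed

end
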